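(* Let $t$ be an indeterminate over the field $\mathbb{F}_2$ with two elements. The Galois group over $\mathbb{F}_2(t)$ of the polynomial $x^{24}+x+t\in \mathbb{F}_2(t)[x]$, as a permutation group on its $24$ roots, is the Mathieu group $M_{24}$.
   Context: The Galois group of a separable polynomial over a field is the Galois group of its splitting field over that field, regarded as a permutation group on the roots. $M_{24}$ is the Mathieu group in its natural action on $24$ points. *)

theory Defs
  imports
    "HOL-Library.Z2"
    "HOL-Algebra.Algebraic_Closure_Type"
    "HOL-Algebra.Generated_Fields"
    "HOL-Algebra.Bij"
    "HOL-Number_Theory.Residues"
    "HOL-Combinatorics.Permutations"
begin

section \<open>Galois groups of polynomials as permutation groups\<close>

definition ac_roots :: "'a::field poly \<Rightarrow> 'a alg_closure set" where
  "ac_roots p = {x. poly (map_poly to_ac p) x = 0}"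

definition splitting_field :: "'a::field poly \<Rightarrow> 'a alg_closure ring" where
  "splitting_field p = ring_of_type_algebra
     \<lparr>carrier := generate_field ring_of_type_algebra (range to_ac \<union> ac_roots p)\<rparr>"

text \<open>As in \<^const>\<open>auto\<close>, automorphisms are taken to be extensional on the carrier.\<close>

definition galois_group :: "'a::field poly \<Rightarrow> ('a alg_closure \<Rightarrow> 'a alg_closure) set" where
  "galois_group p =
     {\<sigma> \<in> ring_hom (splitting_field p) (splitting_field p) \<inter> Bij (carrier (splitting_field p)).
        \<forall>a. \<sigma> (to_ac a) = to_ac a}"

definition galois_perm_group :: "'a::field poly \<Rightarrow> ('a alg_closure \<Rightarrow> 'a alg_closure) set" where
  "galois_perm_group p =
     {\<pi>. \<pi> permutes ac_roots p \<and> (\<exists>\<sigma>\<in>galois_group p. \<forall>x\<in>ac_roots p. \<pi> x = \<sigma> x)}"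

text \<open>
  A permutation group \<open>G\<close> on \<open>A\<close> is the same permutation group as \<open>H\<close> on \<open>B\<close>, up to relabelling
  the points: some bijection from \<open>A\<close> to \<open>B\<close> transports \<open>G\<close> onto \<open>H\<close>.
\<close>

definition perm_isomorphic ::
  "'a set \<Rightarrow> ('a \<Rightarrow> 'a) set \<Rightarrow> 'b set \<Rightarrow> ('b \<Rightarrow> 'b) set \<Rightarrow> bool" where
  "perm_isomorphic A G B H \<longleftrightarrow>
     (\<exists>h. bij_betw h A B \<and>
        H = {\<rho>. \<rho> permutes B \<and> (\<exists>\<pi>\<in>G. \<forall>x\<in>A. \<rho> (h x) = h (\<pi> x))})"


section \<open>The Mathieu group on 24 points\<close>

text \<open>
  The 24 points are the projective line over the field with 23 elements: \<open>0, \<dots>, 22\<close> are the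
  residues and \<open>23\<close> stands for the point at infinity. The extended binary Golay code is the
  extended quadratic residue code of length 24: identifying a binary word with its support,
  it is spanned under symmetric difference by the whole line and the translates of the set of
  elements that are not squares (infinity being a nonsquare and 0 a square).
  The Mathieu group is the automorphism group of this code.
\<close>

definition golay_points :: "nat set" where
  "golay_points = {0..<24}"

definition golay_generator :: "nat \<Rightarrow> nat set" where
  "golay_generator i = insert 23 {(n + i) mod 23 |n. n < 23 \<and> \<not> QuadRes 23 (int n)}"

inductive_set golay_code :: "nat set set" where
  empty: "{} \<in> golay_code"
| all: "golay_points \<in> golay_code"
| generator: "i < 23 \<Longrightarrow> golay_generator i \<in> golay_code"
| sum: "A \<in> golay_code \<Longrightarrow> B \<in> golay_code \<Longrightarrow> sym_diff A B \<in> golay_code"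

definition M24 :: "(nat \<Rightarrow> nat) set" where
  "M24 = {\<pi>. \<pi> permutes golay_points \<and> (\<lambda>C. \<pi> ` C) ` golay_code = golay_code}"

end

theory Submission
  imports Defs
begin

text \<open>
  Two facts about \<open>f = x ^ 24 + x + t\<close> determine its Galois group: the roots satisfy an additive equation, which
  bounds the group from above, and the polynomial has no multiple root at any point \<open>t = c\<close>, so that
  Frobenius elements bound it from below.

  Upper bound. If \<open>x ^ 24 = x + t\<close>, then
  \<open>x ^ 2048 = t ^ 64 * x ^ 512 + t ^ 8 * x ^ 16 + t ^ 16 * x ^ 8 + x + (t + t ^ 24)\<close> (\<open>linearized\<close>). All exponents of
  \<open>x\<close> are powers of two, so every sum of roots is one of at most 4096 elements. Therefore at least \<open>2 ^ 12\<close>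
  of the \<open>2 ^ 24\<close> sets of roots have sum zero (\<open>card_root_relations\<close>). These sets form a binary code of length 24 that
  the Galois group preserves. At \<open>t = 0\<close> the roots reduce to 0 and the 23rd roots of unity, which
  embeds the code into the extended quadratic residue code. As this has only \<open>2 ^ 12\<close> words, the code is the
  Golay code, and the Galois group is contained in M24 (\<open>golay_labelling_exists\<close>).

  Lower bound. At \<open>t = c + X\<close>, with \<open>c\<close> algebraic over the field with two elements, the roots are power series in \<open>X\<close>.
  The Frobenius map on coefficients yields an element of the Galois group that permutes the roots as the Frobenius map
  permutes the roots of \<open>x ^ 24 + x + c\<close> (\<open>reduction_at_point\<close>, \<open>frobenius_element\<close>). For \<open>c = 0\<close>, for \<open>c = 1\<close>, and for \<open>c\<close> a
  primitive third or fifth root of unity, the cycle types are \<open>1\<^sup>2 11\<^sup>2\<close>, \<open>3 21\<close>, \<open>1 2 7 14\<close> and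
  \<open>1 3 5 15\<close>. The periods 14 and 15 are found by squaring a root 28 and 60 times with the help of the linearized
  equation.

  A subgroup of M24 with such elements is M24 (\<open>M24_subset\<close>). The size of an orbit of a pointwise
  stabilizer is congruent to its number of fixed points under an element of prime order, and the primes 11,
  7 and 5 force 4-fold transitivity. Then the words of weight 8 form a Steiner system, and elements of
  orders 5, 3 and 2 acting on a sextet give 5-fold transitivity. Finally, the group is transitive on the three
  remaining points of an octad and on the 16 points outside, and only the identity of M24 fixes seven suitable points.
\<close>

section \<open>Extending partial embeddings of fields\<close>

definition unital_hom :: "('a::comm_ring_1 \<Rightarrow> 'b::comm_ring_1) \<Rightarrow> bool" where
  "unital_hom f \<longleftrightarrow> f 1 = 1 \<and> (\<forall>x y. f (x + y) = f x + f y) \<and> (\<forall>x y. f (x * y) = f x * f y)"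

lemma unital_homI:
  "f 1 = 1 \<Longrightarrow> (\<And>x y. f (x + y) = f x + f y) \<Longrightarrow> (\<And>x y. f (x * y) = f x * f y) \<Longrightarrow> unital_hom f"
  by (simp add: unital_hom_def)

lemma
  assumes "unital_hom f"
  shows unital_hom_1: "f 1 = 1"
    and unital_hom_add: "f (x + y) = f x + f y"
    and unital_hom_mult: "f (x * y) = f x * f y"
  using assms by (auto simp: unital_hom_def)

lemma unital_hom_0: assumes "unital_hom f" shows "f 0 = 0"
  using unital_hom_add[OF assms, of 0 0] by (metis add_0 add_right_cancel)

lemma unital_hom_uminus: assumes "unital_hom f" shows "f (- x) = - f x"
  using unital_hom_add[OF assms, of x "- x"] unital_hom_0[OF assms] by (metis add.right_inverse eq_neg_iff_add_eq_0 add.commute)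

lemma unital_hom_diff: assumes "unital_hom f" shows "f (x - y) = f x - f y"
  using unital_hom_add[OF assms, of x "- y"] unital_hom_uminus[OF assms] by simp

lemma unital_hom_power: assumes "unital_hom f" shows "f (x ^ n) = f x ^ n"
  by (induction n) (auto simp: unital_hom_1[OF assms] unital_hom_mult[OF assms])

lemma unital_hom_sum: assumes "unital_hom f" shows "f (sum g A) = (\<Sum>a\<in>A. f (g a))"
  by (induction A rule: infinite_finite_induct) (auto simp: unital_hom_0[OF assms] unital_hom_add[OF assms])

lemma unital_hom_eq_0_iff:
  fixes f :: "'a::field \<Rightarrow> 'b::field"
  assumes "unital_hom f" shows "f x = 0 \<longleftrightarrow> x = 0"
proof
  assume "f x = 0"
  show "x = 0"
  proof (rule ccontr)
    assume "x \<noteq> 0"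
    then have "f (x * inverse x) = 1" by (simp add: unital_hom_1[OF assms])
    then show False using \<open>f x = 0\<close> by (simp add: unital_hom_mult[OF assms])
  qed
qed (simp add: unital_hom_0[OF assms])

lemma unital_hom_eq_iff:
  fixes f :: "'a::field \<Rightarrow> 'b::field"
  assumes "unital_hom f" shows "f x = f y \<longleftrightarrow> x = y"
  using unital_hom_eq_0_iff[OF assms, of "x - y"] unital_hom_diff[OF assms, of x y] by simp

lemma unital_hom_inverse:
  fixes f :: "'a::field \<Rightarrow> 'b::field"
  assumes "unital_hom f" shows "f (inverse x) = inverse (f x)"
proof (cases "x = 0")
  case False
  then have "f x * f (inverse x) = 1" by (simp add: unital_hom_1[OF assms] flip: unital_hom_mult[OF assms])
  then show ?thesis by (simp add: inverse_unique)
qed (simp add: unital_hom_0[OF assms])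

text \<open>
  Polynomials over the domain of a partial map with graph \<open>\<Gamma>\<close>, together with their images under it.
\<close>

definition poly_pairs :: "('a::field \<times> 'b::field) set \<Rightarrow> ('a poly \<times> 'b poly) set" where
  "poly_pairs \<Gamma> = {(p, q). \<forall>i. (Polynomial.coeff p i, Polynomial.coeff q i) \<in> \<Gamma>}"

text \<open>
  The graph of an isomorphism between subrings of two fields. Since a graph is closed under
  differences, the last condition expresses both that it is single-valued and that it is injective.
\<close>

locale partial_embedding =
  fixes \<Gamma> :: "('a::field \<times> 'b::field) set"
  assumes one: "(1, 1) \<in> \<Gamma>"
    and uminus: "(a, b) \<in> \<Gamma> \<Longrightarrow> (- a, - b) \<in> \<Gamma>"
    and add: "(a, b) \<in> \<Gamma> \<Longrightarrow> (c, d) \<in> \<Gamma> \<Longrightarrow> (a + c, b + d) \<in> \<Gamma>"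
    and mult: "(a, b) \<in> \<Gamma> \<Longrightarrow> (c, d) \<in> \<Gamma> \<Longrightarrow> (a * c, b * d) \<in> \<Gamma>"
    and zero_iff: "(a, b) \<in> \<Gamma> \<Longrightarrow> a = 0 \<longleftrightarrow> b = 0"
begin

lemma zero: "(0, 0) \<in> \<Gamma>"
  using add[OF one uminus[OF one]] by simp

lemma diff: "(a, b) \<in> \<Gamma> \<Longrightarrow> (c, d) \<in> \<Gamma> \<Longrightarrow> (a - c, b - d) \<in> \<Gamma>"
  using add[OF _ uminus] by force

lemma eq_iff: "(a, b) \<in> \<Gamma> \<Longrightarrow> (c, d) \<in> \<Gamma> \<Longrightarrow> a = c \<longleftrightarrow> b = d"
  using zero_iff[OF diff] by force

lemma sum: "(\<And>i. i \<in> I \<Longrightarrow> (f i, g i) \<in> \<Gamma>) \<Longrightarrow> (sum f I, sum g I) \<in> \<Gamma>"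
  by (induction I rule: infinite_finite_induct) (auto simp: zero add)

lemma pairs_add: "(p, q) \<in> poly_pairs \<Gamma> \<Longrightarrow> (r, s) \<in> poly_pairs \<Gamma> \<Longrightarrow> (p + r, q + s) \<in> poly_pairs \<Gamma>"
  by (auto simp: poly_pairs_def add)

lemma pairs_diff: "(p, q) \<in> poly_pairs \<Gamma> \<Longrightarrow> (r, s) \<in> poly_pairs \<Gamma> \<Longrightarrow> (p - r, q - s) \<in> poly_pairs \<Gamma>"
  by (auto simp: poly_pairs_def diff)

lemma pairs_uminus: "(p, q) \<in> poly_pairs \<Gamma> \<Longrightarrow> (- p, - q) \<in> poly_pairs \<Gamma>"
  by (auto simp: poly_pairs_def uminus)

lemma pairs_mult: "(p, q) \<in> poly_pairs \<Gamma> \<Longrightarrow> (r, s) \<in> poly_pairs \<Gamma> \<Longrightarrow> (p * r, q * s) \<in> poly_pairs \<Gamma>"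
  by (auto simp: poly_pairs_def coeff_mult intro!: sum mult)

lemma pairs_monom: "(a, b) \<in> \<Gamma> \<Longrightarrow> (Polynomial.monom a n, Polynomial.monom b n) \<in> poly_pairs \<Gamma>"
  by (auto simp: poly_pairs_def zero)

lemma pairs_smult: "(a, b) \<in> \<Gamma> \<Longrightarrow> (p, q) \<in> poly_pairs \<Gamma> \<Longrightarrow> (Polynomial.smult a p, Polynomial.smult b q) \<in> poly_pairs \<Gamma>"
  by (auto simp: poly_pairs_def mult)

lemma pairs_0: "(0, 0) \<in> poly_pairs \<Gamma>"
  by (auto simp: poly_pairs_def zero)

lemma pairs_coeff: "(p, q) \<in> poly_pairs \<Gamma> \<Longrightarrow> (Polynomial.coeff p i, Polynomial.coeff q i) \<in> \<Gamma>"
  by (auto simp: poly_pairs_def)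

lemma pairs_eq_0_iff: "(p, q) \<in> poly_pairs \<Gamma> \<Longrightarrow> p = 0 \<longleftrightarrow> q = 0"
  using zero_iff[OF pairs_coeff] by (auto simp: poly_eq_iff)

lemma pairs_degree: assumes "(p, q) \<in> poly_pairs \<Gamma>" shows "Polynomial.degree p = Polynomial.degree q"
proof -
  have "Polynomial.coeff p i = 0 \<longleftrightarrow> Polynomial.coeff q i = 0" for i
    using zero_iff[OF pairs_coeff[OF assms]] .
  then show ?thesis by (simp add: Polynomial.degree_def)
qed

text \<open>
  The domain is only a ring, so the dividend is first multiplied by a power of the leading
  coefficient of the divisor.
\<close>

lemma pairs_pseudo_division:
  assumes "(p, q) \<in> poly_pairs \<Gamma>" "p \<noteq> 0" "(u, v) \<in> poly_pairs \<Gamma>"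
  shows "\<exists>c d s s' r r'. (c, d) \<in> \<Gamma> \<and> c \<noteq> 0 \<and> (s, s') \<in> poly_pairs \<Gamma> \<and> (r, r') \<in> poly_pairs \<Gamma> \<and>
    Polynomial.smult c u = p * s + r \<and> Polynomial.smult d v = q * s' + r' \<and> (r = 0 \<or> Polynomial.degree r < Polynomial.degree p)"
  using assms(3)
proof (induction "Polynomial.degree u" arbitrary: u v rule: less_induct)
  case less
  show ?case
  proof (cases "u = 0 \<or> Polynomial.degree u < Polynomial.degree p")
    case True
    then show ?thesis using less.prems one pairs_0
      by (intro exI[of _ 1] exI[of _ 0] exI[of _ u] exI[of _ v] conjI) auto
  next
    case False
    define n where "n = Polynomial.degree u - Polynomial.degree p"
    define a b where "a = Polynomial.lead_coeff p" and "b = Polynomial.lead_coeff q"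
    define e f where "e = Polynomial.lead_coeff u" and "f = Polynomial.lead_coeff v"
    have ab: "(a, b) \<in> \<Gamma>" unfolding a_def b_def using pairs_coeff[OF assms(1)] pairs_degree[OF assms(1)] by metis
    have ef: "(e, f) \<in> \<Gamma>" unfolding e_def f_def using pairs_coeff[OF less.prems] pairs_degree[OF less.prems] by metis
    have a0: "a \<noteq> 0" using assms by (simp add: a_def)
    define u' v' where "u' = Polynomial.smult a u - Polynomial.monom e n * p" and "v' = Polynomial.smult b v - Polynomial.monom f n * q"
    have uv': "(u', v') \<in> poly_pairs \<Gamma>" unfolding u'_def v'_def
      by (intro pairs_diff pairs_mult pairs_smult pairs_monom ab ef less.prems assms(1))
    have degu: "Polynomial.degree u = n + Polynomial.degree p" using False by (simp add: n_def)
    have "Polynomial.degree u' \<le> Polynomial.degree u" unfolding u'_def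
      by (rule degree_diff_le) (auto simp: degu intro!: order.trans[OF degree_mult_le] degree_monom_le)
    moreover have "Polynomial.coeff u' (Polynomial.degree u) = 0"
      unfolding u'_def by (simp add: coeff_monom_mult degu a_def e_def)
    ultimately have cases: "u' = 0 \<or> Polynomial.degree u' < Polynomial.degree u"
      using leading_coeff_0_iff le_neq_implies_less by metis
    have "\<exists>c d s s' r r'. (c, d) \<in> \<Gamma> \<and> c \<noteq> 0 \<and> (s, s') \<in> poly_pairs \<Gamma> \<and> (r, r') \<in> poly_pairs \<Gamma> \<and>
      Polynomial.smult c u' = p * s + r \<and> Polynomial.smult d v' = q * s' + r' \<and> (r = 0 \<or> Polynomial.degree r < Polynomial.degree p)"
    proof (cases "u' = 0")
      case True
      then have "v' = 0" using pairs_eq_0_iff[OF uv'] by simp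
      then show ?thesis using True one pairs_0
        by (intro exI[of _ 1] exI[of _ 0] conjI) auto
    next
      case False
      then show ?thesis using cases less.hyps[OF _ uv'] by blast
    qed
    then obtain c d s s' r r' where *: "(c, d) \<in> \<Gamma>" "c \<noteq> 0" "(s, s') \<in> poly_pairs \<Gamma>" "(r, r') \<in> poly_pairs \<Gamma>"
      "Polynomial.smult c u' = p * s + r" "Polynomial.smult d v' = q * s' + r'" "r = 0 \<or> Polynomial.degree r < Polynomial.degree p"
      by blast
    have 1: "Polynomial.smult (c * a) u = p * (s + Polynomial.monom (c * e) n) + r"
      using *(5) unfolding u'_def by (simp add: algebra_simps smult_diff_right smult_monom_mult flip: smult_monom)
    have 2: "Polynomial.smult (d * b) v = q * (s' + Polynomial.monom (d * f) n) + r'"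
      using *(6) unfolding v'_def by (simp add: algebra_simps smult_diff_right smult_monom_mult flip: smult_monom)
    show ?thesis
      using 1 2 * a0 mult[OF *(1) ab] pairs_add[OF *(3) pairs_monom[OF mult[OF *(1) ef], of n]]
      by (intro exI[of _ "c * a"] exI[of _ "d * b"] exI[of _ "s + Polynomial.monom (c * e) n"]
          exI[of _ "s' + Polynomial.monom (d * f) n"] exI[of _ r] exI[of _ r']) auto
  qed
qed

end


lemma partial_embedding_Union:
  assumes "C \<noteq> {}" "\<And>\<Gamma>. \<Gamma> \<in> C \<Longrightarrow> partial_embedding \<Gamma>" "\<And>\<Gamma> \<Delta>. \<Gamma> \<in> C \<Longrightarrow> \<Delta> \<in> C \<Longrightarrow> \<Gamma> \<subseteq> \<Delta> \<or> \<Delta> \<subseteq> \<Gamma>"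
  shows "partial_embedding (\<Union>C)"
proof
  have two: "\<exists>\<Gamma>\<in>C. u \<in> \<Gamma> \<and> v \<in> \<Gamma>" if "u \<in> \<Union>C" "v \<in> \<Union>C" for u v
    using that assms(3) by blast
  show "(1, 1) \<in> \<Union>C" using assms(1,2) partial_embedding.one by blast
  show "(- a, - b) \<in> \<Union>C" if "(a, b) \<in> \<Union>C" for a b
    using that assms(2) partial_embedding.uminus by blast
  show "(a + c, b + d) \<in> \<Union>C" if "(a, b) \<in> \<Union>C" "(c, d) \<in> \<Union>C" for a b c d
    using two[OF that] assms(2) partial_embedding.add by blast
  show "(a * c, b * d) \<in> \<Union>C" if "(a, b) \<in> \<Union>C" "(c, d) \<in> \<Union>C" for a b c d
    using two[OF that] assms(2) partial_embedding.mult by blast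
  show "a = 0 \<longleftrightarrow> b = 0" if "(a, b) \<in> \<Union>C" for a b
    using that assms(2) partial_embedding.zero_iff by blast
qed

text \<open>
  Let \<open>p\<close> be of minimal degree among the polynomials over the domain that vanish at \<open>x\<close>, and let
  \<open>q\<close> be its image. Sending \<open>x\<close> to a root \<open>y\<close> of \<open>q\<close> is well defined and injective if \<open>q\<close> is minimal
  for \<open>y\<close> as well. A minimal counterexample \<open>b\<close> would divide a multiple of \<open>q\<close>; its partner \<open>a\<close> would then
  divide a multiple of \<open>p\<close>, and one of the two factors, both of smaller degree than \<open>p\<close>, would
  vanish at \<open>x\<close>.
\<close>

lemma (in partial_embedding) extend:
  fixes x :: 'a
  assumes alg: "(p0, q0) \<in> poly_pairs \<Gamma>" "p0 \<noteq> 0" "poly p0 x = 0"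
    and closed: "\<And>q :: 'b poly. Polynomial.degree q > 0 \<Longrightarrow> \<exists>y. poly q y = 0"
  shows "\<exists>\<Delta> y. partial_embedding \<Delta> \<and> \<Gamma> \<subseteq> \<Delta> \<and> (x, y) \<in> \<Delta>"
proof -
  define P where "P = (\<lambda>n. \<exists>p q. (p, q) \<in> poly_pairs \<Gamma> \<and> p \<noteq> 0 \<and> poly p x = 0 \<and> Polynomial.degree p = n)"
  have "P (Polynomial.degree p0)" unfolding P_def using alg by blast
  then have "P (LEAST n. P n)" by (rule LeastI)
  then obtain p q where pq: "(p, q) \<in> poly_pairs \<Gamma>" "p \<noteq> 0" "poly p x = 0" "Polynomial.degree p = (LEAST n. P n)"
    unfolding P_def by blast
  have min: "r = 0" if "(r, r') \<in> poly_pairs \<Gamma>" "poly r x = 0" "Polynomial.degree r < Polynomial.degree p" for r r'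
    using not_less_Least[of "Polynomial.degree r" P] that pq(4) unfolding P_def by auto
  have "Polynomial.degree p > 0"
  proof (rule ccontr)
    assume "\<not> ?thesis"
    then obtain c where "p = [:c:]" using degree_eq_zeroE by blast
    then show False using pq by simp
  qed
  then obtain y where y: "poly q y = 0" using closed pairs_degree[OF pq(1)] by metis
  have min': "r' = 0" if r: "(r, r') \<in> poly_pairs \<Gamma>" "poly r' y = 0" "Polynomial.degree r' < Polynomial.degree q" for r r'
  proof (rule ccontr)
    define Q where "Q = (\<lambda>n. \<exists>a b. (a, b) \<in> poly_pairs \<Gamma> \<and> b \<noteq> 0 \<and> poly b y = 0 \<and> Polynomial.degree b = n)"
    assume "r' \<noteq> 0"
    then have Qr: "Q (Polynomial.degree r')" unfolding Q_def using r by blast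
    then have "Q (LEAST n. Q n)" by (rule LeastI)
    then obtain a b where ab: "(a, b) \<in> poly_pairs \<Gamma>" "b \<noteq> 0" "poly b y = 0" "Polynomial.degree b = (LEAST n. Q n)"
      unfolding Q_def by blast
    have b_less: "Polynomial.degree b < Polynomial.degree q" using Least_le[of Q, OF Qr] ab(4) r(3) by simp
    have a0: "a \<noteq> 0" using ab pairs_eq_0_iff by blast
    obtain c d s s' w w' where *: "(c, d) \<in> \<Gamma>" "c \<noteq> 0" "(s, s') \<in> poly_pairs \<Gamma>" "(w, w') \<in> poly_pairs \<Gamma>"
      "Polynomial.smult c p = a * s + w" "Polynomial.smult d q = b * s' + w'" "w = 0 \<or> Polynomial.degree w < Polynomial.degree a"
      using pairs_pseudo_division[OF ab(1) a0 pq(1)] by blast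
    have "poly w' y = 0" using arg_cong[OF *(6), of "\<lambda>u. poly u y"] y ab(3) by simp
    moreover have "w' = 0 \<or> Polynomial.degree w' < Polynomial.degree b"
      using *(7) pairs_eq_0_iff[OF *(4)] pairs_degree[OF *(4)] pairs_degree[OF ab(1)] by auto
    ultimately have "w' = 0"
      using not_less_Least[of "Polynomial.degree w'" Q] ab(4) *(4) unfolding Q_def by auto
    then have w0: "w = 0" using pairs_eq_0_iff[OF *(4)] by simp
    then have eq: "Polynomial.smult c p = a * s" using *(5) by simp
    then have s0: "s \<noteq> 0" using pq(2) *(2) by auto
    have deg: "Polynomial.degree p = Polynomial.degree a + Polynomial.degree s"
      using arg_cong[OF eq, of Polynomial.degree] *(2) a0 s0 by (simp add: degree_mult_eq)
    have da: "Polynomial.degree a < Polynomial.degree p" using b_less pairs_degree[OF ab(1)] pairs_degree[OF pq(1)] by simp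
    have "Polynomial.degree a > 0"
    proof (rule ccontr)
      assume "\<not> ?thesis"
      then have "Polynomial.degree b = 0" using pairs_degree[OF ab(1)] by simp
      then obtain e where "b = [:e:]" using degree_eq_zeroE by blast
      then show False using ab by simp
    qed
    then have ds: "Polynomial.degree s < Polynomial.degree p" using deg by simp
    have "poly a x * poly s x = 0" using arg_cong[OF eq, of "\<lambda>u. poly u x"] pq(3) by simp
    then show False using min[OF ab(1) _ da] min[OF *(3) _ ds] a0 s0 by auto
  qed
  have key: "poly u x = 0 \<longleftrightarrow> poly v y = 0" if uv: "(u, v) \<in> poly_pairs \<Gamma>" for u v
  proof -
    obtain c d s s' w w' where *: "(c, d) \<in> \<Gamma>" "c \<noteq> 0" "(s, s') \<in> poly_pairs \<Gamma>" "(w, w') \<in> poly_pairs \<Gamma>"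
      "Polynomial.smult c u = p * s + w" "Polynomial.smult d v = q * s' + w'" "w = 0 \<or> Polynomial.degree w < Polynomial.degree p"
      using pairs_pseudo_division[OF pq(1,2) uv] by blast
    have d0: "d \<noteq> 0" using zero_iff[OF *(1)] *(2) by simp
    have w'_cases: "w' = 0 \<or> Polynomial.degree w' < Polynomial.degree q"
      using *(7) pairs_eq_0_iff[OF *(4)] pairs_degree[OF *(4)] pairs_degree[OF pq(1)] by auto
    have "c * poly u x = poly w x" using arg_cong[OF *(5), of "\<lambda>u. poly u x"] pq(3) by simp
    then have "poly u x = 0 \<longleftrightarrow> poly w x = 0" using *(2) by (metis mult_eq_0_iff)
    also have "\<dots> \<longleftrightarrow> w = 0" using min[OF *(4)] *(7) by auto
    also have "\<dots> \<longleftrightarrow> w' = 0" using pairs_eq_0_iff[OF *(4)] .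
    also have "\<dots> \<longleftrightarrow> poly w' y = 0" using min'[OF *(4)] w'_cases by auto
    also have "\<dots> \<longleftrightarrow> poly v y = 0"
    proof -
      have "d * poly v y = poly w' y" using arg_cong[OF *(6), of "\<lambda>u. poly u y"] y by simp
      then show ?thesis using d0 by (metis mult_eq_0_iff)
    qed
    finally show ?thesis .
  qed
  define \<Delta> where "\<Delta> = {(poly u x, poly v y) | u v. (u, v) \<in> poly_pairs \<Gamma>}"
  have \<Delta>I: "(poly u x, poly v y) \<in> \<Delta>" if "(u, v) \<in> poly_pairs \<Gamma>" for u v
    using that unfolding \<Delta>_def by blast
  have const: "(a, b) \<in> \<Delta>" if "(a, b) \<in> \<Gamma>" for a b
    using \<Delta>I[OF pairs_monom[OF that, of 0]] by (simp add: poly_monom)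
  have "partial_embedding \<Delta>"
  proof
    show "(1, 1) \<in> \<Delta>" by (rule const[OF one])
    show "(- a, - b) \<in> \<Delta>" if "(a, b) \<in> \<Delta>" for a b
      using that \<Delta>I[OF pairs_uminus] unfolding \<Delta>_def by auto
    show "(a + c, b + d) \<in> \<Delta>" if "(a, b) \<in> \<Delta>" "(c, d) \<in> \<Delta>" for a b c d
      using that \<Delta>I[OF pairs_add] unfolding \<Delta>_def by auto
    show "(a * c, b * d) \<in> \<Delta>" if "(a, b) \<in> \<Delta>" "(c, d) \<in> \<Delta>" for a b c d
      using that \<Delta>I[OF pairs_mult] unfolding \<Delta>_def by auto
    show "a = 0 \<longleftrightarrow> b = 0" if "(a, b) \<in> \<Delta>" for a b
      using that key unfolding \<Delta>_def by auto
  qed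
  moreover have "\<Gamma> \<subseteq> \<Delta>" using const by auto
  moreover have "(x, y) \<in> \<Delta>" using \<Delta>I[OF pairs_monom[OF one, of 1]] by (simp add: poly_monom)
  ultimately show ?thesis by blast
qed


text \<open>
  By Zorn's lemma: a maximal partial embedding cannot be extended to any further algebraic element.
\<close>

theorem partial_embedding_maximal:
  fixes \<Gamma> :: "('a::field \<times> 'b::alg_closed_field) set"
  assumes "partial_embedding \<Gamma>"
  obtains \<Delta> where "partial_embedding \<Delta>" "\<Gamma> \<subseteq> \<Delta>"
    "\<And>p q x. (p, q) \<in> poly_pairs \<Delta> \<Longrightarrow> p \<noteq> 0 \<Longrightarrow> poly p x = 0 \<Longrightarrow> \<exists>y. (x, y) \<in> \<Delta>"
proof -
  define A where "A = {\<Delta>. partial_embedding \<Delta> \<and> \<Gamma> \<subseteq> \<Delta>}"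
  have "\<exists>M\<in>A. \<forall>N\<in>A. M \<subseteq> N \<longrightarrow> N = M"
  proof (rule subset_Zorn_nonempty)
    show "A \<noteq> {}" using assms unfolding A_def by blast
    fix C assume C: "C \<noteq> {}" "subset.chain A C"
    have "partial_embedding (\<Union>C)"
    proof (rule partial_embedding_Union[OF C(1)])
      show "partial_embedding \<Delta>" if "\<Delta> \<in> C" for \<Delta>
        using that C(2) unfolding subset.chain_def A_def by blast
      show "\<Delta> \<subseteq> \<Delta>' \<or> \<Delta>' \<subseteq> \<Delta>" if "\<Delta> \<in> C" "\<Delta>' \<in> C" for \<Delta> \<Delta>'
        using that C(2) unfolding subset_chain_def by blast
    qed
    then show "\<Union>C \<in> A" using C unfolding subset.chain_def A_def by blast
  qed
  then obtain M where MA: "M \<in> A" and MA_max: "\<forall>N\<in>A. M \<subseteq> N \<longrightarrow> N = M" by (rule bexE)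
  have M: "partial_embedding M" "\<Gamma> \<subseteq> M" using MA by (simp_all add: A_def)
  have max: "N = M" if "partial_embedding N" "\<Gamma> \<subseteq> N" "M \<subseteq> N" for N
    using MA_max that by (simp add: A_def)
  interpret partial_embedding M by (rule M(1))
  show thesis
  proof (rule that[OF M])
    fix p q x assume pq: "(p, q) \<in> poly_pairs M" "p \<noteq> 0" "poly p x = 0"
    obtain \<Delta> y where "partial_embedding \<Delta>" "M \<subseteq> \<Delta>" "(x, y) \<in> \<Delta>"
      using extend[OF pq] by (auto simp: alg_closed_imp_poly_has_root)
    then show "\<exists>y. (x, y) \<in> M" using max[of \<Delta>] M(2) by blast
  qed
qed

text \<open>
  A fraction \<open>a / b\<close> is a root of \<open>b X - a\<close>, so a maximal extension first contains the fraction field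
  of \<open>'r\<close> and then everything algebraic over it.
\<close>

theorem alg_closure_extension:
  fixes \<Gamma> :: "('r::idom fract alg_closure \<times> 'b::alg_closed_field) set"
  assumes "partial_embedding \<Gamma>" and base: "\<And>r. \<exists>y. (to_ac (to_fract r), y) \<in> \<Gamma>"
  obtains \<psi> where "unital_hom \<psi>" "\<And>x y. (x, y) \<in> \<Gamma> \<Longrightarrow> \<psi> x = y"
proof -
  obtain M where M: "partial_embedding M" "\<Gamma> \<subseteq> M" and
    closed: "\<And>p q x. (p, q) \<in> poly_pairs M \<Longrightarrow> p \<noteq> 0 \<Longrightarrow> poly p x = 0 \<Longrightarrow> \<exists>y. (x, y) \<in> M"
    using partial_embedding_maximal[OF assms(1)] by metis
  interpret partial_embedding M by (rule M(1))
  have fractions: "\<exists>y. (to_ac z, y) \<in> M" for z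
  proof -
    obtain a b where z: "z = Fract a b" "b \<noteq> 0" by (cases z)
    obtain a' b' where a': "(to_ac (to_fract a), a') \<in> M" and b': "(to_ac (to_fract b), b') \<in> M"
      using base M(2) by blast
    show ?thesis
    proof (rule closed)
      show "([:- to_ac (to_fract a), to_ac (to_fract b):], [:- a', b':]) \<in> poly_pairs M"
        using a' b' by (auto simp: poly_pairs_def zero uminus coeff_pCons split: nat.split)
      show "[:- to_ac (to_fract a), to_ac (to_fract b):] \<noteq> 0" using z(2) by simp
      show "poly [:- to_ac (to_fract a), to_ac (to_fract b):] (to_ac z) = 0"
      proof -
        have "z * to_fract b = to_fract a" using z by (simp add: Fract_conv_to_fract)
        then have "to_ac z * to_ac (to_fract b) = to_ac (to_fract a)" by (simp flip: to_ac_mult)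
        then show ?thesis by simp
      qed
    qed
  qed
  have total: "\<exists>y. (x, y) \<in> M" for x
  proof -
    obtain p :: "'r fract poly" where p: "p \<noteq> 0" "poly (map_poly to_ac p) x = 0" by (rule alg_closure_algebraic)
    define h where "h z = (if z = 0 then 0 else SOME y. (to_ac z, y) \<in> M)" for z
    have h: "(to_ac z, h z) \<in> M" for z
      using someI_ex[OF fractions[of z]] zero by (simp add: h_def)
    have "(map_poly to_ac p, map_poly h p) \<in> poly_pairs M"
      using h by (simp add: poly_pairs_def coeff_map_poly h_def[of 0])
    then show ?thesis by (rule closed) (use p in \<open>auto simp: map_poly_eq_0_iff\<close>)
  qed
  define \<psi> where "\<psi> x = (SOME y. (x, y) \<in> M)" for x
  have \<psi>: "(x, \<psi> x) \<in> M" for x unfolding \<psi>_def by (rule someI_ex[OF total])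
  have \<psi>I: "\<psi> x = y" if "(x, y) \<in> M" for x y using eq_iff[OF \<psi>[of x] that] by simp
  have "unital_hom \<psi>"
    by (intro unital_homI \<psi>I one add mult \<psi>)
  then show thesis using \<psi>I M(2) by (intro that) auto
qed

section \<open>Characteristic two\<close>

text \<open>
  With \<open>1 + 1 = 0\<close> in a class of its own, the simplifier turns all signs into \<open>+\<close> and cancels
  repeated summands, in fields, polynomials and power series alike.
\<close>

class char_2 = comm_ring_1 +
  assumes one_plus_one: "1 + 1 = 0"
begin

lemma add_self [simp]: "x + x = 0"
  by (metis distrib_left mult_1_right mult_zero_right one_plus_one)

lemma add_self_left [simp]: "x + (x + y) = y"
  by (simp flip: add.assoc)

lemma uminus_eq [simp]: "- x = x"
  by (rule minus_unique) simp

lemma diff_eq [simp]: "x - y = x + y"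
  using diff_conv_add_uminus[of x y] by simp

lemma of_nat_char_2: "of_nat n = of_bool (odd n)"
  by (induction n) (auto simp: one_plus_one)

lemma add_eq_0_iff_char_2: "x + y = 0 \<longleftrightarrow> x = y"
  using eq_iff_diff_eq_0[of x y] by simp

lemma power2_add: "(x + y) ^ 2 = x ^ 2 + y ^ 2"
  by (simp add: power2_eq_square algebra_simps)

lemma frobenius_add: "(x + y) ^ (2 ^ n) = x ^ (2 ^ n) + y ^ (2 ^ n)"
proof (induction n arbitrary: x y)
  case (Suc n)
  have "(x + y) ^ 2 ^ Suc n = (x ^ 2 + y ^ 2) ^ 2 ^ n" by (simp add: power_mult power2_add)
  then show ?case by (simp add: Suc.IH power_mult)
qed simp

lemma frobenius_sum: "sum f A ^ (2 ^ n) = (\<Sum>a\<in>A. f a ^ (2 ^ n))"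
  by (induction A rule: infinite_finite_induct) (auto simp: frobenius_add power_0_left)

end

instance bit :: char_2
  by standard simp

instance poly :: (char_2) char_2
  by standard (simp add: one_pCons one_plus_one)

instance fps :: (char_2) char_2
proof
  have "(1 + 1 :: 'a fps) = fps_const (1 + 1)" by (simp only: fps_const_add[symmetric] fps_const_1_eq_1)
  then show "(1 + 1 :: 'a fps) = 0" by (simp only: one_plus_one fps_const_0_eq_0)
qed

class idom_char_2 = idom + char_2
class field_char_2 = field + char_2
subclass (in field_char_2) idom_char_2 ..

instance bit :: field_char_2 ..
instance poly :: (idom_char_2) idom_char_2 ..
instance fps :: (idom_char_2) idom_char_2 ..

instance fract :: (idom_char_2) field_char_2
proof
  have "(1 + 1 :: 'a fract) = to_fract (1 + 1)" by (simp only: to_fract_add to_fract_1)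
  then show "(1 + 1 :: 'a fract) = 0" by (simp only: one_plus_one to_fract_0)
qed

instance alg_closure :: (field_char_2) field_char_2
proof
  have "(1 + 1 :: 'a alg_closure) = to_ac (1 + 1)" by (simp only: to_ac_add to_ac_1)
  then show "(1 + 1 :: 'a alg_closure) = 0" by (simp only: one_plus_one to_ac_0)
qed

text \<open>
  If \<open>p = (X - x) q\<close>, then \<open>p' = q + (X - x) q'\<close>; hence \<open>q\<close> does not vanish at \<open>x\<close> and has no
  multiple root either.
\<close>

lemma card_roots_separable:
  fixes p :: "'a::alg_closed_field poly"
  assumes "p \<noteq> 0" "\<And>x. poly p x = 0 \<Longrightarrow> poly (pderiv p) x \<noteq> 0"
  shows "card {x. poly p x = 0} = Polynomial.degree p"
  using assms
proof (induction "Polynomial.degree p" arbitrary: p)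
  case 0
  then obtain c where "p = [:c:]" "c \<noteq> 0" by (metis degree_eq_zeroE pCons_0_0)
  then show ?case by simp
next
  case (Suc n)
  then obtain x where x: "poly p x = 0" using alg_closed_imp_poly_has_root[of p] by auto
  then have "[:- x, 1:] dvd p" using poly_eq_0_iff_dvd by blast
  then obtain q where pq: "p = [:- x, 1:] * q" by (rule dvdE)
  have q0: "q \<noteq> 0" using pq Suc.prems by auto
  have deg: "Polynomial.degree p = Suc (Polynomial.degree q)" using q0 unfolding pq by (subst degree_mult_eq) auto
  have der: "poly (pderiv p) a = poly q a + (a - x) * poly (pderiv q) a" for a
    unfolding pq pderiv_mult by (simp add: pderiv_pCons algebra_simps)
  have "poly (pderiv q) a \<noteq> 0" if "poly q a = 0" for a
    using Suc.prems(2)[of a] that der[of a] by (auto simp: pq)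
  then have IH: "card {x. poly q x = 0} = Polynomial.degree q"
    using Suc.hyps q0 deg by simp
  have "poly q x \<noteq> 0" using Suc.prems(2)[OF x] der[of x] by simp
  moreover have "{a. poly p a = 0} = insert x {a. poly q a = 0}" by (auto simp: pq)
  moreover have "finite {a. poly q a = 0}" using q0 poly_roots_finite by blast
  ultimately show ?case using IH deg by simp
qed

definition root_set :: "'a::field \<Rightarrow> 'a set" where
  "root_set c = {x. x ^ 24 + x + c = 0}"

text \<open>
  The derivative of \<open>x ^ 24 + x + c\<close> is \<open>1\<close>, so there is no multiple root for any \<open>c\<close>.
\<close>

lemma card_root_set:
  fixes c :: "'a::{alg_closed_field,field_char_2}"
  shows "card (root_set c) = 24"
proof -
  define p where "p = Polynomial.monom 1 24 + [:c, 1:]"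
  have deg: "Polynomial.degree p = 24"
    unfolding p_def by (subst degree_add_eq_left) (auto simp: degree_monom_eq)
  have "pderiv p = [:of_nat 24 :: 'a:] * Polynomial.monom 1 23 + 1"
    by (simp add: p_def pderiv_add pderiv_monom pderiv_pCons smult_monom)
  also have "of_nat 24 = (0 :: 'a)" by (simp only: of_nat_char_2) simp
  finally have der: "pderiv p = 1" by simp
  have "card {x. poly p x = 0} = Polynomial.degree p"
    by (rule card_roots_separable) (use deg der in auto)
  moreover have "{x. poly p x = 0} = root_set c"
    by (auto simp: p_def root_set_def poly_monom algebra_simps)
  ultimately show ?thesis using deg by simp
qed

lemma finite_root_set: "finite (root_set (c :: 'a::{alg_closed_field,field_char_2}))"
  by (rule card_ge_0_finite) (simp add: card_root_set)

section \<open>Power series roots\<close>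

lemma power24_eq: "(x :: 'a::comm_ring_1) ^ 24 = (x ^ 3) ^ 2 ^ 3"
  by (simp flip: power_mult)

text \<open>
  Hensel's lemma for this equation: the iteration \<open>F \<mapsto> F ^ 24 + c + X\<close> contracts, because
  \<open>F ^ 24 + H ^ 24 = (F ^ 3 + H ^ 3) ^ 8\<close> is divisible by \<open>(F + H) ^ 2\<close>. So the coefficients of the iterates
  that start at \<open>a\<close> become stationary.
\<close>

lemma fps_root_exists:
  fixes a c :: "'a::{idom_char_2}"
  assumes "a ^ 24 + a + c = 0"
  shows "\<exists>F. F ^ 24 + F + (fps_const c + fps_X) = 0 \<and> fps_nth F 0 = a"
proof -
  define C where "C = fps_const c + fps_X"
  define G where "G = rec_nat (fps_const a) (\<lambda>_ F. F ^ 24 + C)"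
  have G0: "G 0 = fps_const a" and GS: "\<And>n. G (Suc n) = G n ^ 24 + C" by (simp_all add: G_def)
  have ac: "a ^ 24 + c = a" using assms by (metis add.commute add.left_commute add_eq_0_iff_char_2)
  have dvd24: "fps_X ^ Suc n dvd F ^ 24 + H ^ 24" if "fps_X ^ Suc n dvd F + H" for n and F H :: "'a fps"
  proof -
    have "F ^ 24 + H ^ 24 = ((F + H) * (F ^ 2 + F * H + H ^ 2)) ^ 2 ^ 3"
      unfolding power24_eq by (simp only: frobenius_add[symmetric]) (simp add: power2_eq_square power3_eq_cube algebra_simps)
    also have "(F + H) dvd \<dots>" by (metis dvd_triv_left dvd_power dvd_trans zero_less_numeral zero_less_power)
    finally show ?thesis using that by (rule dvd_trans[rotated])
  qed
  have dvd24': "fps_X ^ Suc (Suc n) dvd F ^ 24 + H ^ 24" if "fps_X ^ Suc n dvd F + H" for n and F H :: "'a fps"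
  proof -
    have "F ^ 24 + H ^ 24 = (F + H) ^ 2 * ((F + H) ^ 6 * (F ^ 2 + F * H + H ^ 2) ^ 8)"
    proof -
      have "F ^ 24 + H ^ 24 = ((F + H) * (F ^ 2 + F * H + H ^ 2)) ^ 2 ^ 3"
        unfolding power24_eq by (simp only: frobenius_add[symmetric]) (simp add: power2_eq_square power3_eq_cube algebra_simps)
      then show ?thesis by (simp add: power_mult_distrib flip: power_add mult.assoc)
    qed
    moreover have "fps_X ^ Suc (Suc n) dvd (F + H) ^ 2"
    proof -
      have "(fps_X ^ Suc n) ^ 2 dvd (F + H) ^ 2" by (rule dvd_power_same[OF that])
      moreover have "fps_X ^ Suc (Suc n) dvd ((fps_X :: 'a fps) ^ Suc n) ^ 2"
        unfolding power_mult[symmetric] by (rule le_imp_power_dvd) simp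
      ultimately show ?thesis by (rule dvd_trans[rotated])
    qed
    ultimately show ?thesis by (metis dvd_mult2)
  qed
  have step: "fps_X ^ Suc n dvd G n + G (Suc n)" for n
  proof (induction n)
    case 0
    have "G 0 + G (Suc 0) = fps_const (a + (a ^ 24 + c)) + fps_X"
      unfolding G0 GS C_def by (simp only: fps_const_power fps_const_add add.assoc[symmetric])
    then show ?case by (simp add: ac)
  next
    case (Suc n)
    have "G (Suc n) + G (Suc (Suc n)) = G n ^ 24 + G (Suc n) ^ 24 + (C + C)"
      unfolding GS[of n] GS[of "Suc n"] by (simp only: ac_simps)
    then show ?case using dvd24'[OF Suc.IH] by simp
  qed
  have stable: "fps_X ^ Suc n dvd G n + G (n + m)" for n m
  proof (induction m)
    case (Suc m)
    have "fps_X ^ Suc n dvd (fps_X :: 'a fps) ^ Suc (n + m)" by (rule le_imp_power_dvd) simp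
    then have "fps_X ^ Suc n dvd G (n + m) + G (n + Suc m)" using step[of "n + m"] dvd_trans by fastforce
    from dvd_add[OF Suc.IH this] show ?case by (simp add: algebra_simps)
  qed simp
  have coeff: "fps_nth F i = fps_nth H i" if "fps_X ^ Suc n dvd F + H" "i \<le> n" for F H :: "'a fps" and n i
  proof -
    from that(1) obtain Q where "F + H = fps_X ^ Suc n * Q" by (rule dvdE)
    then have "fps_nth (F + H) i = 0" using that(2) by (simp only: fps_X_power_mult_nth) simp
    then show ?thesis by (simp add: add_eq_0_iff_char_2)
  qed
  define F where "F = Abs_fps (\<lambda>n. fps_nth (G n) n)"
  have FG: "fps_nth F i = fps_nth (G n) i" if "i \<le> n" for i n
    using coeff[OF stable[of i "n - i"], of i] that by (simp add: F_def)
  have FG_dvd: "fps_X ^ Suc n dvd F + G n" for n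
  proof -
    have "F + G n = fps_X ^ Suc n * fps_shift (Suc n) (F + G n)"
    proof (rule fps_ext)
      fix i show "fps_nth (F + G n) i = fps_nth (fps_X ^ Suc n * fps_shift (Suc n) (F + G n)) i"
        using FG[of i n] by (simp only: fps_X_power_mult_nth) auto
    qed
    then show ?thesis by (metis dvd_triv_left)
  qed
  have "F ^ 24 + F + C = 0"
  proof (rule fps_ext)
    fix n
    have "fps_X ^ Suc n dvd (F ^ 24 + G n ^ 24) + (F + G (Suc n))"
      by (rule dvd_add[OF dvd24[OF FG_dvd] dvd_trans[OF _ FG_dvd]]) (rule le_imp_power_dvd, simp)
    also have "(F ^ 24 + G n ^ 24) + (F + G (Suc n)) = F ^ 24 + F + C + 0"
      unfolding GS by (simp add: algebra_simps)
    finally show "fps_nth (F ^ 24 + F + C) n = fps_nth 0 n" using coeff by blast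
  qed
  moreover have "fps_nth F 0 = a" using FG[of 0 0] by (simp add: G0)
  ultimately show ?thesis unfolding C_def by blast
qed

text \<open>
  The power \<open>F ^ 24\<close> is a square, and in characteristic two a square has no linear term.
\<close>

lemma fps_root_coeffs:
  fixes c :: "'a::idom_char_2"
  assumes "F ^ 24 + F + (fps_const c + fps_X) = 0"
  shows "fps_nth F 0 ^ 24 + fps_nth F 0 + c = 0" "fps_nth F 1 = 1"
proof -
  have F: "F = F ^ 24 + (fps_const c + fps_X)" using assms by (metis add.commute add.left_commute add_eq_0_iff_char_2)
  have "fps_nth (F ^ 24 + F + (fps_const c + fps_X)) 0 = 0" by (simp add: assms)
  then show "fps_nth F 0 ^ 24 + fps_nth F 0 + c = 0" by (simp add: fps_nth_power_0)
  have "fps_nth F 1 = fps_nth (F ^ 24 + (fps_const c + fps_X)) 1" by (rule arg_cong[OF F])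
  also have "F ^ 24 = F ^ 12 * F ^ 12" by (simp flip: power_add)
  also have "fps_nth (F ^ 12 * F ^ 12 + (fps_const c + fps_X)) 1 = 1"
    by (simp only: fps_add_nth fps_mult_nth_1 mult.commute add_self) simp
  finally show "fps_nth F 1 = 1" .
qed

text \<open>
  The power map acts on the coefficients only; the variable stays fixed.
\<close>

definition fps_frobenius :: "nat \<Rightarrow> 'a::comm_ring_1 fps \<Rightarrow> 'a fps" where
  "fps_frobenius e F = Abs_fps (\<lambda>n. fps_nth F n ^ (2 ^ e))"

lemma fps_frobenius_hom: "unital_hom (fps_frobenius e :: 'a::char_2 fps \<Rightarrow> _)"
  by (rule unital_homI)
     (auto intro!: fps_ext simp: fps_frobenius_def frobenius_add fps_mult_nth frobenius_sum power_mult_distrib power_0_left)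

lemma fps_frobenius_eq_0_iff: "fps_frobenius e F = 0 \<longleftrightarrow> F = (0 :: 'a::idom fps)"
  by (auto simp: fps_eq_iff fps_frobenius_def power_0_left)

section \<open>Automorphisms of a splitting field\<close>

lemma splitting_field_simps:
  "carrier (splitting_field p) = generate_field ring_of_type_algebra (range to_ac \<union> ac_roots p)"
  "x \<otimes>\<^bsub>splitting_field p\<^esub> y = x * y" "x \<oplus>\<^bsub>splitting_field p\<^esub> y = x + y" "\<one>\<^bsub>splitting_field p\<^esub> = 1"
  by (simp_all add: splitting_field_def ring_of_type_algebra_def)

lemma a_inv_type_algebra: "\<ominus>\<^bsub>ring_of_type_algebra\<^esub> x = - (x :: 'a::field)"
proof -
  interpret R: field "ring_of_type_algebra :: 'a ring" by (rule field_from_type_algebra)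
  have "- x \<oplus>\<^bsub>ring_of_type_algebra\<^esub> x = \<zero>\<^bsub>ring_of_type_algebra\<^esub>" by (simp add: ring_of_type_algebra_def)
  then show ?thesis by (rule R.minus_equality) (simp_all add: ring_of_type_algebra_def)
qed

lemma m_inv_type_algebra: "x \<noteq> 0 \<Longrightarrow> inv\<^bsub>ring_of_type_algebra\<^esub> x = inverse (x :: 'a::field)"
proof -
  interpret R: field "ring_of_type_algebra :: 'a ring" by (rule field_from_type_algebra)
  assume "x \<noteq> 0"
  then show ?thesis by (intro R.comm_inv_char) (simp_all add: ring_of_type_algebra_def)
qed

lemma splitting_field_induct [consumes 1, case_names base one uminus inverse add mult]:
  assumes "x \<in> carrier (splitting_field p)"
    and "\<And>x. x \<in> range to_ac \<union> ac_roots p \<Longrightarrow> P x" "P 1"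
    and "\<And>x. P x \<Longrightarrow> P (- x)" "\<And>x. P x \<Longrightarrow> P (inverse x)"
    and "\<And>x y. P x \<Longrightarrow> P y \<Longrightarrow> P (x + y)" "\<And>x y. P x \<Longrightarrow> P y \<Longrightarrow> P (x * y)"
  shows "P x"
  using assms(1) unfolding splitting_field_simps
proof (induction rule: generate_field.induct)
  case (m_inv h)
  then show ?case using assms(5)[of h] m_inv_type_algebra[of h] by (simp add: ring_of_type_algebra_def)
next
  case (a_inv h)
  then show ?case using assms(4)[of h] a_inv_type_algebra[of h] by simp
qed (use assms in \<open>simp_all add: ring_of_type_algebra_def\<close>)

lemma splitting_field_closed:
  shows "x \<in> range to_ac \<union> ac_roots p \<Longrightarrow> x \<in> carrier (splitting_field p)"
    and "1 \<in> carrier (splitting_field p)"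
    and "x \<in> carrier (splitting_field p) \<Longrightarrow> - x \<in> carrier (splitting_field p)"
    and "x \<in> carrier (splitting_field p) \<Longrightarrow> inverse x \<in> carrier (splitting_field p)"
    and "x \<in> carrier (splitting_field p) \<Longrightarrow> y \<in> carrier (splitting_field p) \<Longrightarrow> x + y \<in> carrier (splitting_field p)"
    and "x \<in> carrier (splitting_field p) \<Longrightarrow> y \<in> carrier (splitting_field p) \<Longrightarrow> x * y \<in> carrier (splitting_field p)"
proof -
  let ?R = "ring_of_type_algebra :: 'a alg_closure ring"
  let ?H = "range to_ac \<union> ac_roots p"
  show "x \<in> ?H \<Longrightarrow> x \<in> carrier (splitting_field p)"
    unfolding splitting_field_simps by (rule generate_field.incl)
  show "1 \<in> carrier (splitting_field p)"
    using generate_field.one[of ?R ?H] unfolding splitting_field_simps by (simp add: ring_of_type_algebra_def)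
  show "x \<in> carrier (splitting_field p) \<Longrightarrow> - x \<in> carrier (splitting_field p)"
    using generate_field.a_inv[of x ?R ?H] unfolding splitting_field_simps a_inv_type_algebra .
  show "x \<in> carrier (splitting_field p) \<Longrightarrow> inverse x \<in> carrier (splitting_field p)"
    using generate_field.m_inv[of x ?R ?H] m_inv_type_algebra[of x] unfolding splitting_field_simps
    by (cases "x = 0") (auto simp: ring_of_type_algebra_def)
  show "x \<in> carrier (splitting_field p) \<Longrightarrow> y \<in> carrier (splitting_field p) \<Longrightarrow> x + y \<in> carrier (splitting_field p)"
    using generate_field.eng_add[of x ?R ?H y] unfolding splitting_field_simps by (simp add: ring_of_type_algebra_def)
  show "x \<in> carrier (splitting_field p) \<Longrightarrow> y \<in> carrier (splitting_field p) \<Longrightarrow> x * y \<in> carrier (splitting_field p)"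
    using generate_field.eng_mult[of x ?R ?H y] unfolding splitting_field_simps by (simp add: ring_of_type_algebra_def)
qed

lemma hom_poly_to_ac:
  assumes "unital_hom \<chi>" "\<And>a. \<chi> (to_ac a) = to_ac a"
  shows "\<chi> (poly (map_poly to_ac p) x) = poly (map_poly to_ac p) (\<chi> x)"
  by (induction p) (simp_all add: map_poly_pCons unital_hom_0[OF assms(1)] unital_hom_add[OF assms(1)]
      unital_hom_mult[OF assms(1)] assms(2))

text \<open>
  A homomorphism over the base field permutes the finitely many roots. Hence it maps the field that they
  generate onto itself, although it need not be surjective on the algebraic closure.
\<close>

lemma galois_perm_group_of_hom:
  assumes \<chi>: "unital_hom \<chi>" "\<And>a. \<chi> (to_ac a) = to_ac a" and "finite (ac_roots p)"
  shows "(\<lambda>x. if x \<in> ac_roots p then \<chi> x else x) \<in> galois_perm_group p" (is "?\<pi> \<in> _")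
proof -
  let ?L = "carrier (splitting_field p)"
  have inj: "inj_on \<chi> A" for A by (rule inj_onI) (simp add: unital_hom_eq_iff[OF \<chi>(1)])
  have roots: "\<chi> ` ac_roots p \<subseteq> ac_roots p"
    by (auto simp: ac_roots_def unital_hom_0[OF \<chi>(1)] simp flip: hom_poly_to_ac[OF \<chi>])
  then have roots_eq: "\<chi> ` ac_roots p = ac_roots p"
    by (rule endo_inj_surj[OF assms(3)]) (rule inj)
  have into: "\<chi> x \<in> ?L" if "x \<in> ?L" for x
    using that
  proof (induction rule: splitting_field_induct)
    case (base x)
    then show ?case using roots by (intro splitting_field_closed(1)) (auto simp: \<chi>(2))
  qed (simp_all add: unital_hom_1[OF \<chi>(1)] unital_hom_add[OF \<chi>(1)] unital_hom_mult[OF \<chi>(1)]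
      unital_hom_uminus[OF \<chi>(1)] unital_hom_inverse[OF \<chi>(1)] splitting_field_closed)
  have onto: "x \<in> \<chi> ` ?L" if "x \<in> ?L" for x
    using that
  proof (induction rule: splitting_field_induct)
    case (base x)
    then obtain y where "y \<in> range to_ac \<union> ac_roots p" "x = \<chi> y" using roots_eq \<chi>(2) by fastforce
    then show ?case using splitting_field_closed(1) by blast
  next
    case one
    then show ?case using image_eqI[of _ \<chi>, OF unital_hom_1[OF \<chi>(1), symmetric] splitting_field_closed(2)] .
  next
    case (uminus x)
    then obtain y where "y \<in> ?L" "x = \<chi> y" by blast
    then show ?case by (intro image_eqI[of _ _ "- y"]) (simp_all add: unital_hom_uminus[OF \<chi>(1)] splitting_field_closed)
  next
    case (inverse x)
    then obtain y where "y \<in> ?L" "x = \<chi> y" by blast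
    then show ?case by (intro image_eqI[of _ _ "inverse y"]) (simp_all add: unital_hom_inverse[OF \<chi>(1)] splitting_field_closed)
  next
    case (add x x')
    then obtain y y' where "y \<in> ?L" "x = \<chi> y" "y' \<in> ?L" "x' = \<chi> y'" by blast
    then show ?case by (intro image_eqI[of _ _ "y + y'"]) (simp_all add: unital_hom_add[OF \<chi>(1)] splitting_field_closed)
  next
    case (mult x x')
    then obtain y y' where "y \<in> ?L" "x = \<chi> y" "y' \<in> ?L" "x' = \<chi> y'" by blast
    then show ?case by (intro image_eqI[of _ _ "y * y'"]) (simp_all add: unital_hom_mult[OF \<chi>(1)] splitting_field_closed)
  qed
  have bij: "bij_betw \<chi> ?L ?L"
    using into onto inj by (auto simp: bij_betw_def)
  define \<sigma> where "\<sigma> = restrict \<chi> ?L"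
  have "\<sigma> \<in> galois_group p"
    unfolding galois_group_def Bij_def
  proof (intro CollectI conjI IntI allI)
    show "\<sigma> \<in> ring_hom (splitting_field p) (splitting_field p)"
      by (rule ring_hom_memI) (auto simp: \<sigma>_def splitting_field_simps(2,3,4) splitting_field_closed into
         unital_hom_1[OF \<chi>(1)] unital_hom_add[OF \<chi>(1)] unital_hom_mult[OF \<chi>(1)])
    show "\<sigma> \<in> extensional ?L" by (simp add: \<sigma>_def)
    show "bij_betw \<sigma> ?L ?L" unfolding \<sigma>_def using bij by simp
    show "\<sigma> (to_ac a) = to_ac a" for a
      using splitting_field_closed(1)[of "to_ac a" p] by (simp add: \<sigma>_def \<chi>(2))
  qed
  moreover have "?\<pi> permutes ac_roots p"
    by (rule bij_imp_permutes) (auto simp: bij_betw_def inj_on_def unital_hom_eq_iff[OF \<chi>(1)] roots_eq)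
  moreover have "\<forall>x\<in>ac_roots p. ?\<pi> x = \<sigma> x"
    using splitting_field_closed(1) by (auto simp: \<sigma>_def)
  ultimately show ?thesis unfolding galois_perm_group_def by blast
qed

lemma galois_perm_group_compose:
  assumes "\<pi> \<in> galois_perm_group p" "\<rho> \<in> galois_perm_group p"
  shows "\<pi> \<circ> \<rho> \<in> galois_perm_group p"
proof -
  let ?L = "carrier (splitting_field p)"
  from assms obtain \<sigma> \<tau> where \<sigma>: "\<sigma> \<in> galois_group p" "\<forall>x\<in>ac_roots p. \<pi> x = \<sigma> x"
    and \<tau>: "\<tau> \<in> galois_group p" "\<forall>x\<in>ac_roots p. \<rho> x = \<tau> x"
    and perm: "\<pi> permutes ac_roots p" "\<rho> permutes ac_roots p"
    unfolding galois_perm_group_def by blast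
  have "compose ?L \<sigma> \<tau> \<in> galois_group p"
    unfolding galois_group_def
  proof (intro CollectI conjI IntI allI)
    have B: "\<sigma> \<in> Bij ?L" "\<tau> \<in> Bij ?L" using \<sigma> \<tau> by (auto simp: galois_group_def)
    then show "compose ?L \<sigma> \<tau> \<in> Bij ?L" by (rule compose_Bij)
    have h: "\<sigma> \<in> ring_hom (splitting_field p) (splitting_field p)" "\<tau> \<in> ring_hom (splitting_field p) (splitting_field p)"
      using \<sigma> \<tau> by (auto simp: galois_group_def)
    show "compose ?L \<sigma> \<tau> \<in> ring_hom (splitting_field p) (splitting_field p)"
      using ring_hom_memE[OF h(1)] ring_hom_memE[OF h(2)]
      by (intro ring_hom_memI) (auto simp: compose_def splitting_field_simps(2,3,4) splitting_field_closed)
    show "compose ?L \<sigma> \<tau> (to_ac a) = to_ac a" for a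
      using \<sigma> \<tau> splitting_field_closed(1)[of "to_ac a" p] by (simp add: compose_def galois_group_def)
  qed
  moreover have "(\<pi> \<circ> \<rho>) x = compose ?L \<sigma> \<tau> x" if "x \<in> ac_roots p" for x
    using \<sigma>(2) \<tau>(2) that splitting_field_closed(1)[of x p] permutes_in_image[OF perm(2), of x]
    by (simp add: compose_def)
  ultimately show ?thesis
    using permutes_compose[OF perm(2,1)] unfolding galois_perm_group_def by blast
qed

text \<open>
  The sets of roots with sum zero form a code that the Galois group preserves.
\<close>

lemma galois_perm_group_sum_eq_0:
  assumes "\<pi> \<in> galois_perm_group p" "S \<subseteq> ac_roots p" "\<Sum>S = 0"
  shows "\<Sum>(\<pi> ` S) = 0"
proof -
  let ?L = "carrier (splitting_field p)"
  from assms obtain \<sigma> where \<sigma>: "\<sigma> \<in> galois_group p" "\<forall>x\<in>ac_roots p. \<pi> x = \<sigma> x" and perm: "\<pi> permutes ac_roots p"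
    unfolding galois_perm_group_def by blast
  have h: "\<sigma> \<in> ring_hom (splitting_field p) (splitting_field p)" using \<sigma> by (auto simp: galois_group_def)
  have add: "\<sigma> (x + y) = \<sigma> x + \<sigma> y" if "x \<in> ?L" "y \<in> ?L" for x y
    using ring_hom_memE(3)[OF h that] by (simp add: splitting_field_simps)
  have "to_ac 0 \<in> ?L" "\<sigma> (to_ac 0) = to_ac 0"
    using \<sigma>(1) splitting_field_closed(1)[of "to_ac 0" p] by (auto simp: galois_group_def simp del: to_ac_0)
  then have zero: "0 \<in> ?L" "\<sigma> 0 = 0" by simp_all
  have "(\<Sum>x\<in>A. x) \<in> ?L \<and> \<sigma> (\<Sum>x\<in>A. x) = (\<Sum>x\<in>A. \<sigma> x)" if "A \<subseteq> ac_roots p" for A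
    using that
  proof (induction A rule: infinite_finite_induct)
    case (insert a A)
    have "a \<in> ?L" using splitting_field_closed(1) insert by blast
    moreover have "\<Sum>A \<in> ?L" "\<sigma> (\<Sum>A) = (\<Sum>x\<in>A. \<sigma> x)" using insert by simp_all
    ultimately show ?case using insert(1,2) splitting_field_closed(5)[of a p "\<Sum>A"] add[of a "\<Sum>A"] by simp
  qed (simp_all add: zero)
  from this[OF assms(2)] have "(\<Sum>x\<in>S. \<sigma> x) = 0" using assms(3) zero by simp
  moreover have "\<Sum>(\<pi> ` S) = (\<Sum>x\<in>S. \<pi> x)"
    by (subst sum.reindex) (use permutes_inj_on[OF perm] in auto)
  moreover have "(\<Sum>x\<in>S. \<pi> x) = (\<Sum>x\<in>S. \<sigma> x)" by (rule sum.cong) (use \<sigma>(2) assms(2) in auto)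
  ultimately show ?thesis by simp
qed


section \<open>Reduction at a point of the affine line\<close>

type_synonym base_field = "bit poly fract"

text \<open>
  The homomorphism from the polynomials over the field with two elements that sends the
  indeterminate to \<open>z\<close>.
\<close>

definition eval_at :: "'a::comm_ring_1 \<Rightarrow> bit poly \<Rightarrow> 'a" where
  "eval_at z p = poly (map_poly (\<lambda>b. of_bool (b = 1)) p) z"

lemma bit_hom: "unital_hom (\<lambda>b :: bit. of_bool (b = 1) :: 'a::char_2)"
proof (rule unital_homI)
  show "(of_bool (x + y = 1) :: 'a) = of_bool (x = 1) + of_bool (y = 1)" for x y :: bit
    by (cases x; cases y) (simp_all add: one_plus_one)
  show "(of_bool (x * y = 1) :: 'a) = of_bool (x = 1) * of_bool (y = 1)" for x y :: bit
    by (cases x; cases y) simp_all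
qed simp

lemma eval_at_hom: "unital_hom (eval_at (z :: 'a::char_2))"
proof (rule unital_homI)
  note h = bit_hom[where ?'a = 'a]
  have p: "map_poly (\<lambda>b :: bit. of_bool (b = 1) :: 'a) (pCons a p) = pCons (of_bool (a = 1)) (map_poly (\<lambda>b. of_bool (b = 1)) p)" for a p
    by (rule map_poly_pCons) simp
  show "eval_at z 1 = 1" by (simp add: eval_at_def one_pCons p)
  have add: "eval_at z (p + q) = eval_at z p + eval_at z q" for p q
  proof -
    have "map_poly (\<lambda>b :: bit. of_bool (b = 1) :: 'a) (p + q) = map_poly (\<lambda>b. of_bool (b = 1)) p + map_poly (\<lambda>b. of_bool (b = 1)) q"
      by (rule poly_eqI) (simp add: coeff_map_poly unital_hom_add[OF h])
    then show ?thesis by (simp add: eval_at_def)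
  qed
  show "eval_at z (p + q) = eval_at z p + eval_at z q" for p q by (rule add)
  have smult: "eval_at z (Polynomial.smult a p) = of_bool (a = 1) * eval_at z p" for a p
    by (cases a) (auto simp: eval_at_def)
  have pc: "eval_at z (pCons a p) = of_bool (a = 1) + z * eval_at z p" for a p
    by (simp add: eval_at_def p)
  show "eval_at z (p * q) = eval_at z p * eval_at z q" for p q
    by (induction p) (simp_all add: add smult pc algebra_simps, simp add: eval_at_def)
qed

lemma eval_at_X: "eval_at z [:0, 1:] = z"
  by (simp add: eval_at_def map_poly_pCons)

text \<open>
  The element \<open>c + X\<close> is transcendental over the field with two elements: composition with a
  polynomial of degree one is injective.
\<close>

lemma eval_at_shift_eq_0_iff:
  fixes c :: "'a::idom_char_2"
  shows "eval_at (fps_const c + fps_X) p = 0 \<longleftrightarrow> p = 0"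
proof -
  define P where "P = map_poly (\<lambda>b. of_bool (b = 1) :: 'a) p"
  have eq: "eval_at (fps_const c + fps_X) p = fps_of_poly (pcompose P [:c, 1:])"
  proof -
    have "poly (map_poly (\<lambda>b. of_bool (b = 1)) p) (fps_const c + fps_X) = fps_of_poly (pcompose (map_poly (\<lambda>b. of_bool (b = 1)) p) [:c, 1:])"
      by (induction p)
        (simp_all add: map_poly_pCons pcompose_pCons fps_of_poly_add fps_of_poly_mult fps_of_poly_pCons fps_of_poly_const
          algebra_simps of_bool_def)
    then show ?thesis by (simp add: eval_at_def P_def)
  qed
  have "eval_at (fps_const c + fps_X) p = 0 \<longleftrightarrow> pcompose P [:c, 1:] = 0"
    unfolding eq by (metis fps_of_poly_0 fps_of_poly_eq_iff)
  also have "\<dots> \<longleftrightarrow> P = 0" by (metis pcompose_eq_0 pcompose_0 degree_pCons_eq_if one_neq_zero pCons_eq_0_iff zero_less_Suc)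
  also have "\<dots> \<longleftrightarrow> p = 0"
  proof -
    have "of_bool (b = 1) = (0 :: 'a) \<longleftrightarrow> b = 0" for b :: bit by (cases b) simp_all
    then show ?thesis by (simp add: P_def poly_eq_iff coeff_map_poly)
  qed
  finally show ?thesis .
qed

lemma partial_embedding_range:
  fixes f :: "'r::comm_ring_1 \<Rightarrow> 'a::field" and g :: "'r \<Rightarrow> 'b::field"
  assumes "unital_hom f" "unital_hom g" "\<And>r. f r = 0 \<longleftrightarrow> g r = 0"
  shows "partial_embedding (range (\<lambda>r. (f r, g r)))"
proof
  have I: "(f r, g r) \<in> range (\<lambda>r. (f r, g r))" for r by simp
  show "(1, 1) \<in> range (\<lambda>r. (f r, g r))"
    using I[of 1] by (simp only: unital_hom_1[OF assms(1)] unital_hom_1[OF assms(2)])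
  show "(- a, - b) \<in> range (\<lambda>r. (f r, g r))" if "(a, b) \<in> range (\<lambda>r. (f r, g r))" for a b
    using that I by (auto simp flip: unital_hom_uminus[OF assms(1)] unital_hom_uminus[OF assms(2)])
  show "(a + c, b + d) \<in> range (\<lambda>r. (f r, g r))"
    if "(a, b) \<in> range (\<lambda>r. (f r, g r))" "(c, d) \<in> range (\<lambda>r. (f r, g r))" for a b c d
    using that I by (auto simp flip: unital_hom_add[OF assms(1)] unital_hom_add[OF assms(2)])
  show "(a * c, b * d) \<in> range (\<lambda>r. (f r, g r))"
    if "(a, b) \<in> range (\<lambda>r. (f r, g r))" "(c, d) \<in> range (\<lambda>r. (f r, g r))" for a b c d
    using that I by (auto simp flip: unital_hom_mult[OF assms(1)] unital_hom_mult[OF assms(2)])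
  show "a = 0 \<longleftrightarrow> b = 0" if "(a, b) \<in> range (\<lambda>r. (f r, g r))" for a b
    using that assms(3) by auto
qed

lemma unital_hom_comp: "unital_hom f \<Longrightarrow> unital_hom g \<Longrightarrow> unital_hom (\<lambda>x. f (g x))"
  by (simp add: unital_hom_def)

lemma to_ac_to_fract_hom: "unital_hom (\<lambda>r :: 'r::idom. to_ac (to_fract r))"
  by (rule unital_homI) simp_all

abbreviation generic :: "base_field alg_closure" where
  "generic \<equiv> to_ac (to_fract [:0, 1:])"

lemma ac_roots_trinomial:
  "ac_roots (Polynomial.monom 1 24 + Polynomial.monom 1 1 + [:t:]) = root_set (to_ac (t :: 'a::field))"
proof -
  have add: "map_poly to_ac (p + q) = map_poly to_ac p + map_poly to_ac q" for p q :: "'a poly"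
    by (rule poly_eqI) (simp add: coeff_map_poly)
  have monom: "map_poly to_ac (Polynomial.monom 1 n) = Polynomial.monom 1 n" for n
    by (rule poly_eqI) (simp add: coeff_map_poly)
  show ?thesis unfolding ac_roots_def root_set_def add monom by (simp add: map_poly_pCons poly_monom)
qed

text \<open>
  Put \<open>t = c + X\<close>. The 24 roots of \<open>x ^ 24 + x + t\<close> expand into power series in \<open>X\<close>, one for each root of
  \<open>x ^ 24 + x + c\<close>, and \<open>r\<close> is the constant term of the expansion. If \<open>c\<close> is fixed by the \<open>2 ^ e\<close>-th power
  map, then applying this map to all coefficients fixes \<open>t\<close> and permutes the expansions; on the constant terms
  it is the Frobenius map. Thus it comes from an automorphism \<open>\<chi>\<close> of the roots. A vanishing sum of
  roots has a vanishing constant term, and its linear coefficient counts the summands, as every expansion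
  has linear coefficient \<open>1\<close>.
\<close>

theorem reduction_at_point:
  fixes c :: "'k::{alg_closed_field,field_char_2}"
  assumes "c ^ 2 ^ e = c"
  obtains r \<chi> where "bij_betw r (root_set generic) (root_set c)"
    "unital_hom \<chi>" "\<And>a. \<chi> (to_ac a) = to_ac a"
    "\<And>x. x \<in> root_set generic \<Longrightarrow> r (\<chi> x) = r x ^ 2 ^ e"
    "\<And>S. S \<subseteq> root_set generic \<Longrightarrow> \<Sum>S = 0 \<Longrightarrow> sum r S = 0 \<and> even (card S)"
proof -
  define emb :: "'k fps \<Rightarrow> 'k fps fract alg_closure" where "emb F = to_ac (to_fract F)" for F
  define C where "C = fps_const c + fps_X"
  have emb: "unital_hom emb" unfolding emb_def by (rule to_ac_to_fract_hom)
  have emb_eq: "emb F = emb G \<longleftrightarrow> F = G" for F G by (simp add: emb_def)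
  (* The base field embeds into the fractions of power series by t = c + X; the extension of this map to the closure expands the roots. *)
  define \<Gamma> where "\<Gamma> = range (\<lambda>p. (to_ac (to_fract p) :: base_field alg_closure, emb (eval_at C p)))"
  have "partial_embedding \<Gamma>"
    unfolding \<Gamma>_def
  proof (rule partial_embedding_range)
    show "unital_hom (\<lambda>p. to_ac (to_fract p) :: base_field alg_closure)" by (rule to_ac_to_fract_hom)
    show "unital_hom (\<lambda>p. emb (eval_at C p))" by (rule unital_hom_comp[OF emb eval_at_hom])
    show "(to_ac (to_fract p) :: base_field alg_closure) = 0 \<longleftrightarrow> emb (eval_at C p) = 0" for p
      by (simp add: emb_def C_def eval_at_shift_eq_0_iff)
  qed
  then obtain \<psi> where \<psi>: "unital_hom \<psi>" "\<And>x y. (x, y) \<in> \<Gamma> \<Longrightarrow> \<psi> x = y"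
    using alg_closure_extension[of \<Gamma>] unfolding \<Gamma>_def by blast
  have \<psi>_base: "\<psi> (to_ac (to_fract p)) = emb (eval_at C p)" for p
    by (rule \<psi>(2)) (simp add: \<Gamma>_def)
  note \<psi>_simps = unital_hom_add[OF \<psi>(1)] unital_hom_mult[OF \<psi>(1)] unital_hom_power[OF \<psi>(1)] unital_hom_0[OF \<psi>(1)]
  note emb_simps = unital_hom_add[OF emb] unital_hom_mult[OF emb] unital_hom_power[OF emb] unital_hom_0[OF emb]
  define L where "L a = (SOME F. F ^ 24 + F + C = 0 \<and> fps_nth F 0 = a)" for a
  have L: "L a ^ 24 + L a + C = 0" "fps_nth (L a) 0 = a" if "a \<in> root_set c" for a
    using someI_ex[OF fps_root_exists[of a c]] that by (auto simp: root_set_def L_def C_def)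
  have fps_root_iff: "F ^ 24 + F + C = 0 \<longleftrightarrow> emb F \<in> root_set (emb C)" for F
    by (simp add: root_set_def emb_eq flip: emb_simps)
  have inj: "inj_on (\<lambda>a. emb (L a)) (root_set c)"
    by (rule inj_onI) (metis emb_eq L(2))
  have "(\<lambda>a. emb (L a)) ` root_set c \<subseteq> root_set (emb C)"
    using L(1) fps_root_iff by blast
  then have emb_roots: "(\<lambda>a. emb (L a)) ` root_set c = root_set (emb C)"
    by (intro card_subset_eq finite_root_set) (simp_all add: card_image[OF inj] card_root_set)
  have \<psi>_inj: "inj_on \<psi> A" for A by (rule inj_onI) (simp add: unital_hom_eq_iff[OF \<psi>(1)])
  have \<psi>_generic: "\<psi> generic = emb C" by (simp add: \<psi>_base eval_at_X)
  have "\<psi> ` root_set generic \<subseteq> root_set (emb C)"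
  proof safe
    fix x assume "x \<in> root_set generic"
    then have "\<psi> (x ^ 24 + x + generic) = 0" by (simp add: root_set_def \<psi>_simps(4))
    then show "\<psi> x \<in> root_set (emb C)" by (simp only: root_set_def mem_Collect_eq \<psi>_simps \<psi>_generic)
  qed
  then have \<psi>_roots: "\<psi> ` root_set generic = root_set (emb C)"
    by (intro card_subset_eq finite_root_set) (simp_all add: card_image[OF \<psi>_inj] card_root_set)
  define F where "F x = inv_into UNIV emb (\<psi> x)" for x
  have F: "\<psi> x = emb (F x)" "F x ^ 24 + F x + C = 0" if "x \<in> root_set generic" for x
  proof -
    have "\<psi> x \<in> root_set (emb C)" using \<psi>_roots that by blast
    moreover from this obtain a where "\<psi> x = emb (L a)" using emb_roots by (metis imageE)
    ultimately show "\<psi> x = emb (F x)" "F x ^ 24 + F x + C = 0"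
      unfolding fps_root_iff F_def by (metis f_inv_into_f rangeI)+
  qed
  have F_onto: "\<exists>x\<in>root_set generic. F x = G" if "G ^ 24 + G + C = 0" for G
  proof -
    have "emb G \<in> \<psi> ` root_set generic" unfolding \<psi>_roots using that by (simp only: fps_root_iff)
    then obtain x where x: "x \<in> root_set generic" "\<psi> x = emb G" by (metis imageE)
    have "emb (F x) = emb G" by (rule trans[OF F(1)[OF x(1), symmetric] x(2)])
    then show ?thesis using x(1) unfolding emb_eq by blast
  qed
  define r where "r x = fps_nth (F x) 0" for x
  have r_mem: "r x \<in> root_set c" if "x \<in> root_set generic" for x
    using fps_root_coeffs(1)[of "F x" c] F(2)[OF that] by (simp add: root_set_def r_def C_def)
  have r_onto: "root_set c \<subseteq> r ` root_set generic"
  proof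
    fix a assume a: "a \<in> root_set c"
    from F_onto[OF L(1)[OF a]] obtain x where "x \<in> root_set generic" "F x = L a" by (rule bexE)
    then show "a \<in> r ` root_set generic" using L(2)[OF a] unfolding r_def by (metis imageI)
  qed
  then have r_image: "r ` root_set generic = root_set c" using r_mem by blast
  have r_inj: "inj_on r (root_set generic)"
    by (rule eq_card_imp_inj_on[OF finite_root_set]) (simp only: r_image card_root_set)
  have r_bij: "bij_betw r (root_set generic) (root_set c)"
    using r_inj r_image by (simp add: bij_betw_def)

  define \<Phi> where "\<Phi> = (fps_frobenius e :: 'k fps \<Rightarrow> 'k fps)"
  have \<Phi>: "unital_hom \<Phi>" unfolding \<Phi>_def by (rule fps_frobenius_hom)
  have \<Phi>_eq_0: "\<Phi> G = 0 \<longleftrightarrow> G = 0" for G unfolding \<Phi>_def by (rule fps_frobenius_eq_0_iff)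
  have \<Phi>_C: "\<Phi> C = C"
    by (rule fps_ext) (auto simp: \<Phi>_def fps_frobenius_def C_def assms fps_X_def power_0_left)
  have \<Phi>_eval: "\<Phi> (eval_at C p) = eval_at C p" for p
  proof -
    have "\<Phi> (of_bool b) = of_bool b" for b
      by (cases b) (simp_all add: unital_hom_0[OF \<Phi>] unital_hom_1[OF \<Phi>])
    then show ?thesis unfolding eval_at_def
      by (induction p) (simp_all add: map_poly_pCons unital_hom_0[OF \<Phi>] unital_hom_add[OF \<Phi>] unital_hom_mult[OF \<Phi>] \<Phi>_C)
  qed
  (* The power map on coefficients, transported to the subring of elements whose image under \<psi> is a power series. *)
  define \<Delta> where "\<Delta> = {(x, y). \<exists>G. \<psi> x = emb G \<and> \<psi> y = emb (\<Phi> G)}"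
  have "partial_embedding \<Delta>"
  proof
    show "(1, 1) \<in> \<Delta>"
      by (auto simp: \<Delta>_def unital_hom_1[OF \<psi>(1)] unital_hom_1[OF emb] unital_hom_1[OF \<Phi>] intro!: exI[of _ 1])
    show "(- x, - y) \<in> \<Delta>" if "(x, y) \<in> \<Delta>" for x y
      using that by simp
    show "(x + x', y + y') \<in> \<Delta>" if "(x, y) \<in> \<Delta>" "(x', y') \<in> \<Delta>" for x y x' y'
      using that by (auto simp: \<Delta>_def \<psi>_simps unital_hom_add[OF \<Phi>] simp flip: emb_simps)
    show "(x * x', y * y') \<in> \<Delta>" if "(x, y) \<in> \<Delta>" "(x', y') \<in> \<Delta>" for x y x' y'
      using that by (auto simp: \<Delta>_def \<psi>_simps unital_hom_mult[OF \<Phi>] simp flip: emb_simps)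
    show "x = 0 \<longleftrightarrow> y = 0" if "(x, y) \<in> \<Delta>" for x y
    proof -
      from that obtain G where G: "\<psi> x = emb G" "\<psi> y = emb (\<Phi> G)" unfolding \<Delta>_def by blast
      have emb_eq_0: "emb H = 0 \<longleftrightarrow> H = 0" for H using emb_eq[of H 0] by (simp only: emb_simps(4))
      have "x = 0 \<longleftrightarrow> \<psi> x = 0" "y = 0 \<longleftrightarrow> \<psi> y = 0" by (simp_all only: unital_hom_eq_0_iff[OF \<psi>(1)])
      then show ?thesis unfolding G emb_eq_0 \<Phi>_eq_0 by blast
    qed
  qed
  moreover have base: "(to_ac (to_fract p), to_ac (to_fract p)) \<in> \<Delta>" for p
    unfolding \<Delta>_def by (simp only: mem_Collect_eq case_prod_conv \<psi>_base) (metis \<Phi>_eval)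
  ultimately obtain \<chi> where \<chi>: "unital_hom \<chi>" "\<And>x y. (x, y) \<in> \<Delta> \<Longrightarrow> \<chi> x = y"
    using alg_closure_extension[of \<Delta>] by blast
  have \<chi>_fix: "\<chi> (to_ac a) = to_ac a" for a
  proof -
    obtain p q where "a = Fract p q" "q \<noteq> 0" by (cases a)
    then have "a = to_fract p * inverse (to_fract q)" by (simp add: Fract_conv_to_fract field_simps)
    then show ?thesis
      using \<chi>(2)[OF base] by (simp add: unital_hom_mult[OF \<chi>(1)] unital_hom_inverse[OF \<chi>(1)])
  qed
  have r\<chi>: "r (\<chi> x) = r x ^ 2 ^ e" if x: "x \<in> root_set generic" for x
  proof -
    have "\<Phi> (F x ^ 24 + F x + C) = 0" using F(2)[OF x] by (simp add: unital_hom_0[OF \<Phi>])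
    then have "\<Phi> (F x) ^ 24 + \<Phi> (F x) + C = 0"
      by (simp add: unital_hom_add[OF \<Phi>] unital_hom_power[OF \<Phi>] \<Phi>_C)
    from F_onto[OF this] obtain y where y: "y \<in> root_set generic" "F y = \<Phi> (F x)" by (rule bexE)
    have "(x, y) \<in> \<Delta>" using F(1)[OF x] F(1)[OF y(1)] unfolding \<Delta>_def y(2) by blast
    then show ?thesis using \<chi>(2) y(2) by (simp add: r_def \<Phi>_def fps_frobenius_def)
  qed
  have rel: "sum r S = 0 \<and> even (card S)" if S: "S \<subseteq> root_set generic" "\<Sum>S = 0" for S
  proof -
    have "emb (\<Sum>x\<in>S. F x) = \<psi> (\<Sum>x\<in>S. x)"
      unfolding unital_hom_sum[OF emb] unital_hom_sum[OF \<psi>(1)] using S F(1) by (intro sum.cong) auto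
    also have "\<dots> = emb 0" using S \<psi>_simps(4) emb_simps(4) by simp
    finally have 0: "(\<Sum>x\<in>S. F x) = 0" unfolding emb_eq .
    have "sum r S = fps_nth (\<Sum>x\<in>S. F x) 0" by (simp add: r_def fps_sum_nth)
    moreover have "of_nat (card S) = fps_nth (\<Sum>x\<in>S. F x) 1"
    proof -
      have "fps_nth (F x) 1 = 1" if "x \<in> S" for x
        using fps_root_coeffs(2)[of "F x" c] F(2) that S(1) unfolding C_def by blast
      then show ?thesis by (simp add: fps_sum_nth)
    qed
    ultimately show ?thesis by (simp add: 0 of_nat_char_2 split: if_splits)
  qed
  show thesis using that[OF r_bij \<chi>(1) \<chi>_fix r\<chi> rel] .
qed

section \<open>The binary Golay code\<close>

definition nonresidues :: "nat list" where
  "nonresidues = [5, 7, 10, 11, 14, 15, 17, 19, 20, 21, 22]"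

lemma points_list: "[0..<24] = [0, 1, 2, 3, 4, 5, 6, 7, 8, 9, 10, 11, 12, 13, 14, 15, 16, 17, 18, 19, 20, 21, 22, 23]"
  by (simp add: upt_rec)

lemma residues_list: "[0..<23] = [0, 1, 2, 3, 4, 5, 6, 7, 8, 9, 10, 11, 12, 13, 14, 15, 16, 17, 18, 19, 20, 21, 22]"
  by (simp add: upt_rec)

lemma QuadRes_23_iff:
  assumes "n < 23" shows "QuadRes 23 (int n) \<longleftrightarrow> n \<notin> set nonresidues"
proof -
  have "QuadRes 23 (int n) \<longleftrightarrow> n \<in> set (map (\<lambda>y. y ^ 2 mod 23) [0..<23])"
  proof
    assume "QuadRes 23 (int n)"
    then obtain y where "[y ^ 2 = int n] (mod 23)" by (auto simp: QuadRes_def)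
    then have "y ^ 2 mod 23 = int n" using assms by (simp add: cong_def)
    then have "(y mod 23) ^ 2 mod 23 = int n" by (simp add: power_mod)
    then have "nat ((y mod 23) ^ 2 mod 23) = n" by simp
    then have "nat (y mod 23) ^ 2 mod 23 = n" by (simp add: nat_mod_distrib nat_power_eq)
    then show "n \<in> set (map (\<lambda>y. y ^ 2 mod 23) [0..<23])"
      by (auto intro!: image_eqI[of _ _ "nat (y mod 23)"] simp: nat_less_iff)
  next
    assume "n \<in> set (map (\<lambda>y. y ^ 2 mod 23) [0..<23])"
    then obtain y where "y ^ 2 mod 23 = n" by auto
    then have "int (y ^ 2 mod 23) = int n" by simp
    then have "[int y ^ 2 = int n] (mod 23)" using assms by (simp add: cong_def zmod_int)
    then show "QuadRes 23 (int n)" unfolding QuadRes_def by blast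
  qed
  also have "map (\<lambda>y :: nat. y ^ 2 mod 23) [0..<23] = [0, 1, 4, 9, 16, 2, 13, 3, 18, 12, 8, 6, 6, 8, 12, 18, 3, 13, 2, 16, 9, 4, 1]"
    unfolding residues_list by simp
  also have "n \<in> set \<dots> \<longleftrightarrow> n \<notin> set nonresidues"
  proof -
    have "n \<in> set [0..<23]" using assms by simp
    then show ?thesis unfolding residues_list nonresidues_def by (simp only: list.set insert_iff empty_iff) (elim disjE; simp)
  qed
  finally show ?thesis .
qed

unbundle bit_operations_syntax

text \<open>
  Words are encoded by numbers, so that sums of words are computed by \<open>XOR\<close> and intersections
  by \<open>AND\<close> on numerals.
\<close>

definition wset :: "nat \<Rightarrow> nat set" where
  "wset m = {j. bit m j}"

lemma wset_0: "wset 0 = {}"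
  by (simp add: wset_def)

lemma wset_xor: "wset (m XOR n) = sym_diff (wset m) (wset n)"
  by (auto simp: wset_def bit_xor_iff)

lemma wset_and: "wset (m AND n) = wset m \<inter> wset n"
  by (auto simp: wset_def bit_and_iff)

definition rows :: "nat list" where
  "rows = [16436384, 16095553, 15413891, 14050567, 11323919, 14259230, 11741245, 15093882, 13410549, 10043883, 11699158, 15009708, 13242201, 9707187, 11025766, 13662924, 10548633, 12708658, 8640101, 8891594, 9394580, 10400552, 12412496]"

definition row_ok :: "nat \<Rightarrow> nat \<Rightarrow> bool" where
  "row_ok i m \<longleftrightarrow> (\<forall>j\<in>set [0..<24]. bit m j \<longleftrightarrow> (j = 23 \<or> (j + 23 - i) mod 23 \<in> set nonresidues))"

lemma row_ok_upto: "list_all2 row_ok [0..<23] rows"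
  unfolding residues_list rows_def list_all2_Cons list_all2_Nil
  by (intro conjI TrueI; simp add: row_ok_def points_list nonresidues_def bit_0)

lemma row_bits:
  assumes "i < 23" "j < 24"
  shows "bit (rows ! i) j \<longleftrightarrow> (j = 23 \<or> (j + 23 - i) mod 23 \<in> set nonresidues)"
  using list_all2_nthD[OF row_ok_upto, of i] assms by (simp add: row_ok_def)

lemma rows_less: "\<forall>m\<in>set rows. m < 2 ^ 24"
  unfolding rows_def by simp

lemma wset_subset: assumes "m < 2 ^ 24" shows "wset m \<subseteq> golay_points"
proof
  fix j assume "j \<in> wset m"
  then have "bit (take_bit 24 m) j" using assms by (simp add: wset_def take_bit_nat_eq_self)
  then show "j \<in> golay_points" by (simp add: bit_take_bit_iff golay_points_def)
qed

lemma golay_generator_eq: assumes "i < 23" shows "golay_generator i = wset (rows ! i)"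
proof -
  have "(\<exists>n<23. n \<in> set nonresidues \<and> j = (n + i) mod 23) \<longleftrightarrow> j < 23 \<and> (j + 23 - i) mod 23 \<in> set nonresidues" for j
  proof
    assume "\<exists>n<23. n \<in> set nonresidues \<and> j = (n + i) mod 23"
    then obtain n where n: "n < 23" "n \<in> set nonresidues" "j = (n + i) mod 23" by blast
    then have "(j + 23 - i) mod 23 = n" using assms by (cases "n + i < 23") (simp_all add: mod_if)
    then show "j < 23 \<and> (j + 23 - i) mod 23 \<in> set nonresidues" using n by simp
  next
    assume *: "j < 23 \<and> (j + 23 - i) mod 23 \<in> set nonresidues"
    then have "j = ((j + 23 - i) mod 23 + i) mod 23" using assms by (simp add: mod_add_left_eq)
    then show "\<exists>n<23. n \<in> set nonresidues \<and> j = (n + i) mod 23" using * by (intro exI[of _ "(j + 23 - i) mod 23"]) auto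
  qed
  then have "golay_generator i = {j. j = 23 \<or> j < 23 \<and> (j + 23 - i) mod 23 \<in> set nonresidues}"
    using QuadRes_23_iff by (auto simp: golay_generator_def)
  also have "\<dots> = {j. j < 24 \<and> bit (rows ! i) j}"
    using row_bits assms by (auto simp: less_Suc_eq)
  also have "\<dots> = wset (rows ! i)"
  proof -
    have "rows ! i \<in> set rows" using assms list_all2_lengthD[OF row_ok_upto] by simp
    then have "wset (rows ! i) \<subseteq> golay_points" using wset_subset rows_less by blast
    then show ?thesis by (auto simp: wset_def golay_points_def)
  qed
  finally show ?thesis .
qed

definition word_sum :: "nat list \<Rightarrow> nat" where
  "word_sum is = foldr (\<lambda>i m. (rows ! i) XOR m) is 0"

lemma wset_word_sum: "set is \<subseteq> {..<23} \<Longrightarrow> wset (word_sum is) \<in> golay_code"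
proof (induction "is")
  case Nil
  then show ?case using golay_code.empty by (simp add: word_sum_def wset_0)
next
  case (Cons i js)
  have "wset (word_sum (i # js)) = sym_diff (wset (rows ! i)) (wset (word_sum js))"
    by (simp add: word_sum_def wset_xor)
  then show ?case using golay_code.sum[OF golay_code.generator[of i]] Cons by (simp add: golay_generator_eq)
qed

text \<open>
  An entry consists of the generators to be added and the mask of their sum. The \<open>j\<close>-th word contains
  \<open>j\<close> and no other point below 12: this is the row-reduced basis of the code.
\<close>

definition leading_words :: "(nat list \<times> nat) list" where
  "leading_words = [([1, 3, 6, 10, 11], 13062145),
    ([0, 1, 3, 4, 5, 6, 7, 8, 9, 11], 4845570),
    ([0, 3, 4, 7, 10], 13938692),
    ([3, 4, 5, 6, 8, 10], 7221256),
    ([1, 3, 4, 5, 7, 9, 10], 10170384),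
    ([2, 4, 5, 6, 8, 10, 11], 11952160),
    ([0, 2, 3, 6, 7, 8, 10], 15515712),
    ([4, 6, 7, 8, 9, 10], 2019456),
    ([5, 7, 8, 9, 10, 11], 4038912),
    ([0, 2, 5, 6], 8077824),
    ([7, 10, 11], 11654144),
    ([0, 2, 5, 9, 10], 14919680)]"

text \<open>
  The five octads through the points 0, 1, 2, 3.
\<close>

definition sextet_words :: "(nat list \<times> nat) list" where
  "sextet_words = [([4, 6, 9, 10], 3416079),
    ([2, 5, 8, 9, 11], 8536111),
    ([4, 5, 6, 7, 8, 11], 622863),
    ([1, 3, 4, 5, 7, 8, 9, 11], 5279),
    ([0, 2, 3, 4, 6, 7, 8, 10], 4196943)]"

text \<open>
  Nine octads, each containing at least five of the seven points 0, 1, 2, 3, 4, 5, 7. A permutation in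
  M24 that fixes these points therefore leaves each of the nine octads invariant.
\<close>

definition separating_words :: "(nat list \<times> nat) list" where
  "separating_words = [([0, 2, 3, 5, 6, 11], 4726955),
    ([0, 1, 3, 4, 6, 7], 2130606),
    ([0, 2, 5, 6, 9, 10], 5275709),
    ([1, 3, 6, 7, 10, 11], 2162811),
    ([0, 4, 6, 11], 10558),
    ([0, 4, 5, 7, 9, 10], 4325622),
    ([1, 5, 6, 8, 10, 11], 262637),
    ([2, 5, 8, 9, 11], 8536111),
    ([0, 1, 2, 3, 10], 8421811)]"

definition weight :: "nat \<Rightarrow> nat" where
  "weight m = length (filter (bit m) [0..<24])"

definition certified :: "nat list \<times> nat \<Rightarrow> bool" where
  "certified c \<longleftrightarrow> (\<forall>i\<in>set (fst c). i < 23) \<and> word_sum (fst c) = snd c \<and> snd c < 2 ^ 24 \<and> weight (snd c) = 8"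

lemma certified_words: "\<forall>c \<in> set (leading_words @ sextet_words @ separating_words). certified c"
  unfolding leading_words_def sextet_words_def separating_words_def append.simps list.set
  by (intro ballI, elim insertE emptyE; simp add: certified_def weight_def points_list word_sum_def rows_def bit_0)

lemma card_wset: assumes "m < 2 ^ 24" shows "card (wset m) = weight m"
proof -
  have "wset m = set (filter (bit m) [0..<24])" using wset_subset[OF assms] by (auto simp: wset_def golay_points_def)
  then show ?thesis unfolding weight_def by (simp only: distinct_card[OF distinct_filter[OF distinct_upt]])
qed

lemma certified_octad:
  assumes "certified (c, m)"
  shows "wset m \<in> golay_code" "card (wset m) = 8"
  using assms wset_word_sum[of c] card_wset[of m] by (auto simp: certified_def)

lemma leading_words_bits:
  "list_all2 (\<lambda>j c. \<forall>k\<in>set [0..<12]. bit (snd c) k \<longleftrightarrow> k = j) [0..<12] leading_words"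
proof -
  have l: "[0..<12] = [0, 1, 2, 3, 4, 5, 6, 7, 8, 9, 10, 11]" by (simp add: upt_rec)
  show ?thesis unfolding l leading_words_def list_all2_Cons list_all2_Nil
    by (intro conjI TrueI; simp add: bit_0)
qed

lemma sextet_cover:
  "\<forall>x\<in>set [0..<24]. \<exists>m\<in>set (map snd sextet_words). bit m 0 \<and> bit m 1 \<and> bit m 2 \<and> bit m 3 \<and> bit m x"
  unfolding points_list sextet_words_def by (simp add: bit_0)

text \<open>
  The binary digits of the signature tell which of the words contain the point.
\<close>

definition signature :: "nat list \<Rightarrow> nat \<Rightarrow> nat" where
  "signature ms j = foldr (\<lambda>m s. of_bool (bit m j) + 2 * s) ms 0"

lemma signature_cong: "(\<And>m. m \<in> set ms \<Longrightarrow> bit m j \<longleftrightarrow> bit m k) \<Longrightarrow> signature ms j = signature ms k"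
  by (induction ms) (auto simp: signature_def)

lemma leading_signatures:
  "map (signature (map snd leading_words)) [0..<24] = [1, 2, 4, 8, 16, 32, 64, 128, 256, 512, 1024, 2048, 1183, 2366, 1763, 3526, 3859, 2745, 493, 986, 1972, 3944, 2639, 3189]"
  unfolding points_list leading_words_def signature_def by (simp add: bit_0)

text \<open>
  The points outside 0, 1, 2, 3, 4, 5, 7 that the nine octads distinguish from each other. Only 12 is left out,
  which lies in the same octads as 10.
\<close>

definition movable_points :: "nat list" where
  "movable_points = [6, 8, 9, 10, 11, 13, 14, 15, 16, 17, 18, 19, 20, 21, 22, 23]"

lemma separating_signatures:
  "map (signature (map snd separating_words)) movable_points = [104, 336, 2, 0, 16, 17, 128, 262, 8, 160, 64, 1, 4, 10, 37, 384]"
  "signature (map snd separating_words) 12 = 0"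
  unfolding movable_points_def separating_words_def signature_def by (simp_all add: bit_0)

lemma separating_base:
  "\<forall>m\<in>set (map snd separating_words). length (filter (bit m) [0, 1, 2, 3, 4, 5, 7]) \<ge> 5"
  unfolding separating_words_def list.map snd_conv list.set
  by (intro ballI, elim insertE emptyE; simp add: bit_0)

definition generators :: "nat list" where
  "generators = 16777215 # rows"

text \<open>
  Self-orthogonality of the code, checked on the generators.
\<close>

lemma generator_pairs_sorted: "sorted_wrt (\<lambda>m n. even (weight (m AND n))) generators"
  unfolding generators_def rows_def sorted_wrt.simps list.set
  by (intro conjI TrueI; intro ballI; elim insertE emptyE; simp add: weight_def points_list bit_0)

lemma generator_weights: "\<forall>m\<in>set generators. weight m = 12 \<or> weight m = 24"
  unfolding generators_def rows_def list.set
  by (intro ballI, elim insertE emptyE; simp add: weight_def points_list bit_0)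

lemma generator_pairs:
  assumes "m \<in> set generators" "n \<in> set generators"
  shows "even (weight (m AND n))"
proof -
  obtain i j where ij: "i < length generators" "j < length generators" "m = generators ! i" "n = generators ! j"
    using assms by (metis in_set_conv_nth)
  consider "i < j" | "j < i" | "m = n" using ij by force
  then show ?thesis
  proof cases
    case 1
    then show ?thesis using sorted_wrt_nth_less[OF generator_pairs_sorted, of i j] ij by simp
  next
    case 2
    then have "even (weight (n AND m))" using sorted_wrt_nth_less[OF generator_pairs_sorted, of j i] ij by simp
    then show ?thesis by (simp only: and.commute)
  next
    case 3
    then have "weight (m AND n) = 12 \<or> weight (m AND n) = 24" using generator_weights assms by simp
    then show ?thesis by auto
  qed
qed

lemma generators_less: "m \<in> set generators \<Longrightarrow> m < 2 ^ 24"
  using rows_less by (auto simp: generators_def)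

lemma wset_all: "wset 16777215 = golay_points"
proof -
  have eq: "16777215 = (mask 24 :: nat)" by (simp add: mask_eq_exp_minus_1)
  show ?thesis unfolding eq wset_def golay_points_def bit_mask_iff by auto
qed

lemma golay_generator_words:
  "golay_points = wset 16777215 \<and> 16777215 \<in> set generators"
  "i < 23 \<Longrightarrow> golay_generator i = wset (rows ! i) \<and> rows ! i \<in> set generators"
proof -
  show "golay_points = wset 16777215 \<and> 16777215 \<in> set generators" by (simp add: wset_all generators_def)
  assume "i < 23"
  then show "golay_generator i = wset (rows ! i) \<and> rows ! i \<in> set generators"
    using list_all2_lengthD[OF row_ok_upto] by (simp add: golay_generator_eq generators_def)
qed

lemma golay_code_subset: "A \<in> golay_code \<Longrightarrow> A \<subseteq> golay_points"
proof (induction rule: golay_code.induct)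
  case (generator i)
  then show ?case using golay_generator_words(2) wset_subset generators_less by metis
qed auto

lemma golay_code_finite: "A \<in> golay_code \<Longrightarrow> finite A"
  by (rule finite_subset[OF golay_code_subset]) (auto simp: golay_points_def)

lemma card_sym_diff: "finite A \<Longrightarrow> finite B \<Longrightarrow> card (sym_diff A B) + 2 * card (A \<inter> B) = card A + card B"
proof -
  assume fin: "finite A" "finite B"
  have "card (sym_diff A B) = card (A - B) + card (B - A)"
    using fin by (intro card_Un_disjoint) auto
  then show ?thesis using fin card_Int_Diff[of A B] card_Int_Diff[of B A] by (simp add: Int_commute)
qed

lemma card_wset_and_even:
  assumes "m \<in> set generators" "n \<in> set generators"
  shows "even (card (wset m \<inter> wset n))"
proof -
  have "wset (m AND n) \<subseteq> golay_points"
    unfolding wset_and using wset_subset[OF generators_less[OF assms(1)]] by blast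
  then have "wset (m AND n) = set (filter (bit (m AND n)) [0..<24])" by (auto simp: wset_def golay_points_def)
  then have "card (wset (m AND n)) = weight (m AND n)"
    unfolding weight_def by (simp only: distinct_card[OF distinct_filter[OF distinct_upt]])
  then show ?thesis using generator_pairs[OF assms] by (simp add: wset_and)
qed

lemma golay_code_even_generator:
  assumes "A \<in> golay_code" "n \<in> set generators"
  shows "even (card (A \<inter> wset n))"
  using assms(1)
proof (induction rule: golay_code.induct)
  case all
  then show ?case using card_wset_and_even[OF _ assms(2)] golay_generator_words(1) by metis
next
  case (generator i)
  then show ?case using card_wset_and_even[OF _ assms(2)] golay_generator_words(2) by metis
next
  case (sum A B)
  have "sym_diff A B \<inter> wset n = sym_diff (A \<inter> wset n) (B \<inter> wset n)" by blast
  then show ?case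
    using card_sym_diff[of "A \<inter> wset n" "B \<inter> wset n"] golay_code_finite sum by (metis dvd_add_right_iff dvd_triv_left even_add finite_Int)
qed simp

lemma golay_code_even:
  assumes "A \<in> golay_code" "B \<in> golay_code"
  shows "even (card (A \<inter> B))"
  using assms(2)
proof (induction rule: golay_code.induct)
  case all
  then show ?case using golay_code_even_generator[OF assms(1)] golay_generator_words(1) by metis
next
  case (generator i)
  then show ?case using golay_code_even_generator[OF assms(1)] golay_generator_words(2) by metis
next
  case (sum B C)
  have "A \<inter> sym_diff B C = sym_diff (A \<inter> B) (A \<inter> C)" by blast
  then show ?case
    using card_sym_diff[of "A \<inter> B" "A \<inter> C"] golay_code_finite sum by (metis dvd_add_right_iff dvd_triv_left even_add finite_Int)
qed simp

text \<open>
  From \<open>|A + B| = |A| + |B| - 2 |A \<inter> B|\<close>, because all intersections are even and the generators have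
  weight 12 or 24.
\<close>

theorem golay_code_doubly_even: "A \<in> golay_code \<Longrightarrow> 4 dvd card A"
proof (induction rule: golay_code.induct)
  case all
  then show ?case by (simp add: golay_points_def)
next
  case (generator i)
  then have "card (golay_generator i) = 12 \<or> card (golay_generator i) = 24"
    using golay_generator_words(2)[of i] generator_weights generators_less by (simp add: card_wset)
  then show ?case by auto
next
  case (sum A B)
  have "4 dvd 2 * card (A \<inter> B)" using golay_code_even[OF sum.hyps] by auto
  moreover have "4 dvd card A + card B" using sum.IH by simp
  ultimately show ?case
    using card_sym_diff[of A B] golay_code_finite sum.hyps by (metis dvd_add_left_iff)
qed simp

lemma golay_code_separates:
  assumes "i \<in> golay_points" "j \<in> golay_points" "i \<noteq> j"
  shows "\<exists>C\<in>golay_code. i \<in> C \<longleftrightarrow> j \<notin> C"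
proof (rule ccontr)
  assume no: "\<not> ?thesis"
  let ?s = "signature (map snd leading_words)"
  have "bit m i \<longleftrightarrow> bit m j" if "m \<in> set (map snd leading_words)" for m
  proof -
    from that obtain c where "(c, m) \<in> set leading_words" by auto
    then have "wset m \<in> golay_code" using certified_octad certified_words by fastforce
    then have "\<not> (i \<in> wset m \<longleftrightarrow> j \<notin> wset m)" using no by blast
    then show ?thesis by (simp add: wset_def)
  qed
  then have "?s i = ?s j" by (rule signature_cong)
  moreover have "distinct (map ?s [0..<24])" unfolding leading_signatures by simp
  then have "inj_on ?s {0..<24}" by (simp add: distinct_map)
  ultimately show False using assms by (auto simp: golay_points_def inj_on_def)
qed

text \<open>
  The points below 12 are an information set: the leading words realise every pattern on them.
\<close>

theorem golay_code_systematic: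
  "S \<subseteq> {0..<12} \<Longrightarrow> \<exists>C\<in>golay_code. C \<inter> {0..<12} = S"
proof (induction S rule: infinite_finite_induct)
  case (infinite S)
  then show ?case using finite_subset by blast
next
  case empty
  then show ?case using golay_code.empty by blast
next
  case (insert j S)
  then obtain C where C: "C \<in> golay_code" "C \<inter> {0..<12} = S" by auto
  obtain c m where cm: "leading_words ! j = (c, m)" by (cases "leading_words ! j")
  have len: "length leading_words = 12" using list_all2_lengthD[OF leading_words_bits] by simp
  have "(c, m) \<in> set leading_words" using cm insert.prems len nth_mem by (metis atLeastLessThan_iff insert_subset)
  then have "wset m \<in> golay_code" using certified_octad certified_words by fastforce
  moreover have "wset m \<inter> {0..<12} = {j}"
    using list_all2_nthD[OF leading_words_bits, of j] insert.prems cm by (auto simp: wset_def)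
  moreover have "sym_diff C (wset m) \<inter> {0..<12} = sym_diff (C \<inter> {0..<12}) (wset m \<inter> {0..<12})" by blast
  ultimately have "sym_diff C (wset m) \<inter> {0..<12} = insert j S" using C(2) insert.hyps by auto
  then show ?case using golay_code.sum[OF C(1)] \<open>wset m \<in> golay_code\<close> by blast
qed

lemma golay_code_sextet:
  assumes "x \<in> golay_points"
  shows "\<exists>C\<in>golay_code. card C = 8 \<and> {0, 1, 2, 3, x} \<subseteq> C"
proof -
  have "x \<in> set [0..<24]" using assms by (simp add: golay_points_def)
  from bspec[OF sextet_cover this] obtain m
    where m: "m \<in> set (map snd sextet_words)" "bit m 0" "bit m 1" "bit m 2" "bit m 3" "bit m x"
    by blast
  then obtain c where "(c, m) \<in> set sextet_words" by auto
  then have "certified (c, m)" using certified_words by simp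
  then show ?thesis using certified_octad[of c m] m by (intro bexI[of _ "wset m"]) (auto simp: wset_def)
qed

unbundle no bit_operations_syntax

section \<open>Fixed points of permutations in M24\<close>

abbreviation inv_fun :: "('a \<Rightarrow> 'b) \<Rightarrow> 'b \<Rightarrow> 'a" where
  "inv_fun \<equiv> inv_into UNIV"

lemma funpow_fixed: "p x = x \<Longrightarrow> (p ^^ n) x = x"
  by (induction n) auto

lemma funpow_fixed_mult: "(p ^^ a) x = x \<Longrightarrow> (p ^^ (a * b)) x = x"
  using funpow_fixed[of "p ^^ a" x b] by (simp add: funpow_mult)

lemma funpow_fixed_coprime:
  assumes "(p ^^ a) x = x" "(p ^^ b) x = x" "coprime a b" "a > 0"
  shows "p x = x"
proof -
  obtain u v where uv: "a * u = b * v + 1" using bezout_nat[of a b] assms(3,4) by auto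
  have "x = (p ^^ (a * u)) x" using funpow_fixed_mult[OF assms(1)] by simp
  also have "\<dots> = p ((p ^^ (b * v)) x)" unfolding uv by simp
  also have "\<dots> = p x" using funpow_fixed_mult[OF assms(2)] by simp
  finally show ?thesis by simp
qed

lemma funpow_closed: "p ` A \<subseteq> A \<Longrightarrow> x \<in> A \<Longrightarrow> (p ^^ n) x \<in> A"
  by (induction n) auto

lemma funpow_distinct:
  assumes "inj p" "(p ^^ n) x = x" "\<And>d. 0 < d \<Longrightarrow> d < n \<Longrightarrow> (p ^^ d) x \<noteq> x"
  shows "inj_on (\<lambda>i. (p ^^ i) x) {..<n}"
proof (rule linorder_inj_onI')
  fix i j assume ij: "i \<in> {..<n}" "j \<in> {..<n}" "i < j"
  have "p ^^ j = p ^^ (i + (j - i))" using ij by simp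
  then have eq: "(p ^^ j) x = (p ^^ i) ((p ^^ (j - i)) x)" by (simp only: funpow_add comp_apply)
  have "(p ^^ (j - i)) x \<noteq> x" using assms(3)[of "j - i"] ij by simp
  then show "(p ^^ i) x \<noteq> (p ^^ j) x" unfolding eq inj_eq[OF inj_fn[OF assms(1)]] by (rule not_sym)
qed

text \<open>
  The points that are moved fall into cycles of length \<open>r\<close>.
\<close>

theorem card_cong_fixed_points:
  fixes r :: nat
  assumes "finite A" "inj p" "p ` A \<subseteq> A" "prime r" "\<And>x. x \<in> A \<Longrightarrow> (p ^^ r) x = x"
  shows "[card A = card {x \<in> A. p x = x}] (mod r)"
  using assms(1,3,5)
proof (induction A rule: finite_psubset_induct)
  case (psubset A)
  show ?case
  proof (cases "\<forall>x\<in>A. p x = x")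
    case True
    then have "{x \<in> A. p x = x} = A" by blast
    then show ?thesis by simp
  next
    case False
    then obtain x where x: "x \<in> A" "p x \<noteq> x" by blast
    define C where "C = (\<lambda>i. (p ^^ i) x) ` {..<r}"
    have r0: "r > 0" using assms(4) by (simp add: prime_gt_0_nat)
    have ne: "(p ^^ d) x \<noteq> x" if "0 < d" "d < r" for d
    proof
      assume "(p ^^ d) x = x"
      moreover have "coprime d r"
        using that assms(4) by (metis coprime_commute nat_dvd_not_less prime_imp_coprime)
      ultimately show False using funpow_fixed_coprime[of d p x r] psubset.prems(2)[OF x(1)] that x by blast
    qed
    have card_C: "card C = r"
      unfolding C_def using card_image[OF funpow_distinct[OF assms(2) psubset.prems(2)[OF x(1)] ne]] by simp
    have CA: "C \<subseteq> A" using funpow_closed[OF psubset.prems(1) x(1)] by (auto simp: C_def)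
    have pC: "p ` C \<subseteq> C"
    proof safe
      fix y assume "y \<in> C"
      then obtain i where i: "i < r" "y = (p ^^ i) x" by (auto simp: C_def)
      show "p y \<in> C"
      proof (cases "Suc i = r")
        case True
        then have "p y = (p ^^ 0) x" using i psubset.prems(2)[OF x(1)] by auto
        then show ?thesis using r0 unfolding C_def by blast
      next
        case False
        then have "Suc i < r" "p y = (p ^^ Suc i) x" using i by auto
        then show ?thesis unfolding C_def by blast
      qed
    qed
    have C_moved: "p y \<noteq> y" if "y \<in> C" for y
    proof
      assume "p y = y"
      from that obtain i where i: "i < r" "y = (p ^^ i) x" by (auto simp: C_def)
      have "(p ^^ i) (p x) = (p ^^ i) x" using \<open>p y = y\<close> i by (simp add: funpow_swap1)
      then show False using x(2) unfolding inj_eq[OF inj_fn[OF assms(2)]] by blast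
    qed
    have fin_C: "finite C" by (simp add: C_def)
    have "p ` C = C" by (rule endo_inj_surj[OF fin_C pC]) (rule inj_on_subset[OF assms(2)], simp)
    have diff: "p ` (A - C) \<subseteq> A - C"
    proof safe
      fix y assume "y \<in> A" "y \<notin> C"
      then show "p y \<in> A" using psubset.prems(1) by blast
      assume "p y \<in> C"
      then obtain z where "z \<in> C" "p y = p z" using \<open>p ` C = C\<close> by blast
      then show False using \<open>y \<notin> C\<close> assms(2) by (auto dest: injD)
    qed
    have "x \<in> C" using r0 unfolding C_def by (intro image_eqI[of _ _ 0]) auto
    then have "A - C \<subset> A" using x by blast
    from psubset.IH[OF this diff] psubset.prems(2)
    have "[card (A - C) = card {x \<in> A - C. p x = x}] (mod r)" by blast
    also have "{x \<in> A - C. p x = x} = {x \<in> A. p x = x}" using C_moved by blast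
    finally have "[card (A - C) + r = card {x \<in> A. p x = x}] (mod r)" by (simp add: cong_def)
    moreover have "card (A - C) + r = card A"
      using card_C CA psubset.hyps by (metis card_Diff_subset card_mono fin_C le_add_diff_inverse2)
    ultimately show ?thesis by simp
  qed
qed

lemma finite_points: "finite golay_points" and card_points: "card golay_points = 24"
  by (simp_all add: golay_points_def)

lemma M24_permutes: "\<pi> \<in> M24 \<Longrightarrow> \<pi> permutes golay_points"
  by (simp add: M24_def)

lemma M24_inj: "\<pi> \<in> M24 \<Longrightarrow> inj \<pi>"
  using M24_permutes permutes_inj by blast

lemma M24_point: "\<pi> \<in> M24 \<Longrightarrow> \<pi> x \<in> golay_points \<longleftrightarrow> x \<in> golay_points"
  using M24_permutes permutes_in_image by metis

lemma M24_code: "\<pi> \<in> M24 \<Longrightarrow> C \<in> golay_code \<Longrightarrow> \<pi> ` C \<in> golay_code"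
  by (auto simp: M24_def)

lemma M24_comp: assumes "\<pi> \<in> M24" "\<rho> \<in> M24" shows "\<pi> \<circ> \<rho> \<in> M24"
proof -
  have "(\<lambda>C. (\<pi> \<circ> \<rho>) ` C) ` golay_code = (\<lambda>C. \<pi> ` C) ` ((\<lambda>C. \<rho> ` C) ` golay_code)"
    by (simp add: image_image image_comp)
  then show ?thesis using assms by (simp add: M24_def permutes_compose)
qed

lemma finite_M24: "finite M24"
  by (rule finite_subset[OF _ finite_permutations[OF finite_points]]) (auto simp: M24_def)

lemma M24_image_inj: "\<pi> \<in> M24 \<Longrightarrow> card (\<pi> ` A) = card A"
  using M24_inj card_image inj_on_subset subset_UNIV by metis

definition Fix :: "(nat \<Rightarrow> nat) \<Rightarrow> nat set" where
  "Fix p = {x \<in> golay_points. p x = x}"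

lemma finite_Fix: "finite (Fix p)"
  by (simp add: Fix_def finite_points)

lemma card_moved: "card {x \<in> golay_points. p x \<noteq> x} = 24 - card (Fix p)"
proof -
  have "{x \<in> golay_points. p x \<noteq> x} = golay_points - Fix p" by (auto simp: Fix_def)
  then show ?thesis using card_Diff_subset[OF finite_Fix, of p golay_points] card_points by (auto simp: Fix_def)
qed

text \<open>
  A word and its image differ only in moved points, by a word of weight 0 or 4. If all differences are
  empty, then every word is invariant, contradicting the separation of points. If four of exactly five
  moved points form a word, then so do their images; the two omitted points make up the sum of these two
  words, which would have weight 2.
\<close>

lemma M24_small_support:
  assumes "\<pi> \<in> M24" "card {x \<in> golay_points. \<pi> x \<noteq> x} \<le> 5" "card {x \<in> golay_points. \<pi> x \<noteq> x} \<noteq> 4"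
  shows "\<pi> = id"
proof (rule ccontr)
  assume "\<pi> \<noteq> id"
  define Z where "Z = {x \<in> golay_points. \<pi> x \<noteq> x}"
  have fin: "finite Z" by (simp add: Z_def finite_points)
  have fixes_outside: "\<pi> x = x" if "x \<notin> Z" for x
    using that M24_permutes[OF assms(1)] by (cases "x \<in> golay_points") (auto simp: Z_def permutes_def)
  have Z_inv: "\<pi> x \<in> Z \<longleftrightarrow> x \<in> Z" for x
    using M24_inj[OF assms(1)] M24_point[OF assms(1)] by (auto simp: Z_def dest: injD)
  obtain z where z: "z \<in> Z" using \<open>\<pi> \<noteq> id\<close> fixes_outside by (metis eq_id_iff)
  then have "z \<in> golay_points" "\<pi> z \<in> golay_points" "z \<noteq> \<pi> z" using M24_point[OF assms(1)] by (auto simp: Z_def)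
  then obtain C where C: "C \<in> golay_code" "z \<in> C \<longleftrightarrow> \<pi> z \<notin> C" using golay_code_separates by blast
  define w where "w = sym_diff C (\<pi> ` C)"
  have w: "w \<in> golay_code" unfolding w_def by (intro golay_code.sum C(1) M24_code[OF assms(1)])
  have "w \<noteq> {}"
  proof
    assume "w = {}"
    then have "\<pi> ` C = C" by (auto simp: w_def)
    then have "z \<in> C \<longleftrightarrow> \<pi> z \<in> C" using M24_inj[OF assms(1)] by (metis inj_image_mem_iff)
    then show False using C by blast
  qed
  have wZ: "w \<subseteq> Z"
  proof
    fix x assume "x \<in> w"
    show "x \<in> Z"
    proof (rule ccontr)
      assume "x \<notin> Z"
      then have "\<pi> x = x" by (rule fixes_outside)
      then have "x \<in> C \<longleftrightarrow> x \<in> \<pi> ` C" using M24_inj[OF assms(1)] by (metis inj_image_mem_iff)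
      then show False using \<open>x \<in> w\<close> by (auto simp: w_def)
    qed
  qed
  have fin_w: "finite w" using wZ fin finite_subset by blast
  have "card w \<le> card Z" using wZ fin by (rule card_mono[rotated])
  moreover have "card w > 0" using \<open>w \<noteq> {}\<close> fin_w by (simp add: card_gt_0_iff)
  moreover have "4 dvd card w" using w by (rule golay_code_doubly_even)
  ultimately have card_w: "card w = 4" "card Z = 5" using assms(2,3) unfolding Z_def[symmetric]
    by (auto elim!: dvdE)
  then have "card (Z - w) = 1" using wZ fin by (simp add: card_Diff_subset fin_w)
  then obtain a where a: "Z - w = {a}" using card_1_singletonE by blast
  have aZ: "a \<in> Z" "\<pi> a \<in> Z" "\<pi> a \<noteq> a" using a Z_inv[of a] by (auto simp: Z_def)
  have "\<pi> ` Z = Z" using Z_inv by (intro endo_inj_surj[OF fin] inj_on_subset[OF M24_inj[OF assms(1)] subset_UNIV]) blast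
  have w_eq: "w = Z - {a}" using a wZ by blast
  have "\<pi> ` w = \<pi> ` Z - \<pi> ` {a}" unfolding w_eq by (rule image_set_diff[OF M24_inj[OF assms(1)]])
  then have pw: "\<pi> ` w = Z - {\<pi> a}" using \<open>\<pi> ` Z = Z\<close> by simp
  have "sym_diff w (\<pi> ` w) = {a, \<pi> a}" unfolding pw unfolding w_eq using aZ by auto
  then have "{a, \<pi> a} \<in> golay_code" using golay_code.sum[OF w M24_code[OF assms(1) w]] by simp
  then have "4 dvd card {a, \<pi> a}" by (rule golay_code_doubly_even)
  moreover have "card {a, \<pi> a} = 2" using aZ by simp
  ultimately show False by simp
qed

section \<open>Multiple transitivity\<close>

lemma distinct_list_of_card:
  assumes "k \<le> card A"
  obtains xs where "distinct xs" "set xs \<subseteq> A" "length xs = k"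
proof -
  obtain B where B: "B \<subseteq> A" "card B = k" "finite B" using obtain_subset_with_card_n[OF assms] by metis
  obtain xs where "set xs = B" "distinct xs" using finite_distinct_list[OF B(3)] by blast
  then show thesis using that[of xs] B distinct_card[of xs] by auto
qed

locale M24_subgroup =
  fixes H :: "(nat \<Rightarrow> nat) set"
  assumes subset_M24: "H \<subseteq> M24"
    and comp: "g \<in> H \<Longrightarrow> h \<in> H \<Longrightarrow> g \<circ> h \<in> H"
    and nonempty: "H \<noteq> {}"
begin

lemma M24: "g \<in> H \<Longrightarrow> g \<in> M24"
  using subset_M24 by blast

lemma inj: "g \<in> H \<Longrightarrow> inj g"
  using M24 M24_inj by blast

lemma point: "g \<in> H \<Longrightarrow> g x \<in> golay_points \<longleftrightarrow> x \<in> golay_points"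
  using M24 M24_point by blast

lemma funpow_Suc: "g \<in> H \<Longrightarrow> g ^^ Suc n \<in> H"
  by (induction n) (auto simp: comp)

lemma order_exists: assumes "g \<in> H" obtains n where "n > 0" "g ^^ n = id"
proof -
  have "finite H" using finite_M24 subset_M24 finite_subset by blast
  moreover have "(\<lambda>n. g ^^ Suc n) ` UNIV \<subseteq> H" using funpow_Suc[OF assms] by blast
  ultimately have "\<not> inj (\<lambda>n :: nat. g ^^ Suc n)"
    using finite_subset finite_imageD infinite_UNIV_nat by blast
  then obtain i j where "i \<noteq> j" "g ^^ Suc i = g ^^ Suc j" unfolding inj_def by blast
  then obtain i j where ij: "i < j" "g ^^ Suc i = g ^^ Suc j" by (metis linorder_neqE_nat)
  have "g ^^ Suc j = g ^^ (Suc i + (j - i))" using ij(1) by simp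
  then have "g ^^ Suc i = g ^^ Suc i \<circ> g ^^ (j - i)" unfolding ij(2)[symmetric] by (simp only: funpow_add)
  then have "(g ^^ Suc i) x = (g ^^ Suc i) ((g ^^ (j - i)) x)" for x by (metis comp_apply)
  then have "g ^^ (j - i) = id" unfolding inj_eq[OF inj_fn[OF inj[OF assms]]] by (simp add: fun_eq_iff)
  then show thesis using that[of "j - i"] ij(1) by simp
qed

lemma one: "id \<in> H"
  using nonempty order_exists funpow_Suc by (metis all_not_in_conv not0_implies_Suc not_gr_zero)

lemma funpow: "g \<in> H \<Longrightarrow> g ^^ n \<in> H"
  by (cases n) (auto simp: one funpow_Suc simp del: funpow.simps(2))

lemma inv_fun: assumes "g \<in> H" shows "inv_fun g \<in> H"
proof -
  obtain n where n: "n > 0" "g ^^ n = id" using order_exists[OF assms] .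
  have "g ((g ^^ (n - 1)) x) = x" for x
    using n by (metis Suc_diff_1 comp_apply funpow.simps(2) id_apply)
  then have "inv_fun g = g ^^ (n - 1)" by (intro ext inv_f_eq[OF inj[OF assms]])
  then show ?thesis using funpow[OF assms] by simp
qed

lemma inv_fun_left: "g \<in> H \<Longrightarrow> inv_fun g (g x) = x"
  using inj by simp

lemma inv_fun_right: assumes "g \<in> H" shows "g (inv_fun g x) = x"
proof -
  have "surj g" using M24_permutes[OF M24[OF assms]] permutes_surj by blast
  then show ?thesis by (rule surj_f_inv_f)
qed

lemma inv_fun_eq_iff: "g \<in> H \<Longrightarrow> inv_fun g y = x \<longleftrightarrow> y = g x"
  using inv_fun_left inv_fun_right by metis

definition conjugate :: "(nat \<Rightarrow> nat) \<Rightarrow> (nat \<Rightarrow> nat) \<Rightarrow> nat \<Rightarrow> nat" where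
  "conjugate g u = (\<lambda>x. g (u (inv_fun g x)))"

lemma conjugate_mem: assumes "g \<in> H" "u \<in> H" shows "conjugate g u \<in> H"
proof -
  have "conjugate g u = g \<circ> (u \<circ> inv_fun g)" by (auto simp: conjugate_def)
  then show ?thesis using comp inv_fun assms by simp
qed

lemma conjugate_apply: "g \<in> H \<Longrightarrow> conjugate g u (g x) = g (u x)"
  by (simp add: conjugate_def inv_fun_left)

lemma conjugate_funpow: "g \<in> H \<Longrightarrow> conjugate g u ^^ n = conjugate g (u ^^ n)"
proof (induction n)
  case (Suc n)
  then show ?case by (auto simp: conjugate_def inv_fun_left)
qed (auto simp: conjugate_def inv_fun_right)

lemma conjugate_id: "g \<in> H \<Longrightarrow> conjugate g id = id"
  by (auto simp: conjugate_def inv_fun_right)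

lemma Fix_conjugate: assumes "g \<in> H" shows "Fix (conjugate g u) = g ` Fix u"
proof safe
  fix x assume "x \<in> Fix (conjugate g u)"
  then have x: "x \<in> golay_points" "g (u (inv_fun g x)) = x" by (auto simp: Fix_def conjugate_def)
  then have "u (inv_fun g x) = inv_fun g x" using inv_fun_left[OF assms] by metis
  moreover have "inv_fun g x \<in> golay_points" using point[OF assms, of "inv_fun g x"] x(1) inv_fun_right[OF assms] by simp
  ultimately have "inv_fun g x \<in> Fix u" by (simp add: Fix_def)
  then show "x \<in> g ` Fix u" using inv_fun_right[OF assms] by (metis image_eqI)
next
  fix x assume "x \<in> Fix u"
  then show "g x \<in> Fix (conjugate g u)" using point[OF assms] by (auto simp: Fix_def conjugate_apply[OF assms])
qed

lemma card_image_H: "g \<in> H \<Longrightarrow> card (g ` A) = card A"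
  using M24 M24_image_inj by blast

lemma image_closed_eq: assumes "g \<in> H" "finite A" "g ` A \<subseteq> A" shows "g ` A = A"
  by (rule endo_inj_surj[OF assms(2,3)]) (rule inj_on_subset[OF inj[OF assms(1)]], simp)

definition stab :: "nat list \<Rightarrow> (nat \<Rightarrow> nat) set" where
  "stab xs = {g \<in> H. \<forall>x\<in>set xs. g x = x}"

lemma stabD: "g \<in> stab xs \<Longrightarrow> g \<in> H" "g \<in> stab xs \<Longrightarrow> x \<in> set xs \<Longrightarrow> g x = x"
  by (auto simp: stab_def)

definition tuple :: "nat \<Rightarrow> nat list \<Rightarrow> bool" where
  "tuple k xs \<longleftrightarrow> distinct xs \<and> length xs = k \<and> set xs \<subseteq> golay_points"

definition transitive :: "nat \<Rightarrow> bool" where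
  "transitive k \<longleftrightarrow> (\<forall>xs ys. tuple k xs \<longrightarrow> tuple k ys \<longrightarrow> (\<exists>g\<in>H. map g xs = ys))"

lemma transitive_0: "transitive 0"
  using one by (auto simp: transitive_def tuple_def)

definition invariant :: "nat list \<Rightarrow> nat set \<Rightarrow> bool" where
  "invariant xs A \<longleftrightarrow> A \<subseteq> golay_points - set xs \<and> (\<forall>g\<in>stab xs. g ` A \<subseteq> A)"

lemma invariant_finite: "invariant xs A \<Longrightarrow> finite A"
  unfolding invariant_def using finite_points finite_subset by blast

lemma invariant_diff:
  assumes "invariant xs A" shows "invariant xs (golay_points - set xs - A)"
  unfolding invariant_def
proof (intro conjI ballI)
  fix g assume g: "g \<in> stab xs"
  have "g ` A = A"
    using image_closed_eq[OF stabD(1)[OF g] invariant_finite[OF assms]] assms g by (simp add: invariant_def)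
  moreover have "g ` set xs = set xs" using stabD(2)[OF g] by simp
  ultimately show "g ` (golay_points - set xs - A) \<subseteq> golay_points - set xs - A"
    using point[OF stabD(1)[OF g]] inj[OF stabD(1)[OF g]] by (auto simp: inj_eq) (metis imageE inj_eq)+
qed blast

lemma card_complement:
  assumes "tuple k xs" "invariant xs A"
  shows "card (golay_points - set xs - A) = 24 - k - card A" "card A \<le> 24 - k"
proof -
  have 1: "card (golay_points - set xs) = 24 - k"
    using assms(1) card_points by (simp add: tuple_def card_Diff_subset distinct_card)
  have 2: "A \<subseteq> golay_points - set xs" using assms(2) by (simp add: invariant_def)
  show "card (golay_points - set xs - A) = 24 - k - card A"
    using 1 card_Diff_subset[OF invariant_finite[OF assms(2)] 2] by simp
  show "card A \<le> 24 - k" using 1 2 card_mono finite_points by (metis finite_Diff)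
qed

text \<open>
  The orbit of a point under the pointwise stabilizer is an invariant set.
\<close>

lemma transitive_step:
  assumes "transitive k"
    and full: "\<And>xs A. tuple k xs \<Longrightarrow> invariant xs A \<Longrightarrow> A \<noteq> {} \<Longrightarrow> card A = 24 - k"
  shows "transitive (Suc k)"
  unfolding transitive_def
proof (intro allI impI)
  fix xs' ys' assume t: "tuple (Suc k) xs'" "tuple (Suc k) ys'"
  obtain x xs y ys where xs': "xs' = x # xs" and ys': "ys' = y # ys"
    using t by (auto simp: tuple_def length_Suc_conv)
  have t': "tuple k xs" "tuple k ys" and x: "x \<in> golay_points - set xs" and y: "y \<in> golay_points - set ys"
    using t by (auto simp: xs' ys' tuple_def)
  obtain g where g: "g \<in> H" "map g xs = ys" using assms(1) t' by (auto simp: transitive_def)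
  have gx: "g x \<in> golay_points - set ys"
    using x point[OF g(1)] inj[OF g(1)] by (auto simp: inj_eq simp flip: g(2))
  define A where "A = (\<lambda>h. h (g x)) ` stab ys"
  have stab_comp: "h \<circ> h' \<in> stab ys" if "h \<in> stab ys" "h' \<in> stab ys" for h h'
    using that comp by (auto simp: stab_def)
  have inv: "invariant ys A"
    unfolding invariant_def
  proof (intro conjI ballI)
    show "A \<subseteq> golay_points - set ys"
    proof
      fix z assume "z \<in> A"
      then obtain h where h: "h \<in> stab ys" "z = h (g x)" by (auto simp: A_def)
      have "z \<notin> set ys"
      proof
        assume "z \<in> set ys"
        then have "h z = h (g x)" using stabD(2)[OF h(1)] h(2) by simp
        then show False using \<open>z \<in> set ys\<close> gx inj[OF stabD(1)[OF h(1)]] by (auto simp: inj_eq)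
      qed
      then show "z \<in> golay_points - set ys" using gx point[OF stabD(1)[OF h(1)]] h(2) by auto
    qed
    show "h ` A \<subseteq> A" if "h \<in> stab ys" for h
      using stab_comp[OF that] unfolding A_def by (force simp: comp_def)
  qed
  have "id \<in> stab ys" by (simp add: stab_def one)
  then have "g x \<in> A" unfolding A_def by (metis id_apply image_eqI)
  then have "card A = 24 - k" using full[OF t'(2) inv] by blast
  then have "golay_points - set ys - A = {}"
    using card_complement(1)[OF t'(2) inv] finite_points by simp
  then obtain h where h: "h \<in> stab ys" "y = h (g x)" using y by (auto simp: A_def)
  have "map (h \<circ> g) xs' = ys'"
    using h stabD(2)[OF h(1)] g(2) by (auto simp: xs' ys' map_idI simp flip: map_map)
  then show "\<exists>g\<in>H. map g xs' = ys'" using comp[OF stabD(1)[OF h(1)] g(1)] by blast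
qed

text \<open>
  By \<open>k\<close>-fold transitivity, \<open>k\<close> fixed points of \<open>u\<close> can be moved to the points \<open>xs\<close>.
\<close>

lemma conjugate_into_stab:
  assumes "transitive k" "tuple k xs" "k \<le> card (Fix u)"
  obtains g where "g \<in> H" "set xs \<subseteq> Fix (conjugate g u)"
proof -
  obtain fs where fs: "distinct fs" "set fs \<subseteq> Fix u" "length fs = k" using distinct_list_of_card[OF assms(3)] by blast
  then have "tuple k fs" by (auto simp: tuple_def Fix_def)
  then obtain g where g: "g \<in> H" "map g fs = xs" using assms by (auto simp: transitive_def)
  have "set xs = g ` set fs" using g(2) by auto
  then have "set xs \<subseteq> Fix (conjugate g u)" using fs(2) Fix_conjugate[OF g(1), of u] by blast
  then show thesis using that g(1) by blast
qed

lemma stabI_Fix: "u \<in> H \<Longrightarrow> set xs \<subseteq> Fix u \<Longrightarrow> u \<in> stab xs"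
  by (auto simp: stab_def Fix_def)

text \<open>
  A conjugate of \<open>u\<close> fixes \<open>xs\<close> and acts on \<open>A\<close> with at most \<open>card (Fix u) - k\<close> fixed points.
  Elements of several prime orders thus restrict the sizes of the orbits of a stabilizer.
\<close>

lemma invariant_card_cong:
  assumes "transitive k" "tuple k xs" "invariant xs A"
    and "u \<in> H" "prime r" "u ^^ r = id" "k \<le> card (Fix u)"
  shows "\<exists>j\<le>card (Fix u) - k. [card A = j] (mod r)"
proof -
  obtain g where g: "g \<in> H" "set xs \<subseteq> Fix (conjugate g u)" using conjugate_into_stab[OF assms(1,2,7)] .
  define v where "v = conjugate g u"
  have v: "v \<in> stab xs" unfolding v_def by (rule stabI_Fix[OF conjugate_mem[OF g(1) assms(4)] g(2)])
  have "v ^^ r = id" unfolding v_def conjugate_funpow[OF g(1)] assms(6) by (rule conjugate_id[OF g(1)])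
  then have "[card A = card {x \<in> A. v x = x}] (mod r)"
    using v assms(3,5) inj[OF stabD(1)[OF v]]
    by (intro card_cong_fixed_points[OF invariant_finite[OF assms(3)]]) (auto simp: invariant_def)
  moreover have "{x \<in> A. v x = x} \<subseteq> Fix v - set xs"
    using assms(3) by (auto simp: invariant_def Fix_def)
  then have "card {x \<in> A. v x = x} \<le> card (Fix v - set xs)"
    by (rule card_mono[rotated]) (simp add: finite_Fix)
  moreover have "card (Fix v - set xs) = card (Fix u) - k"
    using g(2) assms(2) card_image_H[OF g(1)] unfolding v_def
    by (simp add: card_Diff_subset tuple_def distinct_card Fix_conjugate[OF g(1)])
  ultimately show ?thesis by metis
qed

end

lemma orbit_sizes:
  fixes n :: nat
  shows "n \<le> 24 \<Longrightarrow> n mod 11 \<le> 2 \<Longrightarrow> n mod 7 \<le> 3 \<Longrightarrow> n > 2 \<Longrightarrow> n = 24 \<or> n < 22 \<Longrightarrow> n = 24"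
    and "n \<le> 23 \<Longrightarrow> n mod 11 \<le> 1 \<Longrightarrow> n mod 7 \<le> 2 \<Longrightarrow> n > 0 \<Longrightarrow> n \<noteq> 1 \<Longrightarrow> n \<noteq> 22 \<Longrightarrow> n = 23"
    and "n \<le> 22 \<Longrightarrow> n mod 11 = 0 \<Longrightarrow> n mod 7 \<le> 1 \<Longrightarrow> n > 0 \<Longrightarrow> n = 22"
    and "n \<le> 21 \<Longrightarrow> n mod 7 = 0 \<Longrightarrow> n mod 5 \<le> 1 \<Longrightarrow> n > 0 \<Longrightarrow> n = 21"
proof -
  have cases: "n \<le> 24 \<Longrightarrow> n \<in> set (24 # [0..<24])" by auto
  show "n \<le> 24 \<Longrightarrow> n mod 11 \<le> 2 \<Longrightarrow> n mod 7 \<le> 3 \<Longrightarrow> n > 2 \<Longrightarrow> n = 24 \<or> n < 22 \<Longrightarrow> n = 24"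
    using cases unfolding points_list list.set by (elim meta_impE insertE emptyE) simp_all
  show "n \<le> 23 \<Longrightarrow> n mod 11 \<le> 1 \<Longrightarrow> n mod 7 \<le> 2 \<Longrightarrow> n > 0 \<Longrightarrow> n \<noteq> 1 \<Longrightarrow> n \<noteq> 22 \<Longrightarrow> n = 23"
    using cases unfolding points_list list.set by (elim meta_impE insertE emptyE) simp_all
  show "n \<le> 22 \<Longrightarrow> n mod 11 = 0 \<Longrightarrow> n mod 7 \<le> 1 \<Longrightarrow> n > 0 \<Longrightarrow> n = 22"
    using cases unfolding points_list list.set by (elim meta_impE insertE emptyE) simp_all
  show "n \<le> 21 \<Longrightarrow> n mod 7 = 0 \<Longrightarrow> n mod 5 \<le> 1 \<Longrightarrow> n > 0 \<Longrightarrow> n = 21"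
    using cases unfolding points_list list.set by (elim meta_impE insertE emptyE) simp_all
qed

lemma (in M24_subgroup) invariant_card_mod:
  assumes "transitive k" "tuple k xs" "invariant xs A"
    and "u \<in> H" "prime r" "u ^^ r = id" "k \<le> card (Fix u)"
  shows "card A mod r \<le> card (Fix u) - k"
proof -
  obtain j where "j \<le> card (Fix u) - k" "[card A = j] (mod r)" using invariant_card_cong[OF assms] by blast
  then show ?thesis by (metis cong_def le_trans mod_less_eq_dividend)
qed

section \<open>Generating M24\<close>

definition octad :: "nat set \<Rightarrow> bool" where
  "octad D \<longleftrightarrow> D \<in> golay_code \<and> card D = 8"

lemma octad_image: "g \<in> M24 \<Longrightarrow> octad D \<Longrightarrow> octad (g ` D)"
  by (simp add: octad_def M24_code M24_image_inj)

lemma octad_finite: "octad D \<Longrightarrow> finite D"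
  by (simp add: octad_def golay_code_finite)

lemma octad_subset: "octad D \<Longrightarrow> D \<subseteq> golay_points"
  by (simp add: octad_def golay_code_subset)

text \<open>
  The fixed points of permutations of cycle types \<open>1\<^sup>2 11\<^sup>2\<close> (for \<open>p\<close>), \<open>3 21\<close> (for \<open>q\<close>), \<open>1 2 7 14\<close> (for \<open>s\<close>)
  and \<open>1 3 5 15\<close> (for \<open>t\<close>). The powers \<open>s ^^ 2\<close>, \<open>s ^^ 7\<close>, \<open>t ^^ 3\<close> and \<open>t ^^ 5\<close> supply elements of orders 7,
  2, 5 and 3.
\<close>

locale M24_generators = M24_subgroup +
  fixes p q s t :: "nat \<Rightarrow> nat"
  assumes p: "p \<in> H" "p ^^ 11 = id" "card (Fix p) = 2"
    and q: "q \<in> H" "Fix (q ^^ 2) = {}"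
    and s: "s \<in> H" "s ^^ 14 = id" "card (Fix s) = 1" "card (Fix (s ^^ 2)) = 3" "card (Fix (s ^^ 7)) = 8"
    and t: "t \<in> H" "t ^^ 15 = id" "card (Fix t) = 1" "card (Fix (t ^^ 3)) = 4" "card (Fix (t ^^ 5)) = 6"
begin

lemma order_7: "s ^^ 2 \<in> H" "(s ^^ 2) ^^ 7 = id"
  using funpow[OF s(1)] s(2) by (simp_all only: funpow_mult) simp_all

lemma order_2: "s ^^ 7 \<in> H" "(s ^^ 7) ^^ 2 = id"
  using funpow[OF s(1)] s(2) by (simp_all only: funpow_mult) simp_all

lemma order_5: "t ^^ 3 \<in> H" "(t ^^ 3) ^^ 5 = id"
  using funpow[OF t(1)] t(2) by (simp_all only: funpow_mult) simp_all

lemma order_3: "t ^^ 5 \<in> H" "(t ^^ 5) ^^ 3 = id"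
  using funpow[OF t(1)] t(2) by (simp_all only: funpow_mult) simp_all

lemma invariant_Nil_card:
  assumes "invariant [] A" "A \<noteq> {}" shows "card A > 2"
proof (rule ccontr)
  assume "\<not> card A > 2"
  have fin: "finite A" by (rule invariant_finite[OF assms(1)])
  have qA: "q ` A = A" using assms(1) q(1) by (intro image_closed_eq fin) (auto simp: invariant_def stab_def)
  have moved: "q (q x) \<noteq> x" if "x \<in> A" for x
    using q(2) that assms(1) by (auto simp: Fix_def invariant_def numeral_2_eq_2)
  obtain x where x: "x \<in> A" using assms(2) by blast
  have ne: "q x \<noteq> x"
  proof
    assume "q x = x"
    then have "q (q x) = x" by simp
    then show False using moved[OF x] by contradiction
  qed
  have mem: "q x \<in> A" "q (q x) \<in> A" using qA x by blast+
  have ne': "q (q x) \<noteq> q x" using ne unfolding inj_eq[OF inj[OF q(1)]] .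
  have "card {x, q x, q (q x)} = 3" using not_sym[OF ne] not_sym[OF ne'] not_sym[OF moved[OF x]] by simp
  moreover have "card {x, q x, q (q x)} \<le> card A" using mem x by (intro card_mono[OF fin]) simp
  ultimately show False using \<open>\<not> card A > 2\<close> by simp
qed

text \<open>
  Modulo 11 and 7, an orbit has 1, 2, 22, 23 or 24 points. On an orbit or a complement of
  an orbit with at most two points the square of \<open>q\<close> would be the identity.
\<close>

theorem transitive_1: "transitive 1"
  unfolding One_nat_def
proof (rule transitive_step[OF transitive_0])
  fix xs A assume A: "tuple 0 xs" "invariant xs A" "A \<noteq> {}"
  have xs: "xs = []" using A(1) by (simp add: tuple_def)
  have "card A mod 11 \<le> 2" using invariant_card_mod[OF transitive_0 A(1,2) p(1) _ p(2)] p(3) by simp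
  moreover have "card A mod 7 \<le> 3" using invariant_card_mod[OF transitive_0 A(1,2) order_7(1) _ order_7(2)] s(4) by simp
  moreover have "card A > 2" using invariant_Nil_card A xs by simp
  moreover have "card A = 24 \<or> card A < 22"
  proof (rule ccontr)
    assume *: "\<not> ?thesis"
    have c: "card (golay_points - set xs - A) = 24 - card A" using card_complement(1)[OF A(1,2)] by simp
    have "card A \<le> 24" using card_complement(2)[OF A(1,2)] by simp
    then have "0 < card (golay_points - set xs - A)" using * unfolding c by linarith
    then have "golay_points - set xs - A \<noteq> {}" by (metis card.empty less_irrefl)
    then have "24 - card A > 2" using invariant_Nil_card[of "golay_points - set xs - A"] invariant_diff[OF A(2)] c xs by simp
    then show False using * by linarith
  qed
  moreover have "card A \<le> 24" using card_complement(2)[OF A(1,2)] by simp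
  ultimately show "card A = 24 - 0" using orbit_sizes(1)[of "card A"] by simp
qed

text \<open>
  Since \<open>s\<close> has a single fixed point, the stabilizer of a point fixes no other point.
\<close>

lemma invariant_singleton_card:
  assumes "tuple 1 xs" "invariant xs A" shows "card A \<noteq> 1"
proof
  assume "card A = 1"
  then obtain y where y: "A = {y}" using card_1_singletonE by blast
  obtain x where xs: "xs = [x]" using assms(1) by (auto simp: tuple_def length_Suc_conv)
  have "1 \<le> card (Fix s)" using s(3) by simp
  from conjugate_into_stab[OF transitive_1 assms(1) this]
  obtain g where g: "g \<in> H" "set xs \<subseteq> Fix (conjugate g s)" .
  have st: "conjugate g s \<in> stab xs" by (rule stabI_Fix[OF conjugate_mem[OF g(1) s(1)] g(2)])
  have "y \<noteq> x" "y \<in> Fix (conjugate g s)" using assms(2) st by (auto simp: y xs invariant_def Fix_def)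
  moreover have "x \<in> Fix (conjugate g s)" using g(2) xs by simp
  moreover have "card (Fix (conjugate g s)) = 1" using s(3) card_image_H[OF g(1)] by (simp add: Fix_conjugate[OF g(1)])
  then obtain z where "Fix (conjugate g s) = {z}" using card_1_singletonE by blast
  ultimately show False by simp
qed

theorem transitive_2: "transitive 2"
  unfolding numeral_2_eq_2 One_nat_def[symmetric]
proof (rule transitive_step[OF transitive_1])
  fix xs A assume A: "tuple 1 xs" "invariant xs A" "A \<noteq> {}"
  have "card A mod 11 \<le> 1" using invariant_card_mod[OF transitive_1 A(1,2) p(1) _ p(2)] p(3) by simp
  moreover have "card A mod 7 \<le> 2" using invariant_card_mod[OF transitive_1 A(1,2) order_7(1) _ order_7(2)] s(4) by simp
  moreover have "card A > 0" using A(3) invariant_finite[OF A(2)] by (simp add: card_gt_0_iff)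
  moreover have "card A \<noteq> 1" by (rule invariant_singleton_card[OF A(1,2)])
  moreover have "card A \<noteq> 22"
    using invariant_singleton_card[OF A(1) invariant_diff[OF A(2)]] card_complement(1)[OF A(1,2)] by simp
  moreover have "card A \<le> 23" using card_complement(2)[OF A(1,2)] by simp
  ultimately show "card A = 24 - 1" using orbit_sizes(2)[of "card A"] by simp
qed

theorem transitive_3: "transitive 3"
  unfolding numeral_3_eq_3 numeral_2_eq_2[symmetric]
proof (rule transitive_step[OF transitive_2])
  fix xs A assume A: "tuple 2 xs" "invariant xs A" "A \<noteq> {}"
  have "card A mod 11 \<le> 0" using invariant_card_mod[OF transitive_2 A(1,2) p(1) _ p(2)] p(3) by simp
  moreover have "card A mod 7 \<le> 1" using invariant_card_mod[OF transitive_2 A(1,2) order_7(1) _ order_7(2)] s(4) by simp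
  moreover have "card A > 0" using A(3) invariant_finite[OF A(2)] by (simp add: card_gt_0_iff)
  moreover have "card A \<le> 22" using card_complement(2)[OF A(1,2)] by simp
  ultimately show "card A = 24 - 2" using orbit_sizes(3)[of "card A"] by simp
qed

text \<open>
  An orbit on the remaining 21 points has a size divisible by 7 and congruent to 0 or 1 modulo 5.
\<close>

theorem transitive_4: "transitive 4"
proof -
  have "transitive (Suc 3)"
  proof (rule transitive_step[OF transitive_3])
    fix xs A assume A: "tuple 3 xs" "invariant xs A" "A \<noteq> {}"
    have "card A mod 7 \<le> 0" using invariant_card_mod[OF transitive_3 A(1,2) order_7(1) _ order_7(2)] s(4) by simp
    moreover have "card A mod 5 \<le> 1" using invariant_card_mod[OF transitive_3 A(1,2) order_5(1) _ order_5(2)] t(4) by simp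
    moreover have "card A > 0" using A(3) invariant_finite[OF A(2)] by (simp add: card_gt_0_iff)
    moreover have "card A \<le> 21" using card_complement(2)[OF A(1,2)] by simp
    ultimately show "card A = 24 - 3" using orbit_sizes(4)[of "card A"] by simp
  qed
  then show ?thesis by (simp add: eval_nat_numeral)
qed

lemma tuple_of_set:
  assumes "A \<subseteq> golay_points" "card A = k"
  obtains xs where "tuple k xs" "set xs = A"
proof -
  have "finite A" using assms(1) finite_points finite_subset by blast
  then obtain xs where "set xs = A" "distinct xs" using finite_distinct_list by blast
  then show thesis using that[of xs] assms distinct_card[of xs] by (auto simp: tuple_def)
qed

text \<open>
  By 4-fold transitivity all sets of four points would be words, and two of them that share three points
  have a sum of weight 2.
\<close>

lemma no_word_of_weight_4: assumes "C \<in> golay_code" shows "card C \<noteq> 4"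
proof
  assume "card C = 4"
  then obtain xs where xs: "tuple 4 xs" "set xs = C" using tuple_of_set[OF golay_code_subset[OF assms]] by blast
  have *: "set ys \<in> golay_code" if "tuple 4 ys" for ys
  proof -
    from transitive_4 xs(1) that obtain g where g: "g \<in> H" "map g xs = ys" unfolding transitive_def by blast
    have "g ` C = set ys" using g(2) xs(2) by auto
    then show ?thesis using M24_code[OF M24[OF g(1)] assms] by simp
  qed
  have "{0, 1, 2, 3} \<in> golay_code" using *[of "[0, 1, 2, 3]"] by (simp add: tuple_def golay_points_def)
  moreover have "{0, 1, 2, 4} \<in> golay_code" using *[of "[0, 1, 2, 4]"] by (simp add: tuple_def golay_points_def)
  ultimately have "sym_diff {0, 1, 2, 3} {0, 1, 2, 4} \<in> golay_code" by (rule golay_code.sum)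
  then have "4 dvd card (sym_diff {0, 1, 2, 3} {0, 1, 2, 4 :: nat})" by (rule golay_code_doubly_even)
  moreover have "sym_diff {0, 1, 2, 3} {0, 1, 2, 4 :: nat} = {3, 4}" by auto
  then have "card (sym_diff {0, 1, 2, 3} {0, 1, 2, 4 :: nat}) = 2" by (simp only:) simp
  ultimately have "4 dvd (2 :: nat)" by (simp only:)
  then show False by simp
qed

text \<open>
  Octads with five common points have a sum of weight at most 6; weights are divisible by 4, and 4 does not
  occur. Together with \<open>octad_exists\<close> this is the Steiner system S(5,8,24).
\<close>

lemma octad_unique:
  assumes "octad C" "octad D" "5 \<le> card (C \<inter> D)" shows "C = D"
proof -
  have w: "sym_diff C D \<in> golay_code" using assms by (simp add: octad_def golay_code.sum)
  have "card (sym_diff C D) \<le> 6"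
    using card_sym_diff[OF octad_finite[OF assms(1)] octad_finite[OF assms(2)]] assms by (simp add: octad_def)
  moreover have "4 dvd card (sym_diff C D)" using w by (rule golay_code_doubly_even)
  moreover have "card (sym_diff C D) \<noteq> 4" using w by (rule no_word_of_weight_4)
  ultimately have "card (sym_diff C D) = 0" by (auto elim!: dvdE)
  then show ?thesis using golay_code_finite[OF w] by auto
qed

lemma octad_unique_subset:
  assumes "octad C" "octad D" "A \<subseteq> C" "A \<subseteq> D" "5 \<le> card A" shows "C = D"
proof (rule octad_unique[OF assms(1,2)])
  have "card A \<le> card (C \<inter> D)" using assms(3,4) octad_finite[OF assms(1)] by (intro card_mono) auto
  then show "5 \<le> card (C \<inter> D)" using assms(5) by simp
qed

text \<open>
  By 4-fold transitivity it suffices to find an octad through 0, 1, 2, 3 and any further point.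
\<close>

lemma octad_exists:
  assumes "A \<subseteq> golay_points" "card A = 5" shows "\<exists>D. octad D \<and> A \<subseteq> D"
proof -
  obtain xs' where xs': "tuple 5 xs'" "set xs' = A" using tuple_of_set[OF assms] .
  then obtain x xs where x: "xs' = x # xs" by (cases xs') (auto simp: tuple_def)
  have xs: "tuple 4 xs" "A = insert x (set xs)" "x \<in> golay_points"
    using xs' by (auto simp: tuple_def x)
  have "tuple 4 [0, 1, 2, 3]" by (simp add: tuple_def golay_points_def)
  then obtain g where g: "g \<in> H" "map g [0, 1, 2, 3] = xs" using transitive_4 xs(1) unfolding transitive_def by blast
  have y: "inv_fun g x \<in> golay_points" using xs(3) point[OF inv_fun[OF g(1)]] by simp
  obtain C where C: "C \<in> golay_code" "card C = 8" "{0, 1, 2, 3, inv_fun g x} \<subseteq> C" using golay_code_sextet[OF y] by blast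
  have "A = g ` {0, 1, 2, 3, inv_fun g x}" using g(2) xs(2) inv_fun_right[OF g(1)] by auto
  then show ?thesis using octad_image[OF M24[OF g(1)], of C] C unfolding octad_def by blast
qed

lemma octad_invariant:
  assumes "g \<in> M24" "octad D" "A \<subseteq> D" "g ` A = A" "5 \<le> card A" shows "g ` D = D"
  using octad_unique_subset[OF octad_image[OF assms(1,2)] assms(2), of A] assms(3-5) by blast

lemma subset_of_card: assumes "k \<le> card A" obtains B where "B \<subseteq> A" "card B = k"
  using obtain_subset_with_card_n[OF assms] by metis

lemma Fix_image: "A \<subseteq> Fix g \<Longrightarrow> g ` A = A"
  by (force simp: Fix_def)

lemma card_Fix_octad:
  assumes "g \<in> M24" "g ` D = D" "finite D" "D \<subseteq> golay_points" "prime r" "g ^^ r = id"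
  shows "[card D = card (D \<inter> Fix g)] (mod r)"
proof -
  have "[card D = card {x \<in> D. g x = x}] (mod r)"
    using assms M24_inj by (intro card_cong_fixed_points) auto
  also have "{x \<in> D. g x = x} = D \<inter> Fix g" using assms(4) by (auto simp: Fix_def)
  finally show ?thesis .
qed

abbreviation "\<tau> \<equiv> s ^^ 7"

lemma octad_Fix_meets:
  assumes "octad D" "A \<subseteq> D" "A \<subseteq> Fix \<tau>" "card A = 5" shows "card (D \<inter> Fix \<tau>) = 6 \<or> D = Fix \<tau>"
proof -
  have inv: "\<tau> ` D = D" using octad_invariant[OF M24[OF order_2(1)] assms(1,2) Fix_image[OF assms(3)]] assms(4) by simp
  have "[card D = card (D \<inter> Fix \<tau>)] (mod 2)"
    by (rule card_Fix_octad[OF M24[OF order_2(1)] inv octad_finite[OF assms(1)] octad_subset[OF assms(1)] _ order_2(2)]) simp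
  then have "even (card (D \<inter> Fix \<tau>))" using assms(1) by (simp add: octad_def cong_def even_iff_mod_2_eq_zero)
  moreover have "5 \<le> card (D \<inter> Fix \<tau>)"
    using card_mono[of "D \<inter> Fix \<tau>" A] assms octad_finite[OF assms(1)] by simp
  moreover have le: "card (D \<inter> Fix \<tau>) \<le> 8"
    using card_mono[OF octad_finite[OF assms(1)], of "D \<inter> Fix \<tau>"] assms(1) by (simp add: octad_def)
  moreover have "D = Fix \<tau>" if "card (D \<inter> Fix \<tau>) = 8"
  proof -
    have "D \<inter> Fix \<tau> = D" using card_subset_eq[OF octad_finite[OF assms(1)], of "D \<inter> Fix \<tau>"] that assms(1) by (simp add: octad_def)
    moreover have "D \<inter> Fix \<tau> = Fix \<tau>" using card_subset_eq[OF finite_Fix, of "D \<inter> Fix \<tau>" \<tau>] that s(5) by simp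
    ultimately show ?thesis by simp
  qed
  moreover have "n = 6 \<or> n = 8" if "even n" "5 \<le> n" "n \<le> 8" for n :: nat using that by (auto elim!: evenE)
  ultimately show ?thesis by blast
qed


text \<open>
  Suppose that the eight fixed points of the involution are not an octad. By parity, an octad through five
  of them contains exactly six. Let \<open>D\<close> be such an octad, with fixed points \<open>a1\<close> to \<open>a6\<close>, and let \<open>f1\<close>,
  \<open>f2\<close> be the other two. The octad through \<open>f1\<close> and four of the \<open>a\<close>'s meets \<open>D\<close> in these four only, so it
  contains \<open>f2\<close> too. Two such octads whose quadruples have three points in common share five points, yet
  are different.
\<close>

theorem octad_Fix_involution: "octad (Fix \<tau>)"
proof (rule ccontr)
  assume no: "\<not> octad (Fix \<tau>)"
  have meets: "card (D \<inter> Fix \<tau>) = 6" if "octad D" "A \<subseteq> D" "A \<subseteq> Fix \<tau>" "card A = 5" for A D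
    using octad_Fix_meets[OF that] that(1) no by blast
  have FP: "Fix \<tau> \<subseteq> golay_points" by (auto simp: Fix_def)
  have ex: "\<exists>D. octad D \<and> A \<subseteq> D" if "A \<subseteq> Fix \<tau>" "card A = 5" for A
    using octad_exists[of A] that FP by blast
  obtain A where A: "A \<subseteq> Fix \<tau>" "card A = 5" using subset_of_card[of 5 "Fix \<tau>"] s(5) by auto
  obtain D where D: "octad D" "A \<subseteq> D" using ex[OF A] by blast
  have "card (D \<inter> Fix \<tau>) = 6" by (rule meets[OF D A])
  then obtain xs where xs: "distinct xs" "set xs = D \<inter> Fix \<tau>" "length xs = 6"
    using finite_distinct_list[of "D \<inter> Fix \<tau>"] finite_Fix distinct_card by (metis finite_Int)
  then obtain a1 a2 a3 a4 a5 a6 where xs6: "xs = [a1, a2, a3, a4, a5, a6]"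
    by (auto simp: length_Suc_conv eval_nat_numeral)
  have "card (Fix \<tau> - D) = 2"
    using card_Diff_subset_Int[of "Fix \<tau>" D] \<open>card (D \<inter> Fix \<tau>) = 6\<close> s(5) finite_Fix by (simp add: Int_commute)
  then obtain f1 f2 where f: "Fix \<tau> - D = {f1, f2}" "f1 \<noteq> f2" by (auto simp: card_2_iff)
  have a: "{a1, a2, a3, a4, a5, a6} \<subseteq> D" "{a1, a2, a3, a4, a5, a6} \<subseteq> Fix \<tau>" and a_eq: "D \<inter> Fix \<tau> = {a1, a2, a3, a4, a5, a6}"
    using xs(2) xs6 by auto
  have ad: "distinct [a1, a2, a3, a4, a5, a6]" using xs(1) xs6 by simp
  have f1: "f1 \<in> Fix \<tau>" "f1 \<notin> D" "f2 \<in> Fix \<tau>" "f2 \<notin> D" using f by auto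
  have key: "\<exists>E. octad E \<and> {b1, b2, b3, b4, f1, f2} \<subseteq> E \<and> E \<inter> (D \<inter> Fix \<tau>) = {b1, b2, b3, b4}"
    if b: "distinct [b1, b2, b3, b4]" "{b1, b2, b3, b4} \<subseteq> D" "{b1, b2, b3, b4} \<subseteq> Fix \<tau>" for b1 b2 b3 b4
  proof -
    have "f1 \<notin> {b1, b2, b3, b4}" using b f1 by auto
    then have "card (insert f1 {b1, b2, b3, b4}) = 5" using b(1) by (subst card_insert_disjoint) auto
    then have c5: "card {b1, b2, b3, b4, f1} = 5" by (simp add: insert_commute)
    have sub: "{b1, b2, b3, b4, f1} \<subseteq> Fix \<tau>" using b f1 by simp
    obtain E where E: "octad E" "{b1, b2, b3, b4, f1} \<subseteq> E" using ex[OF sub c5] by blast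
    have six: "card (E \<inter> Fix \<tau>) = 6" by (rule meets[OF E sub c5])
    have "E \<noteq> D" using E(2) f1 by auto
    then have le: "card (E \<inter> D) \<le> 4" using octad_unique[OF E(1) D(1)] by fastforce
    have "card {b1, b2, b3, b4} = 4" using b(1) by simp
    then have eq: "{b1, b2, b3, b4} = E \<inter> D"
      using le E(2) b(2) octad_finite[OF E(1)] by (intro card_seteq) auto
    have "E \<inter> Fix \<tau> = {b1, b2, b3, b4} \<union> (E \<inter> {f1, f2})"
      unfolding f(1)[symmetric] eq using b(3) eq by blast
    have "f2 \<in> E"
    proof (rule ccontr)
      assume "f2 \<notin> E"
      then have "E \<inter> Fix \<tau> \<subseteq> {b1, b2, b3, b4, f1}" using f(1) eq by blast
      then have "card (E \<inter> Fix \<tau>) \<le> 5" using card_mono[of "{b1, b2, b3, b4, f1}"] c5 by fastforce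
      then show False using six by simp
    qed
    then show ?thesis using E eq b by (intro exI[of _ E]) auto
  qed
  obtain E1 where E1: "octad E1" "{a1, a2, a3, a4, f1, f2} \<subseteq> E1" "E1 \<inter> (D \<inter> Fix \<tau>) = {a1, a2, a3, a4}"
    using key[of a1 a2 a3 a4] ad a by auto
  obtain E2 where E2: "octad E2" "{a1, a2, a3, a5, f1, f2} \<subseteq> E2" "E2 \<inter> (D \<inter> Fix \<tau>) = {a1, a2, a3, a5}"
    using key[of a1 a2 a3 a5] ad a by auto
  have "{f1, f2} \<inter> {a1, a2, a3} = {}" using a(1) f1 by auto
  then have "card ({f1, f2} \<union> {a1, a2, a3}) = 5" using ad f(2) by (subst card_Un_disjoint) auto
  moreover have "{f1, f2} \<union> {a1, a2, a3} = {a1, a2, a3, f1, f2}" by auto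
  ultimately have "card {a1, a2, a3, f1, f2} = 5" by (simp only:)
  then have "E1 = E2" using E1(2) E2(2) by (intro octad_unique_subset[OF E1(1) E2(1), of "{a1, a2, a3, f1, f2}"]) auto
  then have "a5 \<in> {a1, a2, a3, a4}" using E1(3) E2(3) by blast
  then show False using ad by auto
qed

end

context M24_generators
begin

lemma tupleD: "tuple k xs \<Longrightarrow> card (set xs) = k" "tuple k xs \<Longrightarrow> set xs \<subseteq> golay_points"
  by (auto simp: tuple_def distinct_card)

lemma conjugate_in_stab:
  assumes "transitive k" "tuple k xs" "u \<in> H" "k \<le> card (Fix u)" "u ^^ r = id"
  obtains v where "v \<in> stab xs" "v ^^ r = id" "card (Fix v) = card (Fix u)" "set xs \<subseteq> Fix v"
proof -
  obtain g where g: "g \<in> H" "set xs \<subseteq> Fix (conjugate g u)" using conjugate_into_stab[OF assms(1,2,4)] .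
  show thesis
  proof (rule that)
    show "conjugate g u \<in> stab xs" by (rule stabI_Fix[OF conjugate_mem[OF g(1) assms(3)] g(2)])
    show "conjugate g u ^^ r = id" unfolding conjugate_funpow[OF g(1)] assms(5) by (rule conjugate_id[OF g(1)])
    show "card (Fix (conjugate g u)) = card (Fix u)" by (simp add: Fix_conjugate[OF g(1)] card_image_H[OF g(1)])
  qed (rule g(2))
qed

lemma invariant_image: assumes "invariant xs A" "v \<in> stab xs" shows "v ` A = A"
  using assms by (intro image_closed_eq stabD(1) invariant_finite) (auto simp: invariant_def)

text \<open>
  An element of order 5 in the stabilizer of four points permutes cyclically the five tetrads that complete
  these points to an octad, and the orbits meet all tetrads equally.
\<close>

lemma sextet_orbit_count:
  assumes xs: "tuple 4 xs" and A: "invariant xs A" and D: "octad D" "set xs \<subseteq> D"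
  shows "card A = 5 * card (A \<inter> D)"
proof -
  let ?S = "set xs"
  obtain v where v: "v \<in> stab xs" "v ^^ 5 = id" "card (Fix v) = card (Fix (t ^^ 3))" "?S \<subseteq> Fix v"
    using conjugate_in_stab[OF transitive_4 xs order_5(1) _ order_5(2)] t(4) by auto
  have vH: "v \<in> H" by (rule stabD(1)[OF v(1)])
  have "?S = Fix v" by (rule card_subset_eq[OF finite_Fix v(4)]) (simp add: v(3) t(4) tupleD(1)[OF xs])
  then have FixS: "v x = x \<Longrightarrow> x \<in> golay_points \<Longrightarrow> x \<in> ?S" for x by (simp add: Fix_def)
  have vn: "v ^^ n \<in> H" for n by (rule funpow[OF vH])
  have vnS: "(v ^^ n) ` ?S = ?S" for n
    using stabD(2)[OF v(1)] by (simp add: funpow_fixed)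
  have vnD: "octad ((v ^^ n) ` D)" for n by (rule octad_image[OF M24[OF vn] D(1)])
  have vnA: "(v ^^ n) ` A = A" for n
  proof (induction n)
    case (Suc n)
    have "(v ^^ Suc n) ` A = v ` ((v ^^ n) ` A)" by (simp add: image_comp)
    then show ?case using Suc invariant_image[OF A v(1)] by simp
  qed simp
  define T where "T = D - ?S"
  have card_T: "card T = 4"
    using D tupleD(1)[OF xs] octad_finite[OF D(1)] by (simp add: T_def card_Diff_subset octad_def)
  have fin_T: "finite T" using octad_finite[OF D(1)] by (simp add: T_def)
  have vnT: "(v ^^ n) ` T = (v ^^ n) ` D - ?S" for n
    unfolding T_def image_set_diff[OF inj[OF vn]] vnS ..
  have no_fixed: "(v ^^ n) ` D \<noteq> D" if n: "0 < n" "n < 5" for n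
  proof
    assume eq: "(v ^^ n) ` D = D"
    have "(v ^^ n) ^^ 5 = id"
      using v(2) by (metis funpow_mult id_funpow mult.commute)
    have five: "prime (5 :: nat)" by simp
    have "[card D = card (D \<inter> Fix (v ^^ n))] (mod 5)"
      by (rule card_Fix_octad[OF M24[OF vn] eq octad_finite[OF D(1)] octad_subset[OF D(1)] five]) fact
    moreover have "D \<inter> Fix (v ^^ n) = ?S"
    proof
      have "coprime n 5" using five n by (metis coprime_commute nat_dvd_not_less prime_imp_coprime)
      then have "x \<in> ?S" if "x \<in> golay_points" "(v ^^ n) x = x" for x
        using funpow_fixed_coprime[of n v x 5] v(2) that n FixS by simp
      then show "D \<inter> Fix (v ^^ n) \<subseteq> ?S" by (auto simp: Fix_def)
      show "?S \<subseteq> D \<inter> Fix (v ^^ n)"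
        using D(2) tupleD(2)[OF xs] stabD(2)[OF v(1)] by (auto simp: Fix_def funpow_fixed)
    qed
    ultimately show False using D(1) tupleD(1)[OF xs] by (simp add: octad_def cong_def)
  qed
  have disj: "(v ^^ i) ` T \<inter> (v ^^ j) ` T = {}" if ij: "i < j" "j < 5" for i j
  proof (rule ccontr)
    assume "\<not> ?thesis"
    then obtain z where z: "z \<in> (v ^^ i) ` D" "z \<in> (v ^^ j) ` D" "z \<notin> ?S" by (auto simp: vnT)
    have sub: "insert z ?S \<subseteq> (v ^^ i) ` D" "insert z ?S \<subseteq> (v ^^ j) ` D" using z D(2) vnS by blast+
    have "card (insert z ?S) = 5" using z(3) tupleD(1)[OF xs] by simp
    then have "(v ^^ i) ` D = (v ^^ j) ` D" by (intro octad_unique_subset[OF vnD vnD sub]) simp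
    moreover have "v ^^ j = v ^^ (i + (j - i))" using ij by simp
    then have "(v ^^ j) ` D = (v ^^ i) ` ((v ^^ (j - i)) ` D)" by (simp only: funpow_add image_comp)
    ultimately have "(v ^^ i) ` D = (v ^^ i) ` ((v ^^ (j - i)) ` D)" by simp
    then have "D = (v ^^ (j - i)) ` D" unfolding inj_image_eq_iff[OF inj[OF vn]] .
    moreover have "0 < j - i" "j - i < 5" using ij by linarith+
    ultimately show False using no_fixed[of "j - i"] by simp
  qed
  have disj': "\<forall>i\<in>{..<5}. \<forall>j\<in>{..<5}. i \<noteq> j \<longrightarrow> (v ^^ i) ` T \<inter> (v ^^ j) ` T = {}"
    using disj by (metis Int_commute lessThan_iff linorder_neqE_nat)
  define U where "U = (\<Union>i<5. (v ^^ i) ` T)"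
  have "card U = (\<Sum>i<5. card ((v ^^ i) ` T))"
    unfolding U_def using disj' fin_T by (intro card_UN_disjoint) auto
  then have "card U = 20" by (simp add: card_image_H[OF vn] card_T)
  moreover have "U \<subseteq> golay_points - ?S"
    unfolding U_def using vnT octad_subset[OF vnD] by blast
  moreover have "card (golay_points - ?S) = 20"
    using card_Diff_subset[of ?S golay_points] tupleD[OF xs] card_points by simp
  ultimately have U: "U = golay_points - ?S" by (intro card_subset_eq) (simp_all add: finite_points)
  have A_sub: "A \<subseteq> golay_points - ?S" using A by (simp add: invariant_def)
  then have "A = (\<Union>i<5. A \<inter> (v ^^ i) ` T)" unfolding U[symmetric] U_def by blast
  then have "card A = card (\<Union>i<5. A \<inter> (v ^^ i) ` T)" by simp
  also have "\<dots> = (\<Sum>i<5. card (A \<inter> (v ^^ i) ` T))"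
    using disj' invariant_finite[OF A] by (intro card_UN_disjoint) auto
  also have "\<dots> = (\<Sum>i<(5::nat). card (A \<inter> T))"
  proof (rule sum.cong[OF refl])
    fix i :: nat
    have "A \<inter> (v ^^ i) ` T = (v ^^ i) ` (A \<inter> T)" unfolding image_Int[OF inj[OF vn]] vnA ..
    then show "card (A \<inter> (v ^^ i) ` T) = card (A \<inter> T)" by (simp add: card_image_H[OF vn])
  qed
  also have "A \<inter> T = A \<inter> D" using A_sub by (auto simp: T_def)
  finally show ?thesis by simp
qed

lemma card_octad_invariant:
  assumes "tuple 4 xs" "invariant xs A" "octad D" "set xs \<subseteq> D" shows "card (A \<inter> D) \<le> 4"
proof -
  have "card (A \<inter> D) \<le> card (D - set xs)"
    using assms octad_finite by (intro card_mono) (auto simp: invariant_def)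
  also have "\<dots> = 4" using assms tupleD(1)[OF assms(1)] octad_finite by (simp add: card_Diff_subset octad_def)
  finally show ?thesis .
qed

lemma stab_octad_card_cong:
  assumes "invariant xs A" "v \<in> stab xs" "v ` D = D" "prime r" "v ^^ r = id"
  shows "[card (A \<inter> D) = card (A \<inter> D \<inter> Fix v)] (mod r)"
proof -
  have vH: "v \<in> H" by (rule stabD(1)[OF assms(2)])
  have "v ` (A \<inter> D) = A \<inter> D" using image_Int[OF inj[OF vH]] invariant_image[OF assms(1,2)] assms(3) by simp
  then have "[card (A \<inter> D) = card {x \<in> A \<inter> D. v x = x}] (mod r)"
    using invariant_finite[OF assms(1)] assms(4,5) inj[OF vH] by (intro card_cong_fixed_points) auto
  also have "{x \<in> A \<inter> D. v x = x} = A \<inter> D \<inter> Fix v" using assms(1) by (auto simp: Fix_def invariant_def)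
  finally show ?thesis .
qed

lemma order_3_octad:
  assumes "octad D" "v \<in> M24" "v ` D = D" "v ^^ 3 = id" "card (Fix v) = 6" "5 \<le> card (D \<inter> Fix v)"
  shows "card (D \<inter> Fix v) = 5"
proof -
  have "[card D = card (D \<inter> Fix v)] (mod 3)"
    by (rule card_Fix_octad[OF assms(2,3) octad_finite[OF assms(1)] octad_subset[OF assms(1)] _ assms(4)]) simp
  then have "card (D \<inter> Fix v) \<noteq> 6" using assms(1) by (auto simp: octad_def cong_def)
  moreover have "card (D \<inter> Fix v) \<le> 6" using card_mono[OF finite_Fix[of v], of "D \<inter> Fix v"] assms(5) by simp
  ultimately show ?thesis using assms(6) by simp
qed

text \<open>
  Some element of order 3 in the stabilizer fixes exactly one point of a tetrad. On the tetrad it has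
  a fixed point and a 3-cycle, so an invariant set meets the tetrad in 0, 1, 3 or 4 points.
\<close>

lemma sextet_orbit_mod_3:
  assumes xs: "tuple 4 xs" and A: "invariant xs A"
  shows "\<exists>D. octad D \<and> set xs \<subseteq> D \<and> card (A \<inter> D) \<noteq> 2"
proof -
  obtain v where v: "v \<in> stab xs" "v ^^ 3 = id" "card (Fix v) = card (Fix (t ^^ 5))" "set xs \<subseteq> Fix v"
    using conjugate_in_stab[OF transitive_4 xs order_3(1) _ order_3(2)] t(5) by auto
  have vM: "v \<in> M24" by (rule M24[OF stabD(1)[OF v(1)]])
  have "card (Fix v) = 6" using v(3) t(5) by simp
  then have "\<not> Fix v \<subseteq> set xs" using card_mono[of "set xs" "Fix v"] tupleD(1)[OF xs] by auto
  then obtain y where y: "y \<in> Fix v" "y \<notin> set xs" by blast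
  have y': "insert y (set xs) \<subseteq> Fix v" "card (insert y (set xs)) = 5" using y v(4) tupleD(1)[OF xs] by auto
  have "insert y (set xs) \<subseteq> golay_points" using y'(1) by (auto simp: Fix_def)
  from octad_exists[OF this y'(2)] obtain D where D: "octad D" "insert y (set xs) \<subseteq> D" by blast
  have vD: "v ` D = D" by (rule octad_invariant[OF vM D(1,2) Fix_image[OF y'(1)]]) (simp add: y'(2))
  have "5 \<le> card (D \<inter> Fix v)"
    using card_mono[of "D \<inter> Fix v" "insert y (set xs)"] y' D finite_Fix by simp
  then have "card (D \<inter> Fix v) = 5" by (rule order_3_octad[OF D(1) vM vD v(2) \<open>card (Fix v) = 6\<close>])
  then have "insert y (set xs) = D \<inter> Fix v" using y' D finite_Fix by (intro card_subset_eq) auto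
  then have "A \<inter> D \<inter> Fix v \<subseteq> {y}" using A by (auto simp: invariant_def)
  then have "card (A \<inter> D \<inter> Fix v) \<le> 1" using card_mono[of "{y}" "A \<inter> D \<inter> Fix v"] by simp
  moreover have "[card (A \<inter> D) = card (A \<inter> D \<inter> Fix v)] (mod 3)"
    by (rule stab_octad_card_cong[OF A v(1) vD _ v(2)]) simp
  ultimately have "card (A \<inter> D) \<noteq> 2" by (auto simp: cong_def)
  then show ?thesis using D by blast
qed

text \<open>
  An octad through three fixed points of the involution, a moved point and its image contains exactly
  four fixed points. The involution is in their stabilizer and moves every point of the remaining tetrad. By
  4-fold transitivity the four points can be chosen at will.
\<close>

lemma sextet_orbit_mod_2:
  assumes xs: "tuple 4 xs" and A: "invariant xs A"
  shows "\<exists>D. octad D \<and> set xs \<subseteq> D \<and> even (card (A \<inter> D))"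
proof -
  have \<tau>M: "\<tau> \<in> M24" by (rule M24[OF order_2(1)])
  have \<tau>\<tau>: "\<tau> (\<tau> x) = x" for x
    using fun_cong[OF order_2(2), of x] by (simp only: numeral_2_eq_2 funpow.simps comp_apply id_apply)
  obtain K0 where K0: "K0 \<subseteq> Fix \<tau>" "card K0 = 3" using subset_of_card[of 3 "Fix \<tau>"] s(5) by auto
  have "\<not> golay_points \<subseteq> Fix \<tau>" using card_mono[OF finite_Fix, of golay_points \<tau>] s(5) card_points by auto
  then obtain y where y: "y \<in> golay_points" "\<tau> y \<noteq> y" by (auto simp: Fix_def)
  have y': "\<tau> y \<in> golay_points" using y(1) M24_point[OF \<tau>M] by simp
  (* An octad through these five points is invariant under the involution. *)
  define K where "K = {y, \<tau> y} \<union> K0"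
  have "{y, \<tau> y} \<inter> K0 = {}" using K0(1) y \<tau>\<tau>[of y] by (auto simp: Fix_def)
  then have card_K: "card K = 5"
    unfolding K_def using K0 y(2) finite_subset[OF K0(1) finite_Fix] by (subst card_Un_disjoint) auto
  have "K \<subseteq> golay_points" using K0(1) y(1) y' by (auto simp: K_def Fix_def)
  from octad_exists[OF this card_K] obtain D where D: "octad D" "K \<subseteq> D" by blast
  have "\<tau> ` K = K" unfolding K_def image_Un Fix_image[OF K0(1)] using \<tau>\<tau> by auto
  then have \<tau>D: "\<tau> ` D = D" by (intro octad_invariant[OF \<tau>M D]) (simp_all add: card_K)
  have "D \<noteq> Fix \<tau>" using D(2) y(2) by (auto simp: K_def Fix_def)
  then have "card (D \<inter> Fix \<tau>) \<le> 4" using octad_unique[OF D(1) octad_Fix_involution] by fastforce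
  moreover have "3 \<le> card (D \<inter> Fix \<tau>)"
    using card_mono[of "D \<inter> Fix \<tau>" K0] K0 D(2) finite_Fix by (auto simp: K_def)
  moreover have "[card D = card (D \<inter> Fix \<tau>)] (mod 2)"
    by (rule card_Fix_octad[OF \<tau>M \<tau>D octad_finite[OF D(1)] octad_subset[OF D(1)] _ order_2(2)]) simp
  then have "even (card (D \<inter> Fix \<tau>))" using D(1) by (simp add: octad_def cong_def even_iff_mod_2_eq_zero)
  moreover have "n = 4" if "n \<le> 4" "3 \<le> n" "even n" for n :: nat using that by (auto elim!: evenE)
  ultimately have "card (D \<inter> Fix \<tau>) = 4" by blast
  moreover have "D \<inter> Fix \<tau> \<subseteq> golay_points" by (auto simp: Fix_def)
  ultimately obtain bs where bs: "tuple 4 bs" "set bs = D \<inter> Fix \<tau>" using tuple_of_set by blast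
  obtain g where g: "g \<in> H" "map g bs = xs" using transitive_4 bs(1) xs unfolding transitive_def by blast
  define v where "v = conjugate g \<tau>"
  have "set xs = g ` set bs" using g(2) by auto
  then have S: "set xs = g ` D \<inter> Fix v"
    unfolding v_def Fix_conjugate[OF g(1)] bs(2) image_Int[OF inj[OF g(1)]] .
  have v: "v \<in> stab xs" unfolding v_def
    by (rule stabI_Fix[OF conjugate_mem[OF g(1) order_2(1)]]) (use S in \<open>simp add: v_def\<close>)
  have v2: "v ^^ 2 = id" unfolding v_def conjugate_funpow[OF g(1)] order_2(2) by (rule conjugate_id[OF g(1)])
  have "v ` (g ` D) = g ` (\<tau> ` D)" unfolding v_def image_image by (simp add: conjugate_apply[OF g(1)])
  then have vD: "v ` (g ` D) = g ` D" by (simp add: \<tau>D)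
  have "[card (A \<inter> g ` D) = card (A \<inter> g ` D \<inter> Fix v)] (mod 2)"
    by (rule stab_octad_card_cong[OF A v vD _ v2]) simp
  moreover have "A \<inter> g ` D \<inter> Fix v = {}" using A S by (auto simp: invariant_def)
  ultimately have "even (card (A \<inter> g ` D))" by (simp add: cong_def even_iff_mod_2_eq_zero)
  then show ?thesis using octad_image[OF M24[OF g(1)] D(1)] S by blast
qed

text \<open>
  The common size of the intersections of an orbit with the five tetrads is even, positive, at most 4 and
  not 2. Hence it is 4.
\<close>

theorem transitive_5: "transitive 5"
proof -
  have "transitive (Suc 4)"
  proof (rule transitive_step[OF transitive_4])
    fix xs A assume A: "tuple 4 xs" "invariant xs A" "A \<noteq> {}"
    obtain D where D: "octad D" "set xs \<subseteq> D" "card (A \<inter> D) \<noteq> 2" using sextet_orbit_mod_3[OF A(1,2)] by blast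
    obtain E where E: "octad E" "set xs \<subseteq> E" "even (card (A \<inter> E))" using sextet_orbit_mod_2[OF A(1,2)] by blast
    have "card A = 5 * card (A \<inter> D)" "card A = 5 * card (A \<inter> E)"
      using sextet_orbit_count[OF A(1,2)] D E by blast+
    moreover have "card A > 0" using A(3) invariant_finite[OF A(2)] by (simp add: card_gt_0_iff)
    moreover have "card (A \<inter> D) \<le> 4" by (rule card_octad_invariant[OF A(1,2) D(1,2)])
    moreover have "n = 4" if "n > 0" "n \<le> 4" "n \<noteq> 2" "even n" for n :: nat using that by (auto elim!: evenE)
    ultimately show "card A = 24 - 4" using D(3) E(3) by fastforce
  qed
  then show ?thesis by (simp add: eval_nat_numeral)
qed


theorem octad_transitive:
  assumes "octad D" "octad E" obtains g where "g \<in> H" "g ` D = E"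
proof -
  obtain A where A: "A \<subseteq> D" "card A = 5" using subset_of_card[of 5 D] assms(1) by (auto simp: octad_def)
  obtain B where B: "B \<subseteq> E" "card B = 5" using subset_of_card[of 5 E] assms(2) by (auto simp: octad_def)
  obtain xs where xs: "tuple 5 xs" "set xs = A" using tuple_of_set[of A 5] A octad_subset[OF assms(1)] by auto
  obtain ys where ys: "tuple 5 ys" "set ys = B" using tuple_of_set[of B 5] B octad_subset[OF assms(2)] by auto
  obtain g where g: "g \<in> H" "map g xs = ys" using transitive_5 xs(1) ys(1) unfolding transitive_def by blast
  have "B = g ` A" using g(2) xs(2) ys(2) by auto
  then have "B \<subseteq> g ` D" using A(1) by blast
  then have "g ` D = E"
    by (rule octad_unique_subset[OF octad_image[OF M24[OF g(1)] assms(1)] assms(2) _ B(1)]) (simp add: B(2))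
  then show thesis using that g(1) by blast
qed

text \<open>
  Let \<open>x\<close> be the fixed point of \<open>t\<close>, and let \<open>D\<close> be the octad through the five other fixed points of
  \<open>t ^^ 5\<close>. Then \<open>D\<close> is the union of the cycles of length 3 and 5, and outside \<open>D\<close> there are only \<open>x\<close> and
  the cycle of length 15. A conjugate of the involution fixes exactly the points of \<open>D\<close> and moves \<open>x\<close> into
  this cycle. Conjugating it by the powers of \<open>t\<close>, one moves \<open>x\<close> to any point of the cycle.
\<close>

lemma outside_octad_transitive_one:
  "\<exists>D x. octad D \<and> x \<in> golay_points - D \<and> (\<forall>y\<in>golay_points - D. \<exists>v\<in>H. (\<forall>d\<in>D. v d = d) \<and> v x = y)"
proof -
  obtain x where x: "Fix t = {x}" using t(3) card_1_singletonE by blast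
  have xP: "x \<in> golay_points" "t x = x" using x by (auto simp: Fix_def)
  have tM: "t \<in> M24" by (rule M24[OF t(1)])
  have tn: "t ^^ n \<in> H" for n by (rule funpow[OF t(1)])
  define B where "B = Fix (t ^^ 5) - {x}"
  have x_fix: "x \<in> Fix (t ^^ n)" for n using xP by (simp add: Fix_def funpow_fixed)
  have card_B: "card B = 5" using t(5) x_fix finite_Fix by (simp add: B_def)
  have B_sub: "B \<subseteq> golay_points" by (auto simp: B_def Fix_def)
  obtain D where D: "octad D" "B \<subseteq> D" using octad_exists[OF B_sub card_B] by blast
  have "t ` Fix (t ^^ 5) \<subseteq> Fix (t ^^ 5)"
    using M24_point[OF tM] by (auto simp: Fix_def funpow_swap1[symmetric])
  then have "t ` Fix (t ^^ 5) = Fix (t ^^ 5)" by (rule image_closed_eq[OF t(1) finite_Fix])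
  then have "t ` B = B" unfolding B_def image_set_diff[OF inj[OF t(1)]] using xP by simp
  then have tD: "t ` D = D" by (intro octad_invariant[OF tM D]) (simp_all add: card_B)
  have tnD: "(t ^^ n) ` D = D" for n
  proof (induction n)
    case (Suc n)
    have "(t ^^ Suc n) ` D = t ` ((t ^^ n) ` D)" by (simp add: image_comp)
    then show ?case using Suc tD by simp
  qed simp
  have "5 \<le> card (D \<inter> Fix (t ^^ 5))"
    using card_mono[of "D \<inter> Fix (t ^^ 5)" B] D card_B finite_Fix by (auto simp: B_def)
  then have "card (D \<inter> Fix (t ^^ 5)) = 5"
    by (rule order_3_octad[OF D(1) M24[OF tn] tnD order_3(2) t(5)])
  then have B_eq: "B = D \<inter> Fix (t ^^ 5)" using D(2) card_B finite_Fix by (intro card_subset_eq) (auto simp: B_def)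
  then have xD: "x \<notin> D" using x_fix by (auto simp: B_def)
  have "[card D = card (D \<inter> Fix (t ^^ 3))] (mod 5)"
    by (rule card_Fix_octad[OF M24[OF tn] tnD octad_finite[OF D(1)] octad_subset[OF D(1)] _ order_5(2)]) simp
  moreover have sub3: "D \<inter> Fix (t ^^ 3) \<subseteq> Fix (t ^^ 3) - {x}" using xD by blast
  have card3: "card (Fix (t ^^ 3) - {x}) = 3" using t(4) x_fix finite_Fix by simp
  have "card (D \<inter> Fix (t ^^ 3)) \<le> 3" using card_mono[OF _ sub3] card3 finite_Fix by simp
  ultimately have "card (D \<inter> Fix (t ^^ 3)) = 3" using D(1) by (simp add: octad_def cong_def)
  then have eq3: "D \<inter> Fix (t ^^ 3) = Fix (t ^^ 3) - {x}"
    using sub3 card3 finite_Fix by (intro card_subset_eq) auto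
  define R where "R = golay_points - D - {x}"
  have card_R: "card R = 15"
    using xD xP octad_subset[OF D(1)] octad_finite[OF D(1)] D(1) card_points finite_points
    by (simp add: R_def octad_def card_Diff_subset)
  have R_moved: "(t ^^ 3) z \<noteq> z" "(t ^^ 5) z \<noteq> z" if "z \<in> R" for z
    using that eq3 B_eq by (auto simp: R_def B_def Fix_def)
  have tR: "t ` R \<subseteq> R"
  proof safe
    fix z assume z: "z \<in> R"
    have "t z \<notin> t ` D" using z unfolding inj_image_mem_iff[OF inj[OF t(1)]] by (simp add: R_def)
    moreover have "t z \<noteq> t x" using z unfolding inj_eq[OF inj[OF t(1)]] by (simp add: R_def)
    ultimately show "t z \<in> R" using z M24_point[OF tM] by (simp add: R_def tD xP)
  qed
  have orbit: "(\<lambda>i. (t ^^ i) z) ` {..<15} = R" if z: "z \<in> R" for z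
  proof (rule card_subset_eq)
    have 15: "(t ^^ 15) z = z" by (simp add: t(2))
    have "(t ^^ d) z \<noteq> z" if d: "0 < d" "d < 15" for d
    proof
      assume fixed: "(t ^^ d) z = z"
      have fixed_mult: "(t ^^ (d * n)) z = z" for n by (rule funpow_fixed_mult[OF fixed])
      show False
      proof (cases "3 dvd d")
        case True
        then obtain e where e: "d = 3 * e" by (elim dvdE)
        then have e': "0 < e" "e < 5" using d by auto
        have five: "prime (5 :: nat)" by simp
        have "coprime e 5" using five e' by (metis coprime_commute nat_dvd_not_less prime_imp_coprime)
        moreover have "((t ^^ 3) ^^ e) z = z" "((t ^^ 3) ^^ 5) z = z" using fixed e 15 by (simp_all only: funpow_mult) simp_all
        ultimately have "(t ^^ 3) z = z" using funpow_fixed_coprime[of e "t ^^ 3" z 5] e' by blast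
        then show False using R_moved(1)[OF z] by contradiction
      next
        case False
        have three: "prime (3 :: nat)" by simp
        have "coprime d 3" using three False by (metis coprime_commute prime_imp_coprime)
        moreover have "((t ^^ 5) ^^ d) z = z" using fixed_mult[of 5] by (simp only: funpow_mult mult.commute)
        moreover have "((t ^^ 5) ^^ 3) z = z" using 15 by (simp only: funpow_mult) simp
        ultimately have "(t ^^ 5) z = z" using funpow_fixed_coprime[of d "t ^^ 5" z 3] d by blast
        then show False using R_moved(2)[OF z] by contradiction
      qed
    qed
    then have "inj_on (\<lambda>i. (t ^^ i) z) {..<15}" by (rule funpow_distinct[OF inj[OF t(1)] 15])
    then show "card ((\<lambda>i. (t ^^ i) z) ` {..<15}) = card R" using card_R by (simp add: card_image)
    show "finite R" by (simp add: R_def finite_points)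
    show "(\<lambda>i. (t ^^ i) z) ` {..<15} \<subseteq> R" using funpow_closed[OF tR z] by blast
  qed
  obtain g where g: "g \<in> H" "g ` Fix \<tau> = D" using octad_transitive[OF octad_Fix_involution D(1)] .
  define v where "v = conjugate g \<tau>"
  have v: "v \<in> H" unfolding v_def by (rule conjugate_mem[OF g(1) order_2(1)])
  have Fix_v: "Fix v = D" unfolding v_def Fix_conjugate[OF g(1)] by (rule g(2))
  have "v x \<noteq> x" using Fix_v xD xP by (auto simp: Fix_def)
  moreover have "v x \<notin> D"
  proof
    assume "v x \<in> D"
    then have "v (v x) = v x" using Fix_v by (auto simp: Fix_def)
    then show False using \<open>v x \<noteq> x\<close> unfolding inj_eq[OF inj[OF v]] by contradiction
  qed
  ultimately have vx: "v x \<in> R" using point[OF v] xP by (simp add: R_def)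
  have "\<exists>w\<in>H. (\<forall>d\<in>D. w d = d) \<and> w x = y" if y: "y \<in> golay_points - D" for y
  proof (cases "y = x")
    case True
    then show ?thesis using one by (intro bexI[of _ id]) auto
  next
    case False
    then have "y \<in> R" using y by (simp add: R_def)
    then obtain i where i: "y = (t ^^ i) (v x)" using orbit[OF vx] by blast
    have "conjugate (t ^^ i) v \<in> H" by (rule conjugate_mem[OF tn v])
    moreover have "Fix (conjugate (t ^^ i) v) = D" by (simp add: Fix_conjugate[OF tn] Fix_v tnD)
    then have "\<forall>d\<in>D. conjugate (t ^^ i) v d = d" by (auto simp: Fix_def)
    moreover have "conjugate (t ^^ i) v x = y"
      using conjugate_apply[OF tn, of i v x] xP by (simp add: i funpow_fixed)
    ultimately show ?thesis by blast
  qed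
  then show ?thesis using D(1) xD xP by blast
qed

theorem outside_octad_transitive:
  assumes "octad D" "x \<in> golay_points - D" "y \<in> golay_points - D"
  shows "\<exists>v\<in>H. (\<forall>d\<in>D. v d = d) \<and> v x = y"
proof -
  obtain E z where E: "octad E" "z \<in> golay_points - E" and
    tr: "\<And>y. y \<in> golay_points - E \<Longrightarrow> \<exists>v\<in>H. (\<forall>d\<in>E. v d = d) \<and> v z = y"
    using outside_octad_transitive_one by blast
  obtain g where g: "g \<in> H" "g ` E = D" using octad_transitive[OF E(1) assms(1)] .
  have pull: "inv_fun g w \<in> golay_points - E" if "w \<in> golay_points - D" for w
    using that point[OF inv_fun[OF g(1)]] inv_fun_right[OF g(1)] g(2) by (metis DiffD1 DiffD2 DiffI imageI)
  obtain a where a: "a \<in> H" "\<forall>d\<in>E. a d = d" "a z = inv_fun g x" using tr[OF pull[OF assms(2)]] by blast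
  obtain b where b: "b \<in> H" "\<forall>d\<in>E. b d = d" "b z = inv_fun g y" using tr[OF pull[OF assms(3)]] by blast
  define w where "w = b \<circ> inv_fun a"
  have w: "w \<in> H" unfolding w_def by (intro comp b(1) inv_fun a(1))
  have wE: "w d = d" if "d \<in> E" for d
    using that a(2) b(2) inv_fun_eq_iff[OF a(1), of d d] by (simp add: w_def)
  have "w (inv_fun g x) = inv_fun g y"
    using inv_fun_eq_iff[OF a(1), of "inv_fun g x" z] a(3) b(3) by (simp add: w_def)
  then have "conjugate g w x = y" by (simp add: conjugate_def inv_fun_right[OF g(1)])
  moreover have "conjugate g w d = d" if "d \<in> D" for d
  proof -
    from that obtain e where "e \<in> E" "d = g e" using g(2) by blast
    then show ?thesis using wE by (simp add: conjugate_apply[OF g(1)])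
  qed
  ultimately show ?thesis using conjugate_mem[OF g(1) w] by blast
qed


lemma certified_octad_word: "m \<in> set (map snd (leading_words @ sextet_words @ separating_words)) \<Longrightarrow> octad (wset m)"
  using certified_octad certified_words by (fastforce simp: octad_def)

text \<open>
  All points except 10 and 12 are determined by the seven given points and the nine separating octads, and
  M24 contains no transposition.
\<close>

lemma pointwise_stabilizer_trivial:
  assumes \<pi>: "\<pi> \<in> M24" and fixed: "\<And>x. x \<in> {0, 1, 2, 3, 4, 5, 7} \<Longrightarrow> \<pi> x = x"
  shows "\<pi> = id"
proof -
  let ?ms = "map snd separating_words" and ?base = "{0, 1, 2, 3, 4, 5, 7 :: nat}"
  have inv: "\<pi> ` wset m = wset m" if m: "m \<in> set ?ms" for m
  proof -
    define B where "B = set (filter (bit m) [0, 1, 2, 3, 4, 5, 7])"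
    have "card B = length (filter (bit m) [0, 1, 2, 3, 4, 5, 7])"
      unfolding B_def by (intro distinct_card distinct_filter) simp
    then have "5 \<le> card B" using bspec[OF separating_base m] by (simp only:)
    moreover have "octad (wset m)" by (rule certified_octad_word) (use m in simp)
    moreover have "B \<subseteq> wset m" unfolding B_def wset_def by auto
    moreover have "B \<subseteq> ?base" unfolding B_def set_filter by auto
    then have "\<pi> x = x" if "x \<in> B" for x using that by (intro fixed) blast
    then have "\<pi> ` B = B" by simp
    ultimately show ?thesis using octad_invariant[OF \<pi>, of "wset m" B] by blast
  qed
  have sig: "signature ?ms (\<pi> j) = signature ?ms j" for j
  proof (rule signature_cong)
    fix m assume "m \<in> set ?ms"
    then have "\<pi> j \<in> wset m \<longleftrightarrow> j \<in> wset m" using inv inj_image_mem_iff[OF M24_inj[OF \<pi>]] by metis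
    then show "bit m (\<pi> j) \<longleftrightarrow> bit m j" by (simp add: wset_def)
  qed
  have points: "golay_points = ?base \<union> {12} \<union> set movable_points"
    unfolding golay_points_def atLeastLessThan_upt points_list movable_points_def by auto
  have "distinct (map (signature ?ms) movable_points)" unfolding separating_signatures by simp
  then have inj: "inj_on (signature ?ms) (set movable_points)" by (simp add: distinct_map)
  have sig10: "10 \<in> set movable_points" "signature ?ms 10 = signature ?ms 12"
    using separating_signatures unfolding movable_points_def by simp_all
  have "\<pi> j = j" if j: "j \<in> golay_points" "j \<noteq> 10" "j \<noteq> 12" for j
  proof (cases "j \<in> ?base")
    case False
    then have j': "j \<in> set movable_points" using j points by auto
    have "\<pi> j \<notin> ?base"
    proof
      assume "\<pi> j \<in> ?base"
      then have "\<pi> (\<pi> j) = \<pi> j" by (rule fixed)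
      then have "\<pi> j = j" unfolding inj_eq[OF M24_inj[OF \<pi>]] .
      then show False using \<open>\<pi> j \<in> ?base\<close> False by simp
    qed
    moreover have "\<pi> j \<in> golay_points" using j(1) M24_point[OF \<pi>] by blast
    ultimately consider "\<pi> j \<in> set movable_points" | "\<pi> j = 12" unfolding points by blast
    then show ?thesis
    proof cases
      case 1
      then show ?thesis using inj_onD[OF inj sig] j' by blast
    next
      case 2
      then have "signature ?ms 10 = signature ?ms j" using sig[of j] sig10(2) by simp
      then show ?thesis using inj_onD[OF inj _ sig10(1) j'] j(2) by blast
    qed
  qed (rule fixed)
  then have "{x \<in> golay_points. \<pi> x \<noteq> x} \<subseteq> {10, 12}" by blast
  then have "card {x \<in> golay_points. \<pi> x \<noteq> x} \<le> 2"
    using card_mono[of "{10, 12}" "{x \<in> golay_points. \<pi> x \<noteq> x}"] by simp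
  then show ?thesis by (intro M24_small_support[OF \<pi>]) simp_all
qed

text \<open>
  A permutation in M24 is multiplied successively by elements of \<open>H\<close> until it fixes five points of an
  octad, then a sixth (by an element of order 3), then a point outside the octad.
\<close>

theorem M24_subset: "M24 \<subseteq> H"
proof
  fix \<pi> assume \<pi>: "\<pi> \<in> M24"
  define xs :: "nat list" where "xs = [0, 1, 2, 3, 4]"
  have xs: "tuple 5 xs" by (simp add: xs_def tuple_def golay_points_def)
  (* The mask of the octad 0, 1, 2, 3, 4, 7, 10, 12, one of the sextet words. *)
  define D where "D = wset 5279"
  have D: "octad D" unfolding D_def by (rule certified_octad_word) (simp add: sextet_words_def)
  have D_mem: "set xs \<subseteq> D" "7 \<in> D" "5 \<notin> D" by (simp_all add: D_def wset_def xs_def bit_0)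
  have "inj_on \<pi> (set xs)" using M24_inj[OF \<pi>] inj_on_subset by blast
  then have "tuple 5 (map \<pi> xs)" using xs M24_point[OF \<pi>] by (auto simp: tuple_def distinct_map)
  then obtain g where g: "g \<in> H" "map g xs = map \<pi> xs" using transitive_5 xs unfolding transitive_def by blast
  define \<pi>1 where "\<pi>1 = inv_fun g \<circ> \<pi>"
  have \<pi>1: "\<pi>1 \<in> M24" unfolding \<pi>1_def by (rule M24_comp[OF M24[OF inv_fun[OF g(1)]] \<pi>])
  have \<pi>1_xs: "\<pi>1 x = x" if "x \<in> set xs" for x
    using g that inv_fun_eq_iff[OF g(1)] by (simp add: \<pi>1_def)
  have card_xs: "card (set xs) = 5" by (rule tupleD(1)[OF xs])
  have \<pi>1_D: "\<pi>1 ` D = D" by (rule octad_invariant[OF \<pi>1 D D_mem(1)]) (simp_all add: \<pi>1_xs card_xs)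

  obtain v where v: "v \<in> stab xs" "v ^^ 3 = id" "card (Fix v) = 6" "set xs \<subseteq> Fix v"
    using conjugate_in_stab[OF transitive_5 xs order_3(1) _ order_3(2)] t(5) by auto
  have vH: "v \<in> H" by (rule stabD(1)[OF v(1)])
  have vD: "v ` D = D" by (rule octad_invariant[OF M24[OF vH] D D_mem(1) Fix_image[OF v(4)]]) (simp add: card_xs)
  have "5 \<le> card (D \<inter> Fix v)"
    using card_mono[of "D \<inter> Fix v" "set xs"] D_mem(1) v(4) card_xs finite_Fix by simp
  then have "card (D \<inter> Fix v) = 5" by (rule order_3_octad[OF D M24[OF vH] vD v(2,3)])
  then have D_Fix: "set xs = D \<inter> Fix v" using D_mem(1) v(4) card_xs finite_Fix by (intro card_subset_eq) auto
  define R where "R = D - set xs"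
  have card_R: "card R = 3" using D D_mem(1) card_xs by (simp add: R_def card_Diff_subset octad_def)
  have 7: "7 \<in> R" using D_mem(2) by (simp add: R_def xs_def)
  have vR: "v ` R \<subseteq> R"
    unfolding R_def image_set_diff[OF inj[OF vH]] vD using stabD(2)[OF v(1)] by auto
  have "(\<lambda>i. (v ^^ i) 7) ` {..<3} = R"
  proof (rule card_subset_eq)
    have 73: "(v ^^ 3) 7 = 7" by (simp add: v(2))
    have v7: "v 7 \<noteq> 7" using D_Fix 7 octad_subset[OF D] by (auto simp: R_def Fix_def)
    have "(v ^^ d) 7 \<noteq> 7" if d: "0 < d" "d < 3" for d
    proof
      assume "(v ^^ d) 7 = 7"
      moreover have "prime (3 :: nat)" by simp
      then have "coprime d 3" using d by (metis coprime_commute nat_dvd_not_less prime_imp_coprime)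
      ultimately have "v 7 = 7" using funpow_fixed_coprime[of d v 7 3] 73 d(1) by blast
      then show False using v7 by contradiction
    qed
    then have "inj_on (\<lambda>i. (v ^^ i) 7) {..<3}" by (rule funpow_distinct[OF inj[OF vH] 73])
    then show "card ((\<lambda>i. (v ^^ i) 7) ` {..<3}) = card R" using card_R by (simp add: card_image)
    show "finite R" using octad_finite[OF D] by (simp add: R_def)
    show "(\<lambda>i. (v ^^ i) 7) ` {..<3} \<subseteq> R" using funpow_closed[OF vR 7] by blast
  qed
  moreover have "\<pi>1 7 \<in> R"
  proof -
    have "\<pi>1 7 \<in> D" using \<pi>1_D D_mem(2) by blast
    moreover have "\<pi>1 7 \<notin> set xs"
    proof
      assume "\<pi>1 7 \<in> set xs"
      then have "\<pi>1 (\<pi>1 7) = \<pi>1 7" by (rule \<pi>1_xs)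
      then have "\<pi>1 7 = 7" unfolding inj_eq[OF M24_inj[OF \<pi>1]] .
      then show False using \<open>\<pi>1 7 \<in> set xs\<close> by (simp add: xs_def)
    qed
    ultimately show ?thesis by (simp add: R_def)
  qed
  ultimately obtain i where i: "\<pi>1 7 = (v ^^ i) 7" by blast
  define h where "h = v ^^ i"
  have h: "h \<in> H" unfolding h_def by (rule funpow[OF vH])
  have h_xs: "h x = x" if "x \<in> set xs" for x unfolding h_def using stabD(2)[OF v(1) that] by (rule funpow_fixed)
  define \<pi>2 where "\<pi>2 = inv_fun h \<circ> \<pi>1"
  have \<pi>2: "\<pi>2 \<in> M24" unfolding \<pi>2_def by (rule M24_comp[OF M24[OF inv_fun[OF h]] \<pi>1])
  have \<pi>2_xs: "\<pi>2 x = x" if "x \<in> insert 7 (set xs)" for x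
    using that \<pi>1_xs h_xs i inv_fun_eq_iff[OF h] by (auto simp: \<pi>2_def h_def)
  have \<pi>2_D: "\<pi>2 ` D = D" by (rule octad_invariant[OF \<pi>2 D D_mem(1)]) (simp_all add: \<pi>2_xs card_xs)

  have "\<pi>2 5 \<notin> D" using \<pi>2_D D_mem(3) inj_image_mem_iff[OF M24_inj[OF \<pi>2]] by metis
  moreover have "(5 :: nat) \<in> golay_points" by (simp add: golay_points_def)
  moreover have "\<pi>2 5 \<in> golay_points" using M24_point[OF \<pi>2] by (simp add: golay_points_def)
  ultimately obtain w where w: "w \<in> H" "\<forall>d\<in>D. w d = d" "w 5 = \<pi>2 5"
    using outside_octad_transitive[OF D, of 5 "\<pi>2 5"] D_mem(3) by blast
  have "inv_fun w \<circ> \<pi>2 = id"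
  proof (rule pointwise_stabilizer_trivial[OF M24_comp[OF M24[OF inv_fun[OF w(1)]] \<pi>2]])
    fix x :: nat assume x: "x \<in> {0, 1, 2, 3, 4, 5, 7}"
    have "\<pi>2 x = w x"
    proof (cases "x = 5")
      case False
      then have "x \<in> insert 7 (set xs)" using x by (auto simp: xs_def)
      then show ?thesis using \<pi>2_xs w(2) D_mem(1,2) by auto
    qed (simp add: w(3))
    then show "(inv_fun w \<circ> \<pi>2) x = x" by (simp add: inv_fun_left[OF w(1)])
  qed
  then have "\<pi>2 x = w x" for x
    using inv_fun_eq_iff[OF w(1), of "\<pi>2 x" x] by (metis comp_apply id_apply)
  then have "\<pi>1 x = h (w x)" for x
    using inv_fun_eq_iff[OF h, of "\<pi>1 x" "w x"] by (simp add: \<pi>2_def)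
  then have "\<pi> x = g (h (w x))" for x
    using inv_fun_eq_iff[OF g(1), of "\<pi> x" "h (w x)"] by (simp add: \<pi>1_def)
  then have "\<pi> = g \<circ> (h \<circ> w)" by auto
  then show "\<pi> \<in> H" using comp g(1) h w(1) by simp
qed

end

section \<open>The linearized equation of a root\<close>

text \<open>
  From \<open>x ^ 24 = x + c\<close> one gets \<open>x ^ (24 * 2 ^ n) = x ^ 2 ^ n + c ^ 2 ^ n\<close>. Now
  \<open>2048 = 24 * 64 + 512\<close>, and the term \<open>x ^ 64 * x ^ 512\<close> is reduced by \<open>576 = 24 * 16 + 24 * 8\<close>. In the result all
  exponents are powers of two: the roots satisfy an affine equation over the field with two elements.
\<close>

lemma linearized:
  fixes c :: "'a::field_char_2"
  assumes "x \<in> root_set c"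
  shows "x ^ 2048 = c ^ 64 * x ^ 512 + c ^ 8 * x ^ 16 + c ^ 16 * x ^ 8 + x + (c + c ^ 24)"
proof -
  have "x ^ 24 + (x + c) = 0" using assms by (simp add: root_set_def add.assoc)
  then have x24: "x ^ 24 = x + c" unfolding add_eq_0_iff_char_2 .
  have pow: "x ^ (24 * 2 ^ n) = x ^ 2 ^ n + c ^ 2 ^ n" for n
    unfolding power_mult x24 frobenius_add ..
  have "x ^ 2048 = x ^ (24 * 2 ^ 6) * x ^ 512" by (simp flip: power_add)
  also have "\<dots> = x ^ (24 * 2 ^ 4) * x ^ (24 * 2 ^ 3) + c ^ 64 * x ^ 512"
    unfolding pow[of 6] by (simp add: distrib_right flip: power_add)
  also have "x ^ (24 * 2 ^ 4) * x ^ (24 * 2 ^ 3) = x ^ 24 + c ^ 8 * x ^ 16 + c ^ 16 * x ^ 8 + c ^ 24"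
    unfolding pow by (simp add: algebra_simps flip: power_add)
  finally show ?thesis unfolding x24 by (simp add: algebra_simps)
qed

lemma sum_lessThan_11:
  fixes f :: "nat \<Rightarrow> 'a::comm_ring_1"
  shows "(\<Sum>i<11. f i) = f 0 + f 1 + f 2 + f 3 + f 4 + f 5 + f 6 + f 7 + f 8 + f 9 + f 10"
  by (simp add: eval_nat_numeral)

text \<open>
  The list holds the coefficients of \<open>x\<close>, \<open>x ^ 2\<close>, \<open>x ^ 4\<close>, up to \<open>x ^ 1024\<close>, and a constant term. Squaring
  shifts the list, and the linearized equation rewrites \<open>x ^ 2048\<close>. The arguments \<open>sq\<close>, \<open>sc\<close> and \<open>pl\<close> are
  squaring, multiplication by \<open>c\<close> and addition of coefficients.
\<close>

fun square_step :: "('c \<Rightarrow> 'c) \<Rightarrow> ('c \<Rightarrow> 'c) \<Rightarrow> ('c \<Rightarrow> 'c \<Rightarrow> 'c) \<Rightarrow> 'c list \<Rightarrow> 'c list" where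
  "square_step sq sc pl [c0, c1, c2, c3, c4, c5, c6, c7, c8, c9, c10, d] =
     (let y = sq c10 in
      [y, sq c0, sq c1, pl (sq c2) ((sc ^^ 16) y), pl (sq c3) ((sc ^^ 8) y), sq c4, sq c5, sq c6, sq c7,
       pl (sq c8) ((sc ^^ 64) y), sq c9, pl (sq d) (pl ((sc ^^ 1) y) ((sc ^^ 24) y))])"
| "square_step sq sc pl cs = cs"

definition combination :: "('c \<Rightarrow> 'a) \<Rightarrow> 'a \<Rightarrow> 'c list \<Rightarrow> 'a::comm_ring_1" where
  "combination v x cs = (\<Sum>i<11. v (cs ! i) * x ^ 2 ^ i) + v (cs ! 11)"

lemma length_square_step: "length cs = 12 \<Longrightarrow> length (square_step sq sc pl cs) = 12"
  by (auto simp: length_Suc_conv eval_nat_numeral Let_def)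

lemma combination_square_step:
  fixes c :: "'a::field_char_2"
  assumes x: "x \<in> root_set c" and "length cs = 12"
    and v: "\<And>b. v (sq b) = v b ^ 2" "\<And>b. v (sc b) = c * v b" "\<And>a b. v (pl a b) = v a + v b"
  shows "combination v x (square_step sq sc pl cs) = combination v x cs ^ 2"
proof -
  obtain c0 c1 c2 c3 c4 c5 c6 c7 c8 c9 c10 d where cs: "cs = [c0, c1, c2, c3, c4, c5, c6, c7, c8, c9, c10, d]"
    using assms(2) by (auto simp: length_Suc_conv eval_nat_numeral)
  have v_sc: "v ((sc ^^ n) b) = c ^ n * v b" for n b by (induction n) (simp_all add: v(2) mult.assoc)
  have xx: "x * (x * y) = x ^ 2 * y" for y by (simp add: power2_eq_square mult.assoc)
  show ?thesis
    unfolding combination_def sum_lessThan_11 cs square_step.simps Let_def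
    by (simp add: v v_sc xx power2_add power_mult_distrib linearized[OF x] algebra_simps flip: power_mult)
qed

lemma combination_iterate:
  fixes c :: "'a::field_char_2"
  assumes "x \<in> root_set c" "length cs = 12"
    and "\<And>b. v (sq b) = v b ^ 2" "\<And>b. v (sc b) = c * v b" "\<And>a b. v (pl a b) = v a + v b"
  shows "combination v x ((square_step sq sc pl ^^ n) cs) = combination v x cs ^ 2 ^ n"
proof -
  have "length ((square_step sq sc pl ^^ n) cs) = 12 \<and> combination v x ((square_step sq sc pl ^^ n) cs) = combination v x cs ^ 2 ^ n"
  proof (induction n)
    case (Suc n)
    then have len: "length ((square_step sq sc pl ^^ n) cs) = 12" by simp
    show ?case
      using Suc length_square_step[OF len, of sq sc pl] combination_square_step[OF assms(1) len assms(3-5)]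
      by (simp add: power_mult[symmetric] mult.commute)
  qed (simp add: assms(2))
  then show ?thesis by simp
qed


text \<open>
  The group algebras over the field with two elements of the cyclic groups of order 3 and 5, generated by
  \<open>z\<close>. They represent the fields with 4 and 16 elements redundantly: if \<open>z\<close> is a primitive root of unity,
  then the element with all coefficients \<open>1\<close> is zero.
\<close>

datatype bits3 = B3 bool bool bool
datatype bits5 = B5 bool bool bool bool bool

fun val3 :: "'a::comm_ring_1 \<Rightarrow> bits3 \<Rightarrow> 'a" where
  "val3 z (B3 a b c) = of_bool a + of_bool b * z + of_bool c * z ^ 2"
fun square3 where "square3 (B3 a b c) = B3 a c b"
fun rotate3 where "rotate3 (B3 a b c) = B3 c a b"
fun plus3 where "plus3 (B3 a b c) (B3 a' b' c') = B3 (a \<noteq> a') (b \<noteq> b') (c \<noteq> c')"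

fun val5 :: "'a::comm_ring_1 \<Rightarrow> bits5 \<Rightarrow> 'a" where
  "val5 z (B5 a b c d e) = of_bool a + of_bool b * z + of_bool c * z ^ 2 + of_bool d * z ^ 3 + of_bool e * z ^ 4"
fun square5 where "square5 (B5 a b c d e) = B5 a d b e c"
fun rotate5 where "rotate5 (B5 a b c d e) = B5 e a b c d"
fun plus5 where "plus5 (B5 a b c d e) (B5 a' b' c' d' e') = B5 (a \<noteq> a') (b \<noteq> b') (c \<noteq> c') (d \<noteq> d') (e \<noteq> e')"

lemma of_bool_xor: "(of_bool (a \<noteq> b) :: 'a::char_2) = of_bool a + of_bool b"
  by (cases a; cases b) simp_all

lemma power_mod_order: "(z :: 'a::comm_ring_1) ^ m = 1 \<Longrightarrow> z ^ n = z ^ (n mod m)"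
  by (metis div_mult_mod_eq mult.commute mult_1 power_add power_mult power_one)

lemma of_bool_square: "(of_bool a :: 'a::comm_ring_1) ^ 2 = of_bool a"
  by simp

lemma val3_simps:
  fixes z :: "'a::char_2"
  assumes z: "z ^ 3 = 1"
  shows "val3 z (square3 b) = val3 z b ^ 2" "val3 z (rotate3 b) = z * val3 z b"
    "val3 z (plus3 a b) = val3 z a + val3 z b"
proof -
  obtain p q r where b: "b = B3 p q r" by (cases b)
  have z4: "z ^ 4 = z" using power_mod_order[OF z, of 4] by simp
  show "val3 z (square3 b) = val3 z b ^ 2"
    by (simp add: b power2_add power_mult_distrib of_bool_square z4 flip: power_mult)
  show "val3 z (rotate3 b) = z * val3 z b"
    using z by (simp add: b distrib_left power2_eq_square power3_eq_cube mult.left_commute algebra_simps)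
  show "val3 z (plus3 a b) = val3 z a + val3 z b"
    by (cases a; cases b) (simp add: of_bool_xor algebra_simps)
qed

lemma val5_simps:
  fixes z :: "'a::char_2"
  assumes z: "z ^ 5 = 1"
  shows "val5 z (square5 b) = val5 z b ^ 2" "val5 z (rotate5 b) = z * val5 z b"
    "val5 z (plus5 a b) = val5 z a + val5 z b"
proof -
  obtain p q r s t where b: "b = B5 p q r s t" by (cases b)
  have z6: "z ^ 6 = z" "z ^ 8 = z ^ 3" using power_mod_order[OF z, of 6] power_mod_order[OF z, of 8] by simp_all
  show "val5 z (square5 b) = val5 z b ^ 2"
    by (simp add: b power2_add power_mult_distrib of_bool_square z6 flip: power_mult)
  have pows: "z * z = z ^ 2" "z * z ^ 2 = z ^ 3" "z * z ^ 3 = z ^ 4" "z * z ^ 4 = 1"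
    using z by (simp add: power2_eq_square, simp add: power2_eq_square power3_eq_cube, simp_all flip: power_Suc)
  show "val5 z (rotate5 b) = z * val5 z b"
    unfolding b rotate5.simps val5.simps distrib_left mult.left_commute[of z "of_bool _"] pows by (simp add: ac_simps)
  show "val5 z (plus5 a b) = val5 z a + val5 z b"
    by (cases a; cases b) (simp add: of_bool_xor algebra_simps)
qed

abbreviation (input) "O3 \<equiv> B3 False False False"
abbreviation (input) "O5 \<equiv> B5 False False False False False"

text \<open>
  The list with entries \<open>011\<close> and \<open>111\<close> stands for \<open>x\<close> again, because \<open>z + z ^ 2 = 1\<close>.
\<close>

lemma iterate3:
  "(square_step square3 rotate3 plus3 ^^ 28) [B3 True False False, O3, O3, O3, O3, O3, O3, O3, O3, O3, O3, O3] = [B3 False True True, B3 False False False, B3 False False False, B3 False False False, B3 False False False, B3 False False False, B3 False False False, B3 True True True, B3 False False False, B3 False False False, B3 False False False, B3 False False False]"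
  by code_simp

lemma iterate5:
  "(square_step square5 rotate5 plus5 ^^ 60) [B5 True False False False False, O5, O5, O5, O5, O5, O5, O5, O5, O5, O5, O5] = [B5 True False False False False, B5 True True True True True, B5 False False False False False, B5 False False False False False, B5 False False False False False, B5 False False False False False, B5 True True True True True, B5 False False False False False, B5 True True True True True, B5 False False False False False, B5 False False False False False, B5 False False False False False]"
  by code_simp

lemma two_eq_0: "(2 :: 'a::char_2) = 0"
  by (metis one_add_one one_plus_one)

lemma combination_initial3: "combination (val3 z) x [B3 True False False, O3, O3, O3, O3, O3, O3, O3, O3, O3, O3, O3] = x"
proof -
  show ?thesis unfolding combination_def sum_lessThan_11 by simp
qed

lemma combination_initial5: "combination (val5 z) x [B5 True False False False False, O5, O5, O5, O5, O5, O5, O5, O5, O5, O5, O5] = x"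
proof -
  show ?thesis unfolding combination_def sum_lessThan_11 by simp
qed

lemma length_initial3: "length [B3 True False False, O3, O3, O3, O3, O3, O3, O3, O3, O3, O3, O3] = 12" by simp
lemma length_initial5: "length [B5 True False False False False, O5, O5, O5, O5, O5, O5, O5, O5, O5, O5, O5] = 12" by simp

lemma frobenius_period_cube_root:
  fixes z :: "'a::field_char_2"
  assumes z: "1 + z + z ^ 2 = 0" and x: "x \<in> root_set z"
  shows "x ^ 2 ^ 28 = x"
proof -
  have z2: "z ^ 2 = z + 1" using z by (metis add.commute add_eq_0_iff_char_2)
  have z3: "z ^ 3 = 1"
    using z2 by (simp add: power3_eq_cube power2_eq_square algebra_simps)
  have "x ^ 2 ^ 28 = combination (val3 z) x ((square_step square3 rotate3 plus3 ^^ 28) [B3 True False False, O3, O3, O3, O3, O3, O3, O3, O3, O3, O3, O3])"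
    by (simp only: combination_iterate[OF x length_initial3 val3_simps[OF z3]] combination_initial3)
  also have "\<dots> = x"
  proof -
    show ?thesis unfolding iterate3 combination_def sum_lessThan_11 using z by (simp add: z2 two_eq_0)
  qed
  finally show ?thesis .
qed

lemma frobenius_period_fifth_root:
  fixes z :: "'a::field_char_2"
  assumes z: "1 + z + z ^ 2 + z ^ 3 + z ^ 4 = 0" and x: "x \<in> root_set z"
  shows "x ^ 2 ^ 60 = x"
proof -
  have "z ^ 5 + 1 = (1 + z + z ^ 2 + z ^ 3 + z ^ 4) * (z + 1)"
    by (simp add: eval_nat_numeral algebra_simps)
  then have z5: "z ^ 5 = 1" unfolding z by (simp add: add_eq_0_iff_char_2)
  have "x ^ 2 ^ 60 = combination (val5 z) x ((square_step square5 rotate5 plus5 ^^ 60) [B5 True False False False False, O5, O5, O5, O5, O5, O5, O5, O5, O5, O5, O5])"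
    by (simp only: combination_iterate[OF x length_initial5 val5_simps[OF z5]] combination_initial5)
  also have "\<dots> = x"
  proof -
    show ?thesis unfolding iterate5 combination_def sum_lessThan_11 by (simp add: z)
  qed
  finally show ?thesis .
qed

section \<open>Additive relations among the roots\<close>

lemma sum_sym_diff:
  fixes f :: "'b \<Rightarrow> 'a::char_2"
  assumes "finite A" "finite B"
  shows "sum f (sym_diff A B) = sum f A + sum f B"
proof -
  have "sum f (sym_diff A B) = sum f (A - B) + sum f (B - A)"
    using assms by (intro sum.union_disjoint) auto
  moreover have "sum f A = sum f (A \<inter> B) + sum f (A - B)" using assms(1) by (rule sum.Int_Diff)
  moreover have "sum f B = sum f (A \<inter> B) + sum f (B - A)" using sum.Int_Diff[OF assms(2), of f A] by (simp add: Int_commute)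
  ultimately show ?thesis by (simp add: algebra_simps)
qed

lemma card_additive_roots:
  fixes c d :: "'a::field_char_2"
  shows "card {y. y ^ 2048 + c ^ 64 * y ^ 512 + c ^ 8 * y ^ 16 + c ^ 16 * y ^ 8 + y + d = 0} \<le> 2048"
    and "finite {y. y ^ 2048 + c ^ 64 * y ^ 512 + c ^ 8 * y ^ 16 + c ^ 16 * y ^ 8 + y + d = 0}"
proof -
  define p where "p = Polynomial.monom 1 2048 + (Polynomial.monom (c ^ 64) 512 + Polynomial.monom (c ^ 8) 16 + Polynomial.monom (c ^ 16) 8 + [:d, 1:])"
  have "Polynomial.degree (Polynomial.monom (c ^ 64) 512 + Polynomial.monom (c ^ 8) 16 + Polynomial.monom (c ^ 16) 8 + [:d, 1:]) \<le> 512"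
    by (intro degree_add_le order.trans[OF degree_monom_le]) simp_all
  then have deg: "Polynomial.degree p = 2048"
    unfolding p_def by (subst degree_add_eq_left) (auto simp: degree_monom_eq)
  then have "p \<noteq> 0" by auto
  have eq: "{y. y ^ 2048 + c ^ 64 * y ^ 512 + c ^ 8 * y ^ 16 + c ^ 16 * y ^ 8 + y + d = 0} = {y. poly p y = 0}"
    by (simp add: p_def poly_monom algebra_simps)
  show "card {y. y ^ 2048 + c ^ 64 * y ^ 512 + c ^ 8 * y ^ 16 + c ^ 16 * y ^ 8 + y + d = 0} \<le> 2048"
    unfolding eq using card_poly_roots_bound[OF \<open>p \<noteq> 0\<close>] deg by simp
  show "finite {y. y ^ 2048 + c ^ 64 * y ^ 512 + c ^ 8 * y ^ 16 + c ^ 16 * y ^ 8 + y + d = 0}"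
    unfolding eq using poly_roots_finite[OF \<open>p \<noteq> 0\<close>] .
qed

text \<open>
  The linearized equation summed over \<open>S\<close>; only the constant term depends on the number of summands.
\<close>

lemma sum_roots_additive:
  fixes c :: "'a::field_char_2"
  assumes "S \<subseteq> root_set c"
  shows "(\<Sum>S) ^ 2048 + c ^ 64 * (\<Sum>S) ^ 512 + c ^ 8 * (\<Sum>S) ^ 16 + c ^ 16 * (\<Sum>S) ^ 8 + \<Sum>S + of_bool (odd (card S)) * (c + c ^ 24) = 0"
proof -
  have pow: "(\<Sum>S) ^ n = (\<Sum>x\<in>S. x ^ n)" if "n = 2 ^ k" for n k
    unfolding that frobenius_sum ..
  have "(\<Sum>x\<in>S. x ^ 2048 + c ^ 64 * x ^ 512 + c ^ 8 * x ^ 16 + c ^ 16 * x ^ 8 + x + (c + c ^ 24)) = 0"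
  proof (rule sum.neutral, rule ballI)
    fix x assume "x \<in> S"
    then show "x ^ 2048 + c ^ 64 * x ^ 512 + c ^ 8 * x ^ 16 + c ^ 16 * x ^ 8 + x + (c + c ^ 24) = 0"
      using linearized[of x c] assms by (auto simp: add.assoc)
  qed
  moreover have "(\<Sum>S) ^ 2048 = (\<Sum>x\<in>S. x ^ 2048)" by (rule pow[of _ 11]) simp
  moreover have "(\<Sum>S) ^ 512 = (\<Sum>x\<in>S. x ^ 512)" by (rule pow[of _ 9]) simp
  moreover have "(\<Sum>S) ^ 16 = (\<Sum>x\<in>S. x ^ 16)" by (rule pow[of _ 4]) simp
  moreover have "(\<Sum>S) ^ 8 = (\<Sum>x\<in>S. x ^ 8)" by (rule pow[of _ 3]) simp
  ultimately show ?thesis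
    by (simp only: sum.distrib sum_distrib_left[symmetric] sum_constant of_nat_char_2 distrib_left)
qed

text \<open>
  The sum of a set of roots is a root of one of two polynomials of degree 2048. So the \<open>2 ^ 24\<close> sets of roots
  have at most \<open>2 ^ 12\<close> different sums, and the fibres of the sum map are cosets of the relations.
\<close>

theorem card_root_relations:
  fixes c :: "'a::{alg_closed_field,field_char_2}"
  shows "4096 \<le> card {S. S \<subseteq> root_set c \<and> \<Sum>S = 0}"
proof -
  let ?R = "root_set c"
  define C where "C = {S. S \<subseteq> ?R \<and> \<Sum>S = 0}"
  define W where "W = (\<lambda>S. \<Sum>S) ` Pow ?R"
  have fin: "finite (Pow ?R)" using finite_root_set by simp
  let ?V = "\<lambda>d. {y. y ^ 2048 + c ^ 64 * y ^ 512 + c ^ 8 * y ^ 16 + c ^ 16 * y ^ 8 + y + d = 0}"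
  have "W \<subseteq> ?V 0 \<union> ?V (c + c ^ 24)"
  proof
    fix y assume "y \<in> W"
    then obtain S where "S \<subseteq> ?R" "y = \<Sum>S" by (auto simp: W_def)
    then show "y \<in> ?V 0 \<union> ?V (c + c ^ 24)" using sum_roots_additive[of S c] by (cases "odd (card S)") simp_all
  qed
  then have "card W \<le> card (?V 0 \<union> ?V (c + c ^ 24))" by (intro card_mono finite_UnI card_additive_roots(2))
  also have "\<dots> \<le> card (?V 0) + card (?V (c + c ^ 24))" by (rule card_Un_le)
  also have "\<dots> \<le> 4096" using card_additive_roots(1)[of c 0] card_additive_roots(1)[of c "c + c ^ 24"] by linarith
  finally have card_W: "card W \<le> 4096" .
  have fibre: "card {S \<in> Pow ?R. \<Sum>S = y} \<le> card C" if "y \<in> W" for y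
  proof -
    from that obtain S0 where S0: "S0 \<subseteq> ?R" "y = \<Sum>S0" by (auto simp: W_def)
    have fin': "finite S" if "S \<subseteq> ?R" for S using that finite_root_set finite_subset by blast
    show ?thesis
    proof (rule card_inj_on_le)
      show "inj_on (\<lambda>S. sym_diff S S0) {S \<in> Pow ?R. \<Sum>S = y}" by (rule inj_onI) blast
      show "(\<lambda>S. sym_diff S S0) ` {S \<in> Pow ?R. \<Sum>S = y} \<subseteq> C"
        using S0 fin' by (auto simp: C_def sum_sym_diff)
      show "finite C" by (rule finite_subset[OF _ fin]) (auto simp: C_def)
    qed
  qed
  have "Pow ?R = (\<Union>y\<in>W. {S \<in> Pow ?R. \<Sum>S = y})" by (auto simp: W_def)
  then have "card (Pow ?R) = card (\<Union>y\<in>W. {S \<in> Pow ?R. \<Sum>S = y})" by (rule arg_cong)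
  also have "\<dots> \<le> (\<Sum>y\<in>W. card {S \<in> Pow ?R. \<Sum>S = y})" unfolding W_def by (rule card_UN_le[OF finite_imageI[OF fin]])
  also have "\<dots> \<le> (\<Sum>y\<in>W. card C)" by (rule sum_mono[OF fibre])
  also have "\<dots> \<le> 4096 * card C" using card_W by simp
  finally have "card (Pow ?R) \<le> 4096 * card C" .
  moreover have "card (Pow ?R) = 2 ^ 24" unfolding card_Pow[OF finite_root_set] card_root_set ..
  ultimately have "4096 \<le> card C" by simp
  then show ?thesis unfolding C_def by simp
qed

lemma power_eq_1_coprime:
  assumes "(z :: 'a::field) ^ a = 1" "z ^ b = 1" "coprime a b" "a > 0"
  shows "z = 1"
proof -
  obtain u v where uv: "a * u = b * v + 1" using bezout_nat[of a b] assms(3,4) by auto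
  have "1 = z ^ (a * u)" using assms(1) by (simp add: power_mult)
  also have "\<dots> = z ^ (b * v) * z" unfolding uv by simp
  also have "\<dots> = z" using assms(2) by (simp add: power_mult)
  finally show ?thesis by simp
qed

lemma root_of_unity_powers_inj:
  assumes "(z :: 'a::field) ^ 23 = 1" "z \<noteq> 1" "i < 23" "j < 23" "z ^ i = z ^ j"
  shows "i = j"
proof (rule ccontr)
  have *: "z = 1" if "i < j" "j < 23" "z ^ i = z ^ j" for i j
  proof -
    have "z \<noteq> 0" using assms(1) by auto
    have "z ^ j = z ^ (i + (j - i))" using that(1) by simp
    then have "z ^ j = z ^ i * z ^ (j - i)" by (simp only: power_add)
    from trans[OF this[symmetric] that(3)[symmetric]] have "z ^ i * z ^ (j - i) = z ^ i" .
    then have "z ^ (j - i) = 1" using \<open>z \<noteq> 0\<close> by simp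
    moreover have "prime (23 :: nat)" by simp
    then have "coprime (j - i) 23"
      using that by (metis coprime_commute less_imp_diff_less nat_dvd_not_less prime_imp_coprime zero_less_diff)
    ultimately show ?thesis using power_eq_1_coprime assms(1) that by (metis zero_less_diff)
  qed
  assume "i \<noteq> j"
  then show False using *[of i j] *[of j i] assms by (metis linorder_neqE_nat)
qed

text \<open>
  For a 23rd root of unity \<open>y \<noteq> 1\<close>, the sum over the nonresidues is fixed by squaring because \<open>2\<close> is a
  residue; so it is 0 or 1. If it is 1, then \<open>y ^ 5\<close> works: \<open>5\<close> is a nonresidue, hence the sum becomes the one over
  the nonzero residues, and both sums add up to 1.
\<close>

lemma sum_nonresidues_exists:
  "\<exists>z :: 'a::{alg_closed_field,field_char_2}. z ^ 23 = 1 \<and> z \<noteq> 1 \<and> (\<Sum>n\<leftarrow>nonresidues. z ^ n) = 0"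
proof -
  have "card (root_set (0 :: 'a) - {0, 1}) > 0"
    using card_Diff_subset[of "{0, 1}" "root_set (0 :: 'a)"] card_root_set[of "0 :: 'a"]
      card_mono[OF finite_root_set[of "0 :: 'a"], of "root_set 0 \<inter> {0, 1}"]
    by (simp add: root_set_def one_plus_one)
  then obtain y :: 'a where y: "y \<in> root_set 0" "y \<noteq> 0" "y \<noteq> 1" by (metis DiffE all_not_in_conv card.empty insertCI less_irrefl)
  have "y * (y ^ 23 + 1) = 0" using y(1) by (simp add: root_set_def algebra_simps flip: power_Suc)
  then have y23: "y ^ 23 = 1" using y(2) by (simp add: add_eq_0_iff_char_2)
  note reduce = power_mod_order[OF y23]
  define s where "s = (\<Sum>n\<leftarrow>nonresidues. y ^ n)"
  have s: "s = y ^ 5 + y ^ 7 + y ^ 10 + y ^ 11 + y ^ 14 + y ^ 15 + y ^ 17 + y ^ 19 + y ^ 20 + y ^ 21 + y ^ 22"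
    by (simp add: s_def nonresidues_def add.assoc)
  have "s ^ 2 = y ^ 10 + y ^ 14 + y ^ 20 + y ^ 22 + y ^ 28 + y ^ 30 + y ^ 34 + y ^ 38 + y ^ 40 + y ^ 42 + y ^ 44"
    unfolding s by (simp add: power2_add flip: power_mult)
  also have "\<dots> = s"
    unfolding s reduce[of 28] reduce[of 30] reduce[of 34] reduce[of 38] reduce[of 40] reduce[of 42] reduce[of 44]
    by (simp add: ac_simps)
  finally have sq: "s ^ 2 = s" .
  have "s * (s + 1) = s ^ 2 + s" by (simp only: power2_eq_square distrib_left mult_1_right)
  also have "\<dots> = 0" unfolding sq by simp
  finally have "s = 0 \<or> s = 1" by (simp add: add_eq_0_iff_char_2)
  then show ?thesis
  proof
    assume "s = 0"
    then show ?thesis using y23 y(3) by (auto simp: s_def)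
  next
    assume "s = 1"
    have "(y + 1) * (\<Sum>i<23. y ^ i) = 0"
      using one_diff_power_eq[of y 23] y23 by (simp add: add.commute)
    then have "(\<Sum>i<23. y ^ i) = 0" using y(3) by (simp add: add_eq_0_iff_char_2)
    then have all: "1 + y + y ^ 2 + y ^ 3 + y ^ 4 + y ^ 5 + y ^ 6 + y ^ 7 + y ^ 8 + y ^ 9 + y ^ 10 + y ^ 11 + y ^ 12
      + y ^ 13 + y ^ 14 + y ^ 15 + y ^ 16 + y ^ 17 + y ^ 18 + y ^ 19 + y ^ 20 + y ^ 21 + y ^ 22 = 0"
      by (simp add: numeral_eq_Suc)
    have "(\<Sum>n\<leftarrow>nonresidues. (y ^ 5) ^ n) = y ^ 25 + y ^ 35 + y ^ 50 + y ^ 55 + y ^ 70 + y ^ 75 + y ^ 85 + y ^ 95 + y ^ 100 + y ^ 105 + y ^ 110"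
      by (simp add: nonresidues_def add.assoc flip: power_mult)
    also have "\<dots> = y ^ 2 + y ^ 12 + y ^ 4 + y ^ 9 + y ^ 1 + y ^ 6 + y ^ 16 + y ^ 3 + y ^ 8 + y ^ 13 + y ^ 18"
      unfolding reduce[of 25] reduce[of 35] reduce[of 50] reduce[of 55] reduce[of 70] reduce[of 75] reduce[of 85]
        reduce[of 95] reduce[of 100] reduce[of 105] reduce[of 110] by simp
    also have "\<dots> = 1 + s + (1 + y + y ^ 2 + y ^ 3 + y ^ 4 + y ^ 5 + y ^ 6 + y ^ 7 + y ^ 8 + y ^ 9 + y ^ 10 + y ^ 11 + y ^ 12
      + y ^ 13 + y ^ 14 + y ^ 15 + y ^ 16 + y ^ 17 + y ^ 18 + y ^ 19 + y ^ 20 + y ^ 21 + y ^ 22)"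
      unfolding s by (simp add: ac_simps)
    also have "\<dots> = 0" unfolding all \<open>s = 1\<close> by (simp add: one_plus_one)
    finally have "(\<Sum>n\<leftarrow>nonresidues. (y ^ 5) ^ n) = 0" .
    moreover have "(y ^ 5) ^ 23 = 1" using y23 by (metis mult.commute power_mult power_one)
    moreover have "y ^ 5 \<noteq> 1" using root_of_unity_powers_inj[OF y23 y(3), of 5 0] by auto
    ultimately show ?thesis by blast
  qed
qed

locale root_labelling =
  fixes z :: "'a::{alg_closed_field,field_char_2}"
  assumes z23: "z ^ 23 = 1" and z1: "z \<noteq> 1" and nonres: "(\<Sum>n\<leftarrow>nonresidues. z ^ n) = 0"
begin

text \<open>
  The roots of \<open>x ^ 24 + x\<close>: the point at infinity corresponds to \<open>0\<close>.
\<close>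

definition label :: "nat \<Rightarrow> 'a" where
  "label i = (if i = 23 then 0 else z ^ i)"

lemma z0: "z \<noteq> 0"
  using z23 by auto

lemma label_bij: "bij_betw label golay_points (root_set 0)"
proof -
  have inj: "inj_on label golay_points"
  proof (rule inj_onI)
    fix i j assume "i \<in> golay_points" "j \<in> golay_points" "label i = label j"
    then show "i = j" using root_of_unity_powers_inj[OF z23 z1, of i j] z0
      by (auto simp: label_def golay_points_def less_Suc_eq split: if_splits)
  qed
  have "label i \<in> root_set 0" for i
  proof (cases "i = 23")
    case False
    have "(z ^ i) ^ 24 = (z ^ 23) ^ i * z ^ i" by (simp flip: power_mult power_add add: algebra_simps)
    then show ?thesis using False z23 by (simp add: label_def root_set_def)
  qed (simp add: label_def root_set_def)
  then have "label ` golay_points \<subseteq> root_set 0" by blast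
  then have "label ` golay_points = root_set 0"
    by (intro card_subset_eq finite_root_set) (simp_all add: card_image[OF inj] card_root_set card_points)
  then show ?thesis using inj by (simp add: bij_betw_def)
qed

definition even_code :: "nat set set" where
  "even_code = {S. S \<subseteq> golay_points \<and> sum label S = 0 \<and> even (card S)}"

lemma even_code_sym_diff:
  assumes "A \<in> even_code" "B \<in> even_code" shows "sym_diff A B \<in> even_code"
proof -
  have fin: "finite A" "finite B" using assms finite_points finite_subset by (auto simp: even_code_def)
  have "even (card (sym_diff A B))" using card_sym_diff[OF fin] assms by (metis (no_types, lifting) dvd_add_left_iff dvd_triv_left even_add even_code_def mem_Collect_eq)
  then show ?thesis using assms fin by (auto simp: even_code_def sum_sym_diff)
qed

text \<open>
  A generator is a translate of the set of nonresidues, together with infinity. Translation by \<open>i\<close>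
  multiplies the sum of the labels by \<open>z ^ i\<close>.
\<close>

lemma golay_code_subset_even_code: "A \<in> golay_code \<Longrightarrow> A \<in> even_code"
proof (induction rule: golay_code.induct)
  case all
  have "(\<Sum>i<23. z ^ i) = 0"
  proof -
    have "(z + 1) * (\<Sum>i<23. z ^ i) = 0" using one_diff_power_eq[of z 23] z23 by (simp add: add.commute)
    then show ?thesis using z1 by (simp add: add_eq_0_iff_char_2)
  qed
  moreover have "sum label {..<23} = (\<Sum>i<23. z ^ i)" by (rule sum.cong) (auto simp: label_def)
  moreover have points: "golay_points = insert 23 {..<23}" by (auto simp: golay_points_def)
  have "sum label golay_points = label 23 + sum label {..<23}" unfolding points by simp
  ultimately have "sum label golay_points = 0" by (simp add: label_def)
  then show ?case by (simp add: even_code_def card_points)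
next
  case (generator i)
  define N where "N = (\<lambda>n. (n + i) mod 23) ` set nonresidues"
  have less: "n < 23" if "n \<in> set nonresidues" for n using that by (auto simp: nonresidues_def)
  have "n < 23 \<and> \<not> QuadRes 23 (int n) \<longleftrightarrow> n \<in> set nonresidues" for n
    using QuadRes_23_iff[of n] less[of n] by blast
  then have "golay_generator i = insert 23 N" unfolding golay_generator_def N_def by blast
  moreover have "23 \<notin> N" by (auto simp: N_def)
  moreover have "sum label N = 0"
  proof -
    have inj: "inj_on (\<lambda>n. (n + i) mod 23) (set nonresidues)"
    proof (rule inj_onI)
      fix m n assume mn: "m \<in> set nonresidues" "n \<in> set nonresidues" "(m + i) mod 23 = (n + i) mod 23"
      then have "[m + i = n + i] (mod 23)" by (simp add: cong_def)
      then have "[m = n] (mod 23)" by (simp only: cong_add_rcancel_nat)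
      moreover have "m < 23" "n < 23" using mn(1,2) less by blast+
      ultimately show "m = n" by (rule cong_less_modulus_unique_nat)
    qed
    have "sum label N = (\<Sum>n\<in>set nonresidues. label ((n + i) mod 23))" unfolding N_def by (simp add: sum.reindex[OF inj])
    also have "\<dots> = (\<Sum>n\<in>set nonresidues. z ^ i * z ^ n)"
      using power_mod_order[OF z23] by (intro sum.cong refl) (auto simp: label_def simp flip: power_add, (metis add.commute)+)
    also have "\<dots> = z ^ i * (\<Sum>n\<leftarrow>nonresidues. z ^ n)"
      by (subst sum_list_distinct_conv_sum_set) (simp_all add: nonresidues_def distrib_left)
    finally show ?thesis by (simp add: nonres)
  qed
  moreover have "golay_generator i \<subseteq> golay_points" "even (card (golay_generator i))"
    using golay_code_subset golay_code_doubly_even golay_code.generator[OF generator] by (blast, metis dvd_trans even_numeral dvd_def mult_2 numeral_Bit0)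
  ultimately show ?case by (simp add: even_code_def label_def N_def)
next
  case (sum A B)
  then show ?case by (intro even_code_sym_diff)
qed (simp add: even_code_def)

text \<open>
  Dividing the sum of the labels by \<open>z ^ 12\<close> gives a polynomial of degree at most 10 that vanishes at \<open>z\<close>. Its
  coefficients are 0 and 1, so it also vanishes at the conjugates \<open>z ^ 2 ^ n\<close> of \<open>z\<close>, of which there are 11.
\<close>

lemma even_code_systematic:
  assumes "S \<in> even_code" "S \<inter> {0..<12} = {}" shows "S = {}"
proof -
  have S: "S \<subseteq> {12..23}"
  proof
    fix i assume "i \<in> S"
    then have "i \<notin> {0..<12}" "i \<in> {0..<24}" using assms by (auto simp only: even_code_def golay_points_def)
    then show "i \<in> {12..23}" by simp
  qed
  have S: "S \<subseteq> {12..23}" "sum label S = 0" "even (card S)"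
    using S assms(1) by (auto simp only: even_code_def)
  have fin: "finite S" using S(1) finite_subset by blast
  define p where "p = (\<Sum>i\<in>S - {23}. Polynomial.monom (1 :: 'a) (i - 12))"
  have p_eval: "poly p x = (\<Sum>i\<in>S - {23}. x ^ (i - 12))" for x by (simp add: p_def poly_sum poly_monom)
  have "z ^ 12 * poly p z = (\<Sum>i\<in>S - {23}. label i)"
    unfolding p_eval sum_distrib_left using S(1) by (intro sum.cong refl) (auto simp: label_def simp flip: power_add)
  also have "\<dots> = sum label S" using fin by (intro sum.mono_neutral_left) (auto simp: label_def)
  finally have pz: "poly p z = 0" using S(2) z0 by simp
  have pzn: "poly p (z ^ 2 ^ n) = 0" for n
  proof -
    have "poly p (z ^ 2 ^ n) = poly p z ^ 2 ^ n"
      unfolding p_eval frobenius_sum by (simp flip: power_mult add: mult.commute)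
    then show ?thesis using pz by simp
  qed
  (* The powers of 2 modulo 23. *)
  define Q where "Q = [1, 2, 4, 8, 16, 9, 18, 13, 3, 6, 12 :: nat]"
  have "poly p (z ^ q) = 0" if q: "q \<in> set Q" for q
  proof -
    have "z ^ 2 ^ n = z ^ (2 ^ n mod 23)" for n :: nat by (rule power_mod_order[OF z23])
    then have *: "poly p (z ^ (2 ^ n mod 23)) = 0" for n :: nat using pzn by metis
    show ?thesis
      using q *[of 0] *[of 1] *[of 2] *[of 3] *[of 4] *[of 5] *[of 6] *[of 7] *[of 8] *[of 9] *[of 10]
      unfolding Q_def by auto
  qed
  then have roots: "(\<lambda>q. z ^ q) ` set Q \<subseteq> {x. poly p x = 0}" by blast
  have inj: "inj_on (\<lambda>q. z ^ q) (set Q)"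
    by (rule inj_onI) (rule root_of_unity_powers_inj[OF z23 z1], auto simp: Q_def)
  have "p = 0"
  proof (rule ccontr)
    assume p0: "p \<noteq> 0"
    have "card ((\<lambda>q. z ^ q) ` set Q) = 11" unfolding card_image[OF inj] by (simp add: Q_def)
    then have "11 \<le> card {x. poly p x = 0}" using card_mono[OF poly_roots_finite[OF p0] roots] by simp
    also have "\<dots> \<le> Polynomial.degree p" by (rule card_poly_roots_bound[OF p0])
    also have "\<dots> \<le> 10"
      unfolding p_def
    proof (rule degree_sum_le)
      fix i assume i: "i \<in> S - {23}"
      then have "i \<in> {12..23}" using S(1) by blast
      then have "i - 12 \<le> 10" using i by auto
      then show "Polynomial.degree (Polynomial.monom (1 :: 'a) (i - 12)) \<le> 10"
        by (rule order.trans[OF degree_monom_le])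
    qed (simp add: fin)
    finally show False by simp
  qed
  have "S - {23} = {}"
  proof (rule ccontr)
    assume "S - {23} \<noteq> {}"
    then obtain j where j: "j \<in> S" "j \<noteq> 23" by blast
    have "Polynomial.coeff p (j - 12) = (\<Sum>i\<in>S - {23}. if i - 12 = j - 12 then 1 else 0)"
      by (simp add: p_def coeff_sum)
    also have "\<dots> = (\<Sum>i\<in>S - {23}. if i = j then 1 else 0)"
    proof (rule sum.cong[OF refl])
      fix i assume "i \<in> S - {23}"
      then have "12 \<le> i" "12 \<le> j" using S(1) j(1) by auto
      then have "i - 12 = j - 12 \<longleftrightarrow> i = j" by linarith
      then show "(if i - 12 = j - 12 then 1 else 0) = (if i = j then 1 else (0 :: 'a))" by simp
    qed
    also have "\<dots> = 1" using j fin by simp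
    finally show False using \<open>p = 0\<close> by simp
  qed
  then have "S = {} \<or> S = {23}" by blast
  then show ?thesis using S(3) by auto
qed

lemma even_code_inj: "inj_on (\<lambda>S. S \<inter> {0..<12}) even_code"
proof (rule inj_onI)
  fix A B assume AB: "A \<in> even_code" "B \<in> even_code" "A \<inter> {0..<12} = B \<inter> {0..<12}"
  have "sym_diff A B \<inter> {0..<12} = sym_diff (A \<inter> {0..<12}) (B \<inter> {0..<12})" by blast
  then have "sym_diff A B \<inter> {0..<12} = {}" unfolding AB(3) by simp
  then have "sym_diff A B = {}" by (rule even_code_systematic[OF even_code_sym_diff[OF AB(1,2)]])
  then show "A = B" by blast
qed

lemma even_code_eq: "even_code = golay_code"
proof
  show "golay_code \<subseteq> even_code" using golay_code_subset_even_code by blast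
  show "even_code \<subseteq> golay_code"
  proof
    fix A assume A: "A \<in> even_code"
    obtain C where C: "C \<in> golay_code" "C \<inter> {0..<12} = A \<inter> {0..<12}"
      using golay_code_systematic[of "A \<inter> {0..<12}"] by blast
    then have "A = C" using inj_onD[OF even_code_inj] A golay_code_subset_even_code by metis
    then show "A \<in> golay_code" using C(1) by simp
  qed
qed

lemma card_golay_code: "card golay_code \<le> 4096" and finite_golay_code: "finite golay_code"
proof -
  have "card even_code \<le> card (Pow {0..<12 :: nat})" by (rule card_inj_on_le[OF even_code_inj]) auto
  then show "card golay_code \<le> 4096" unfolding even_code_eq by (simp add: card_Pow)
  show "finite golay_code" unfolding even_code_eq[symmetric]
    by (rule finite_subset[of _ "Pow golay_points"]) (auto simp: even_code_def finite_points)
qed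

end

lemma galois_perm_group_permutes: "\<pi> \<in> galois_perm_group f \<Longrightarrow> \<pi> permutes ac_roots f"
  by (simp add: galois_perm_group_def)

section \<open>Frobenius elements of the Galois group\<close>

text \<open>
  The action of \<open>G\<close> on the points, after relabelling by \<open>h\<close>.
\<close>

definition transport :: "'a set \<Rightarrow> ('a \<Rightarrow> 'a) set \<Rightarrow> ('a \<Rightarrow> nat) \<Rightarrow> (nat \<Rightarrow> nat) set" where
  "transport A G h = {\<rho>. \<rho> permutes golay_points \<and> (\<exists>\<pi>\<in>G. \<forall>x\<in>A. \<rho> (h x) = h (\<pi> x))}"

lemma transport_exists:
  assumes h: "bij_betw h A golay_points" and \<pi>: "\<pi> \<in> G" "\<pi> permutes A"
  obtains \<rho> where "\<rho> \<in> transport A G h" "\<And>x. x \<in> A \<Longrightarrow> \<rho> (h x) = h (\<pi> x)"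
proof -
  define \<rho> where "\<rho> i = (if i \<in> golay_points then h (\<pi> (inv_into A h i)) else i)" for i
  have \<rho>h: "\<rho> (h x) = h (\<pi> x)" if "x \<in> A" for x
    using h that by (simp add: \<rho>_def bij_betw_def inv_into_f_f) blast
  have "bij_betw \<rho> golay_points golay_points"
  proof -
    have "bij_betw (h \<circ> \<pi> \<circ> inv_into A h) golay_points golay_points"
      using h permutes_imp_bij[OF \<pi>(2)] bij_betw_inv_into[OF h] bij_betw_trans by metis
    then show ?thesis by (rule bij_betw_cong[THEN iffD1, rotated]) (simp add: \<rho>_def)
  qed
  then have "\<rho> permutes golay_points" by (rule bij_imp_permutes) (simp add: \<rho>_def)
  then have "\<rho> \<in> transport A G h" using \<rho>h \<pi>(1) unfolding transport_def by blast
  then show thesis using that \<rho>h by blast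
qed

lemma transport_comp:
  assumes "\<And>\<pi>. \<pi> \<in> G \<Longrightarrow> \<pi> permutes A" "\<And>\<pi> \<pi>'. \<pi> \<in> G \<Longrightarrow> \<pi>' \<in> G \<Longrightarrow> \<pi> \<circ> \<pi>' \<in> G"
    and \<rho>: "\<rho> \<in> transport A G h" "\<rho>' \<in> transport A G h"
  shows "\<rho> \<circ> \<rho>' \<in> transport A G h"
proof -
  obtain \<pi> \<pi>' where \<pi>: "\<pi> \<in> G" "\<forall>x\<in>A. \<rho> (h x) = h (\<pi> x)" and \<pi>': "\<pi>' \<in> G" "\<forall>x\<in>A. \<rho>' (h x) = h (\<pi>' x)"
    using \<rho> unfolding transport_def by blast
  have "(\<rho> \<circ> \<rho>') (h x) = h ((\<pi> \<circ> \<pi>') x)" if "x \<in> A" for x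
    using that \<pi>(2) \<pi>'(2) permutes_in_image[OF assms(1)[OF \<pi>'(1)], of x] by simp
  moreover have "\<rho> \<circ> \<rho>' permutes golay_points" using \<rho> by (simp add: transport_def permutes_compose)
  ultimately show ?thesis unfolding transport_def using assms(2)[OF \<pi>(1) \<pi>'(1)] by blast
qed

definition trinomial :: "base_field poly" where
  "trinomial = Polynomial.monom 1 24 + Polynomial.monom 1 1 + [:to_fract [:0, 1:]:]"

lemma roots: "ac_roots trinomial = root_set generic"
  unfolding trinomial_def by (rule ac_roots_trinomial)

locale labelled_roots =
  fixes h :: "base_field alg_closure \<Rightarrow> nat"
  assumes h: "bij_betw h (root_set generic) golay_points"
begin

definition H :: "(nat \<Rightarrow> nat) set" where
  "H = transport (root_set generic) (galois_perm_group trinomial) h"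

text \<open>
  The cycles of this element on the roots are those of the Frobenius map on the roots of \<open>x ^ 24 + x + c\<close>, and they can be read
  off from the numbers of roots in the extensions of the field with \<open>2 ^ e\<close> elements.
\<close>

theorem frobenius_element:
  fixes c :: "'k::{alg_closed_field,field_char_2}"
  assumes "c ^ 2 ^ e = c"
  obtains p where "p \<in> H" "\<And>n. card (Fix (p ^^ n)) = card {a \<in> root_set c. a ^ 2 ^ (e * n) = a}"
proof -
  obtain r \<chi> where r: "bij_betw r (root_set generic) (root_set c)"
    and \<chi>: "unital_hom \<chi>" "\<And>a. \<chi> (to_ac a) = to_ac a"
    and r\<chi>: "\<And>x. x \<in> root_set generic \<Longrightarrow> r (\<chi> x) = r x ^ 2 ^ e"
    using reduction_at_point[OF assms] by metis
  define \<pi> where "\<pi> x = (if x \<in> root_set generic then \<chi> x else x)" for x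
  have \<pi>: "\<pi> \<in> galois_perm_group trinomial"
    using galois_perm_group_of_hom[OF \<chi>, of trinomial] finite_root_set unfolding roots \<pi>_def by blast
  have perm: "\<pi> permutes root_set generic" using galois_perm_group_permutes[OF \<pi>] unfolding roots .
  obtain p where p: "p \<in> H" "\<And>x. x \<in> root_set generic \<Longrightarrow> p (h x) = h (\<pi> x)"
    using transport_exists[OF h \<pi> perm] unfolding H_def by blast
  have mem: "(\<pi> ^^ n) x \<in> root_set generic" if "x \<in> root_set generic" for n x
    using that permutes_in_image[OF perm] by (induction n) auto
  have pn: "(p ^^ n) (h x) = h ((\<pi> ^^ n) x)" if "x \<in> root_set generic" for n x
    using that p(2) mem by (induction n) auto
  have rn: "r ((\<pi> ^^ n) x) = r x ^ 2 ^ (e * n)" if "x \<in> root_set generic" for n x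
  proof (induction n)
    case (Suc n)
    have "r ((\<pi> ^^ Suc n) x) = r ((\<pi> ^^ n) x) ^ 2 ^ e"
      using mem[OF that, of n] r\<chi>[OF mem[OF that, of n]] by (simp add: \<pi>_def)
    then show ?case unfolding Suc by (simp flip: power_mult power_add add: add.commute)
  qed simp
  have "card (Fix (p ^^ n)) = card {a \<in> root_set c. a ^ 2 ^ (e * n) = a}" for n
  proof (rule bij_betw_same_card)
    let ?X = "{x \<in> root_set generic. (\<pi> ^^ n) x = x}"
    have "bij_betw r ?X {a \<in> root_set c. a ^ 2 ^ (e * n) = a}"
    proof (rule bij_betw_subset[OF r])
      have *: "r x ^ 2 ^ (e * n) = r x \<longleftrightarrow> (\<pi> ^^ n) x = x" if "x \<in> root_set generic" for x
        unfolding rn[OF that, symmetric] using r mem[OF that] that by (auto simp: bij_betw_def inj_on_def)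
      have image: "root_set c = r ` root_set generic" using r by (simp add: bij_betw_def)
      show "r ` ?X = {a \<in> root_set c. a ^ 2 ^ (e * n) = a}" unfolding image using * by blast
    qed blast
    moreover have "bij_betw h ?X (Fix (p ^^ n))"
    proof (rule bij_betw_subset[OF h])
      have *: "(p ^^ n) (h x) = h x \<longleftrightarrow> (\<pi> ^^ n) x = x" if "x \<in> root_set generic" for x
        unfolding pn[OF that] using h mem[OF that] that by (auto simp: bij_betw_def inj_on_def)
      have image: "golay_points = h ` root_set generic" using h by (simp add: bij_betw_def)
      show "h ` ?X = Fix (p ^^ n)" unfolding Fix_def image using * by blast
    qed blast
    ultimately show "bij_betw (r \<circ> inv_into ?X h) (Fix (p ^^ n)) {a \<in> root_set c. a ^ 2 ^ (e * n) = a}"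
      using bij_betw_trans bij_betw_inv_into by blast
  qed
  then show thesis using that p(1) by blast
qed

end

text \<open>
  Reduction at \<open>t = 0\<close> identifies the roots with 0 and the 23rd roots of unity. A relation among the roots then
  becomes a set of even size whose labels have sum zero, that is, a word of the Golay code. There are at
  least \<open>2 ^ 12\<close> relations and at most \<open>2 ^ 12\<close> words, so the relations are the Golay code.
\<close>

theorem golay_labelling_exists:
  obtains h where "bij_betw h (root_set generic) golay_points"
    "transport (root_set generic) (galois_perm_group trinomial) h \<subseteq> M24"
proof -
  let ?R = "root_set generic"
  obtain z :: "bit alg_closure" where z: "z ^ 23 = 1" "z \<noteq> 1" "(\<Sum>n\<leftarrow>nonresidues. z ^ n) = 0"
    using sum_nonresidues_exists by blast
  interpret root_labelling z by unfold_locales (rule z)+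
  have "(0 :: bit alg_closure) ^ 2 ^ 0 = 0" by simp
  then obtain r where r: "bij_betw r ?R (root_set (0 :: bit alg_closure))"
    and rel: "\<And>S. S \<subseteq> ?R \<Longrightarrow> \<Sum>S = 0 \<Longrightarrow> sum r S = 0 \<and> even (card S)"
    using reduction_at_point by metis
  define h where "h = inv_into golay_points label \<circ> r"
  have h: "bij_betw h ?R golay_points"
    unfolding h_def by (rule bij_betw_trans[OF r bij_betw_inv_into[OF label_bij]])
  have label_h: "label (h x) = r x" if "x \<in> ?R" for x
    using that r label_bij unfolding h_def by (metis bij_betw_apply bij_betw_inv_into_right comp_apply)
  have inj: "inj_on h S" if "S \<subseteq> ?R" for S using h that by (auto simp: bij_betw_def intro: inj_on_subset)
  define C where "C = {S. S \<subseteq> ?R \<and> \<Sum>S = 0}"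
  have sub: "(\<lambda>S. h ` S) ` C \<subseteq> golay_code"
  proof safe
    fix S assume "S \<in> C"
    then have S: "S \<subseteq> ?R" "\<Sum>S = 0" by (auto simp: C_def)
    have "sum label (h ` S) = sum r S"
      using S(1) label_h by (simp add: sum.reindex[OF inj[OF S(1)]] subset_iff)
    moreover have "h ` S \<subseteq> golay_points" using S(1) h by (auto simp: bij_betw_def)
    ultimately have "h ` S \<in> even_code" using rel[OF S] card_image[OF inj[OF S(1)]] by (simp add: even_code_def)
    then show "h ` S \<in> golay_code" by (simp add: even_code_eq)
  qed
  have inj_C: "inj_on (\<lambda>S. h ` S) C"
    by (rule inj_on_subset[OF inj_on_image_Pow[OF inj[OF subset_refl]]]) (auto simp: C_def)
  have code: "(\<lambda>S. h ` S) ` C = golay_code"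
  proof (rule card_seteq[OF finite_golay_code sub])
    have "card golay_code \<le> 4096" by (rule card_golay_code)
    also have "4096 \<le> card C" unfolding C_def by (rule card_root_relations)
    finally show "card golay_code \<le> card ((\<lambda>S. h ` S) ` C)" by (simp add: card_image[OF inj_C])
  qed
  have "\<rho> \<in> M24" if \<rho>: "\<rho> \<in> transport ?R (galois_perm_group trinomial) h" for \<rho>
  proof -
    from \<rho> obtain \<pi> where \<pi>: "\<pi> \<in> galois_perm_group trinomial" "\<forall>x\<in>?R. \<rho> (h x) = h (\<pi> x)" and perm: "\<rho> permutes golay_points"
      unfolding transport_def by blast
    have "\<rho> ` D \<in> golay_code" if "D \<in> golay_code" for D
    proof -
      from that obtain S where S: "S \<subseteq> ?R" "\<Sum>S = 0" "D = h ` S" unfolding code[symmetric] C_def by blast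
      have "\<pi> ` ?R = ?R"
        using permutes_image[OF galois_perm_group_permutes[OF \<pi>(1)]] unfolding roots .
      then have "\<pi> ` S \<subseteq> ?R" using image_mono[OF S(1), of \<pi>] by (simp only:)
      moreover have "\<Sum>(\<pi> ` S) = 0"
        by (rule galois_perm_group_sum_eq_0[OF \<pi>(1) _ S(2)]) (simp only: roots S(1))
      moreover have "\<rho> ` D = h ` (\<pi> ` S)" unfolding S(3) image_image using \<pi>(2) S(1) by (intro image_cong) auto
      ultimately show ?thesis unfolding code[symmetric] C_def by blast
    qed
    moreover have "inj_on (\<lambda>D. \<rho> ` D) golay_code"
      using permutes_inj[OF perm] by (auto intro!: inj_onI simp: inj_image_eq_iff)
    ultimately have "(\<lambda>D. \<rho> ` D) ` golay_code = golay_code"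
      by (intro endo_inj_surj[OF finite_golay_code]) auto
    then show ?thesis using perm by (simp add: M24_def)
  qed
  then show thesis using that h by blast
qed

lemma M24_funpow: "p \<in> M24 \<Longrightarrow> p ^^ n \<in> M24"
proof (induction n)
  case 0
  have "id \<in> M24" by (simp add: M24_def permutes_id)
  then show ?case by (simp add: id_def)
qed (simp add: M24_comp)

lemma Fix_full: assumes "p \<in> M24" "card (Fix p) = 24" shows "p = id"
proof -
  have "Fix p = golay_points" using assms(2) by (intro card_subset_eq finite_points) (auto simp: Fix_def card_points)
  then have "p x = x" for x
    using M24_permutes[OF assms(1)] by (cases "x \<in> golay_points") (auto simp: Fix_def permutes_def)
  then show ?thesis by auto
qed

text \<open>
  Apply \<open>card_cong_fixed_points\<close> to \<open>p ^^ m\<close> acting on the fixed points of its \<open>r\<close>-th power.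
\<close>

lemma Fix_funpow_cong:
  assumes "p \<in> M24" "prime r"
  shows "[card (Fix (p ^^ (m * r))) = card (Fix (p ^^ m))] (mod r)"
proof -
  let ?u = "p ^^ m"
  have u: "?u ^^ r = p ^^ (m * r)" by (simp only: funpow_mult)
  have "[card (Fix (?u ^^ r)) = card {x \<in> Fix (?u ^^ r). ?u x = x}] (mod r)"
  proof (rule card_cong_fixed_points[OF finite_Fix _ _ assms(2)])
    show "inj ?u" by (rule M24_inj[OF M24_funpow[OF assms(1)]])
    show "?u ` Fix (?u ^^ r) \<subseteq> Fix (?u ^^ r)"
      using M24_point[OF M24_funpow[OF assms(1)], of m] by (auto simp: Fix_def funpow_swap1[symmetric])
    show "x \<in> Fix (?u ^^ r) \<Longrightarrow> (?u ^^ r) x = x" for x by (simp add: Fix_def)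
  qed
  moreover have "{x \<in> Fix (?u ^^ r). ?u x = x} = Fix ?u" by (auto simp: Fix_def funpow_fixed)
  ultimately show ?thesis unfolding u by simp
qed

lemma Fix_not_almost_full:
  assumes "p \<in> M24" shows "card (Fix p) \<notin> {19, 21, 22}"
proof
  assume *: "card (Fix p) \<in> {19, 21, 22}"
  then have "p = id" using M24_small_support[OF assms] by (auto simp: card_moved)
  then have "Fix p = golay_points" by (simp add: Fix_def)
  then show False using * card_points by simp
qed

lemma card_Fix_le: "card (Fix p) \<le> 24"
  using card_mono[OF finite_points, of "Fix p"] by (auto simp: Fix_def card_points)

lemma fixed_point_counts:
  fixes n :: nat
  shows "n \<le> 9 \<Longrightarrow> [24 = n] (mod 7) \<Longrightarrow> [n = 1] (mod 2) \<Longrightarrow> n = 3"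
    and "n \<le> 24 \<Longrightarrow> [24 = n] (mod 2) \<Longrightarrow> [n = 1] (mod 7) \<Longrightarrow> n \<noteq> 22 \<Longrightarrow> n = 8"
    and "n \<le> 24 \<Longrightarrow> [24 = n] (mod 5) \<Longrightarrow> [n = 1] (mod 3) \<Longrightarrow> n \<noteq> 19 \<Longrightarrow> n = 4"
    and "n \<le> 24 \<Longrightarrow> [24 = n] (mod 3) \<Longrightarrow> [n = 1] (mod 5) \<Longrightarrow> n \<noteq> 21 \<Longrightarrow> n = 6"
proof -
  have cases: "n \<le> 24 \<Longrightarrow> n \<in> set (24 # [0..<24])" by auto
  show "n \<le> 9 \<Longrightarrow> [24 = n] (mod 7) \<Longrightarrow> [n = 1] (mod 2) \<Longrightarrow> n = 3"
    using cases unfolding points_list list.set by (elim meta_impE insertE emptyE) (simp_all add: cong_def)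
  show "n \<le> 24 \<Longrightarrow> [24 = n] (mod 2) \<Longrightarrow> [n = 1] (mod 7) \<Longrightarrow> n \<noteq> 22 \<Longrightarrow> n = 8"
    using cases unfolding points_list list.set by (elim meta_impE insertE emptyE) (simp_all add: cong_def)
  show "n \<le> 24 \<Longrightarrow> [24 = n] (mod 5) \<Longrightarrow> [n = 1] (mod 3) \<Longrightarrow> n \<noteq> 19 \<Longrightarrow> n = 4"
    using cases unfolding points_list list.set by (elim meta_impE insertE emptyE) (simp_all add: cong_def)
  show "n \<le> 24 \<Longrightarrow> [24 = n] (mod 3) \<Longrightarrow> [n = 1] (mod 5) \<Longrightarrow> n \<noteq> 21 \<Longrightarrow> n = 6"
    using cases unfolding points_list list.set by (elim meta_impE insertE emptyE) (simp_all add: cong_def)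
qed

locale labelled_golay_roots = labelled_roots +
  assumes H_M24: "H \<subseteq> M24"
begin

text \<open>
  For \<open>c = 0\<close> the linearized equation is \<open>x ^ 2048 = x\<close>; the cycle type is \<open>1\<^sup>2 11\<^sup>2\<close>.
\<close>

lemma frobenius_at_0: obtains p where "p \<in> H" "p ^^ 11 = id" "card (Fix p) = 2"
proof -
  have "(0 :: bit alg_closure) ^ 2 ^ 1 = 0" by simp
  from frobenius_element[OF this] obtain p where p: "p \<in> H"
    "\<And>n. card (Fix (p ^^ n)) = card {a \<in> root_set (0 :: bit alg_closure). a ^ 2 ^ (1 * n) = a}" by blast
  have "{a \<in> root_set (0 :: bit alg_closure). a ^ 2 ^ (1 * 11) = a} = root_set 0"
    using linearized[where c = "0 :: bit alg_closure"] by auto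
  then have "card (Fix (p ^^ 11)) = 24" using p(2)[of 11] card_root_set by metis
  then have "p ^^ 11 = id" using Fix_full M24_funpow H_M24 p(1) by blast
  moreover have "{a \<in> root_set (0 :: bit alg_closure). a ^ 2 ^ (1 * 1) = a} = {0, 1}"
    by (auto simp: root_set_def one_plus_one power2_eq_square)
  then have "card (Fix p) = 2" using p(2)[of 1] by simp
  ultimately show thesis using that p(1) by blast
qed

text \<open>
  A root of \<open>x ^ 24 + x + 1\<close> does not lie in the field with four elements.
\<close>

lemma frobenius_at_1: obtains p where "p \<in> H" "Fix (p ^^ 2) = {}"
proof -
  have "(1 :: bit alg_closure) ^ 2 ^ 1 = 1" by simp
  from frobenius_element[OF this] obtain p where p: "p \<in> H"
    "\<And>n. card (Fix (p ^^ n)) = card {a \<in> root_set (1 :: bit alg_closure). a ^ 2 ^ (1 * n) = a}" by blast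
  have "a ^ 4 \<noteq> a" if a: "a \<in> root_set (1 :: bit alg_closure)" for a
  proof
    assume a4: "a ^ 4 = a"
    have "a ^ 24 = (a ^ 4) ^ 6" by (simp flip: power_mult)
    also have "\<dots> = a ^ 6" unfolding a4 ..
    also have "\<dots> = a ^ 4 * a ^ 2" by (simp flip: power_add)
    also have "\<dots> = a ^ 3" unfolding a4 by (simp add: power2_eq_square power3_eq_cube mult.assoc)
    finally have "a ^ 3 + a + 1 = 0" using a by (simp add: root_set_def)
    then have "a * (a ^ 3 + a + 1) = 0" by simp
    then have "a ^ 4 + a ^ 2 + a = 0" by (simp add: distrib_left power2_eq_square flip: power_Suc)
    then have "a = 0" using a4 by (simp add: two_eq_0)
    then show False using a by (simp add: root_set_def)
  qed
  then have "{a \<in> root_set (1 :: bit alg_closure). a ^ 2 ^ (1 * 2) = a} = {}" by auto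
  then have "card (Fix (p ^^ 2)) = 0" using p(2)[of 2] by (metis card.empty)
  then show thesis using that p(1) finite_Fix by auto
qed

text \<open>
  The cycle type is \<open>1 2 7 14\<close>. The period 14 comes from \<open>frobenius_period_cube_root\<close>. In the field with four
  elements \<open>z + 1\<close> is the only root; in the field with 16 elements \<open>x ^ 24 = x ^ 9\<close>, so there are at most nine.
  The remaining ambiguity is removed by congruences and by the absence of transpositions from M24.
\<close>

lemma frobenius_at_cube_root:
  obtains p where "p \<in> H" "p ^^ 14 = id" "card (Fix p) = 1" "card (Fix (p ^^ 2)) = 3" "card (Fix (p ^^ 7)) = 8"
proof -
  obtain z :: "bit alg_closure" where "poly [:1, 1, 1:] z = 0"
    using alg_closed_imp_poly_has_root[of "[:1, 1, 1:] :: bit alg_closure poly"] by auto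
  then have z: "1 + z + z ^ 2 = 0" by (simp add: power2_eq_square distrib_left add.assoc)
  have z2: "z ^ 2 = z + 1" using z by (metis add.commute add_eq_0_iff_char_2)
  have "z ^ 2 ^ 2 = (z ^ 2) ^ 2" by (simp flip: power_mult)
  then have z4: "z ^ 2 ^ 2 = z" unfolding z2 power2_add by (simp add: z2 add.assoc)
  from frobenius_element[OF z4] obtain p where p: "p \<in> H"
    "\<And>n. card (Fix (p ^^ n)) = card {a \<in> root_set z. a ^ 2 ^ (2 * n) = a}" by blast
  have pM: "p \<in> M24" using p(1) H_M24 by blast
  have "{a \<in> root_set z. a ^ 2 ^ (2 * 14) = a} = root_set z"
    using frobenius_period_cube_root[OF z] by auto
  then have 14: "card (Fix (p ^^ 14)) = 24" using p(2)[of 14] card_root_set by metis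
  have "{a \<in> root_set z. a ^ 2 ^ (2 * 1) = a} = {z + 1}"
  proof safe
    fix a assume a: "a \<in> root_set z" "a ^ 2 ^ (2 * 1) = a"
    have a4: "a ^ 4 = a" using a(2) by simp
    have "a \<noteq> 0" using a(1) z by (auto simp: root_set_def)
    moreover have "a * a ^ 3 = a * 1" using a4 by (simp flip: power_Suc)
    ultimately have "a ^ 3 = 1" by (metis mult_left_cancel)
    then have "a ^ 24 = 1" using power_mult[of a 3 8] by simp
    then have "(a + (z + 1)) = 0" using a(1) by (simp add: root_set_def ac_simps)
    then show "a = z + 1" by (simp only: add_eq_0_iff_char_2)
  next
    have z1: "z + 1 = z ^ 2" using z2 by simp
    have z3: "z ^ 3 = 1" using z2 by (simp add: power3_eq_cube power2_eq_square algebra_simps)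
    have "(z + 1) ^ 24 = 1" unfolding z1 using z3 power_mult[of z 3 16] by (simp flip: power_mult)
    then show "z + 1 \<in> root_set z" by (simp add: root_set_def ac_simps one_plus_one)
    show "(z + 1) ^ 2 ^ (2 * 1) = z + 1" using z4 by (simp only: frobenius_add power_one mult_1_right)
  qed
  then have 1: "card (Fix p) = 1" using p(2)[of 1] by simp
  have "card (Fix (p ^^ 2)) \<le> 9"
  proof -
    define P where "P = Polynomial.monom 1 9 + [:z, 1:]"
    have deg: "Polynomial.degree P = 9" unfolding P_def by (subst degree_add_eq_left) (auto simp: degree_monom_eq)
    have "{a \<in> root_set z. a ^ 2 ^ (2 * 2) = a} \<subseteq> {a. poly P a = 0}"
    proof safe
      fix a assume a: "a \<in> root_set z" "a ^ 2 ^ (2 * 2) = a"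
      have "a ^ 24 = a ^ 16 * a ^ 8" by (simp flip: power_add)
      also have "\<dots> = a ^ 9" using a(2) by (simp flip: power_Suc)
      finally show "poly P a = 0" using a(1) by (simp add: P_def root_set_def poly_monom algebra_simps)
    qed
    moreover have P0: "P \<noteq> 0" using deg by auto
    ultimately have "card (Fix (p ^^ 2)) \<le> card {a. poly P a = 0}"
      unfolding p(2) by (intro card_mono poly_roots_finite)
    also have "\<dots> \<le> 9" using card_poly_roots_bound[OF P0] deg by simp
    finally show ?thesis .
  qed
  moreover have "[24 = card (Fix (p ^^ 2))] (mod 7)" using Fix_funpow_cong[OF pM, of 7 2] 14 by simp
  moreover have "[card (Fix (p ^^ 2)) = 1] (mod 2)" using Fix_funpow_cong[OF pM, of 2 1] 1 by simp
  ultimately have 2: "card (Fix (p ^^ 2)) = 3" by (rule fixed_point_counts(1))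
  have "[24 = card (Fix (p ^^ 7))] (mod 2)" using Fix_funpow_cong[OF pM, of 2 7] 14 by simp
  moreover have "[card (Fix (p ^^ 7)) = 1] (mod 7)" using Fix_funpow_cong[OF pM, of 7 1] 1 by simp
  moreover have "card (Fix (p ^^ 7)) \<noteq> 22" using Fix_not_almost_full[OF M24_funpow[OF pM]] by blast
  ultimately have 7: "card (Fix (p ^^ 7)) = 8" by (rule fixed_point_counts(2)[OF card_Fix_le])
  show thesis using that[OF p(1) Fix_full[OF M24_funpow[OF pM] 14] 1 2 7] .
qed

text \<open>
  The cycle type is \<open>1 3 5 15\<close>. In the field with 16 elements \<open>z + z ^ 3\<close> is the only root: there
  \<open>x ^ 9 = x + z\<close>, and the square of this equation is \<open>x ^ 3 = x ^ 2 + z ^ 2\<close>. Eliminating \<open>x ^ 9\<close> leaves a quadratic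
  and then a linear equation. The other numbers follow from congruences, as M24 contains no 3-cycles or 5-cycles.
\<close>

lemma frobenius_at_fifth_root:
  obtains p where "p \<in> H" "p ^^ 15 = id" "card (Fix p) = 1" "card (Fix (p ^^ 3)) = 4" "card (Fix (p ^^ 5)) = 6"
proof -
  obtain z :: "bit alg_closure" where "poly [:1, 1, 1, 1, 1:] z = 0"
    using alg_closed_imp_poly_has_root[of "[:1, 1, 1, 1, 1:] :: bit alg_closure poly"] by auto
  then have z: "1 + z + z ^ 2 + z ^ 3 + z ^ 4 = 0" by (simp add: eval_nat_numeral distrib_left add.assoc)
  have "z ^ 5 + 1 = (1 + z + z ^ 2 + z ^ 3 + z ^ 4) * (z + 1)"
    by (simp add: eval_nat_numeral algebra_simps)
  then have z5: "z ^ 5 = 1" unfolding z by (simp add: add_eq_0_iff_char_2)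
  then have z0: "z \<noteq> 0" by auto
  note reduce = power_mod_order[OF z5]
  have z16: "z ^ 2 ^ 4 = z" using reduce[of 16] by simp
  from frobenius_element[OF z16] obtain p where p: "p \<in> H"
    "\<And>n. card (Fix (p ^^ n)) = card {a \<in> root_set z. a ^ 2 ^ (4 * n) = a}" by blast
  have pM: "p \<in> M24" using p(1) H_M24 by blast
  have "{a \<in> root_set z. a ^ 2 ^ (4 * 15) = a} = root_set z"
    using frobenius_period_fifth_root[OF z] by auto
  then have 15: "card (Fix (p ^^ 15)) = 24" using p(2)[of 15] card_root_set by metis
  have "{a \<in> root_set z. a ^ 2 ^ (4 * 1) = a} = {z + z ^ 3}"
  proof safe
    fix a assume a: "a \<in> root_set z" "a ^ 2 ^ (4 * 1) = a"
    have "a ^ 24 = a ^ 16 * a ^ 8" by (simp flip: power_add)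
    also have "\<dots> = a ^ 9" using a(2) by (simp flip: power_Suc)
    finally have "a ^ 9 + (a + z) = 0" using a(1) by (simp add: root_set_def add.assoc)
    then have a9: "a ^ 9 = a + z" unfolding add_eq_0_iff_char_2 .
    have a16: "a ^ 16 = a" using a(2) by simp
    have "(a ^ 9) ^ 2 = a ^ 16 * a ^ 2" by (simp flip: power_add power_mult)
    also have "\<dots> = a ^ 3" unfolding a16 by (simp add: power3_eq_cube power2_eq_square mult.assoc)
    finally have a3: "a ^ 3 = a ^ 2 + z ^ 2" unfolding a9 power2_add by simp
    have a4: "a ^ 4 = a ^ 2 + z ^ 2 + z ^ 2 * a"
    proof -
      have "a ^ 4 = a * a ^ 3" by (simp flip: power_Suc)
      also have "\<dots> = a * (a ^ 2 + z ^ 2)" unfolding a3 ..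
      also have "\<dots> = a ^ 3 + z ^ 2 * a" by (simp add: algebra_simps power2_eq_square power3_eq_cube)
      finally show ?thesis unfolding a3 .
    qed
    have "a ^ 9 = (a ^ 3) ^ 3" by (simp flip: power_mult)
    also have "\<dots> = (a ^ 2 + z ^ 2) ^ 2 * (a ^ 2 + z ^ 2)" unfolding a3 by (simp add: power3_eq_cube power2_eq_square)
    also have "\<dots> = (a ^ 4 + z ^ 4) * (a ^ 2 + z ^ 2)" by (simp add: power2_add flip: power_mult)
    also have "\<dots> = (a ^ 3) ^ 2 + a ^ 4 * z ^ 2 + z ^ 4 * a ^ 2 + z ^ 6" by (simp add: algebra_simps flip: power_add power_mult)
    also have "\<dots> = a ^ 4 * (1 + z ^ 2) + z ^ 4 + z ^ 4 * a ^ 2 + z"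
      unfolding a3 power2_add using reduce[of 6] by (simp add: algebra_simps flip: power_mult)
    finally have eq: "a ^ 4 * (1 + z ^ 2) + z ^ 4 + z ^ 4 * a ^ 2 + z = a + z" unfolding a9 by simp
    have "(1 + z ^ 2 + z ^ 4) * (a ^ 2 + a) + z ^ 2 = a ^ 4 * (1 + z ^ 2) + z ^ 4 + z ^ 4 * a ^ 2 + z + (a + z)"
      unfolding a4 by (simp add: algebra_simps flip: power_add)
    also have "\<dots> = 0" unfolding eq by simp
    finally have "(1 + z ^ 2 + z ^ 4) * (a ^ 2 + a) = z ^ 2" unfolding add_eq_0_iff_char_2 .
    moreover have "1 + z ^ 2 + z ^ 4 = z + z ^ 3"
      using z unfolding add_eq_0_iff_char_2[symmetric, of "1 + z ^ 2 + z ^ 4"] by (simp add: ac_simps)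
    ultimately have "(z + z ^ 3) * (a ^ 2 + a) = z ^ 2" by (simp only:)
    moreover have "(z + z ^ 3) * (a ^ 2 + a) = z * ((1 + z ^ 2) * (a ^ 2 + a))"
      by (simp add: algebra_simps power2_eq_square power3_eq_cube)
    ultimately have "z * ((1 + z ^ 2) * (a ^ 2 + a)) = z * z" by (simp only: power2_eq_square)
    then have "(1 + z ^ 2) * (a ^ 2 + a) = z" using z0 by simp
    then have "a * ((1 + z ^ 2) * (a ^ 2 + a)) = a * z" by simp
    moreover have "a * ((1 + z ^ 2) * (a ^ 2 + a)) = (1 + z ^ 2) * (a ^ 3 + a ^ 2)"
      by (simp add: algebra_simps power2_eq_square power3_eq_cube)
    moreover have "a ^ 3 + a ^ 2 = z ^ 2" unfolding a3 by (simp add: add.commute)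
    ultimately have "a * z = (1 + z ^ 2) * z ^ 2" by (simp only:)
    also have "\<dots> = (z + z ^ 3) * z" by (simp add: algebra_simps power2_eq_square power3_eq_cube)
    finally have "a * z = (z + z ^ 3) * z" .
    then show "a = z + z ^ 3" using z0 by simp
  next
    have "(z + z ^ 3) ^ 24 = ((z + z ^ 3) ^ 2 ^ 3) ^ 3" by (simp flip: power_mult)
    also have "(z + z ^ 3) ^ 2 ^ 3 = z ^ 3 + z ^ 4"
      unfolding frobenius_add using reduce[of 8] reduce[of 24] by (simp flip: power_mult)
    also have "(z ^ 3 + z ^ 4) ^ 3 = z ^ 9 * (1 + z + z ^ 2 + z ^ 3)"
      by (simp add: power3_eq_cube[of "z ^ 3 + z ^ 4"] distrib_left distrib_right ac_simps flip: power_add power_Suc)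
    also have "1 + z + z ^ 2 + z ^ 3 = z ^ 4" using z unfolding add_eq_0_iff_char_2 .
    also have "z ^ 9 * z ^ 4 = z ^ 3" using reduce[of 13] by (simp flip: power_add)
    finally show "z + z ^ 3 \<in> root_set z" by (simp add: root_set_def ac_simps)
    show "(z + z ^ 3) ^ 2 ^ (4 * 1) = z + z ^ 3"
      unfolding frobenius_add using reduce[of 16] reduce[of 48] by (simp flip: power_mult)
  qed
  then have 1: "card (Fix p) = 1" using p(2)[of 1] by simp
  have "[24 = card (Fix (p ^^ 3))] (mod 5)" using Fix_funpow_cong[OF pM, of 5 3] 15 by simp
  moreover have "[card (Fix (p ^^ 3)) = 1] (mod 3)" using Fix_funpow_cong[OF pM, of 3 1] 1 by simp
  moreover have "card (Fix (p ^^ 3)) \<noteq> 19" using Fix_not_almost_full[OF M24_funpow[OF pM]] by blast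
  ultimately have 3: "card (Fix (p ^^ 3)) = 4" by (rule fixed_point_counts(3)[OF card_Fix_le])
  have "[24 = card (Fix (p ^^ 5))] (mod 3)" using Fix_funpow_cong[OF pM, of 3 5] 15 by simp
  moreover have "[card (Fix (p ^^ 5)) = 1] (mod 5)" using Fix_funpow_cong[OF pM, of 5 1] 1 by simp
  moreover have "card (Fix (p ^^ 5)) \<noteq> 21" using Fix_not_almost_full[OF M24_funpow[OF pM]] by blast
  ultimately have 5: "card (Fix (p ^^ 5)) = 6" by (rule fixed_point_counts(4)[OF card_Fix_le])
  show thesis using that[OF p(1) Fix_full[OF M24_funpow[OF pM] 15] 1 3 5] .
qed

theorem M24_subset_H: "M24 \<subseteq> H"
proof -
  obtain p where p: "p \<in> H" "p ^^ 11 = id" "card (Fix p) = 2" by (rule frobenius_at_0)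
  obtain q where q: "q \<in> H" "Fix (q ^^ 2) = {}" by (rule frobenius_at_1)
  obtain s where s: "s \<in> H" "s ^^ 14 = id" "card (Fix s) = 1" "card (Fix (s ^^ 2)) = 3" "card (Fix (s ^^ 7)) = 8"
    by (rule frobenius_at_cube_root)
  obtain t where t: "t \<in> H" "t ^^ 15 = id" "card (Fix t) = 1" "card (Fix (t ^^ 3)) = 4" "card (Fix (t ^^ 5)) = 6"
    by (rule frobenius_at_fifth_root)
  have "g \<circ> h' \<in> H" if "g \<in> H" "h' \<in> H" for g h'
    using that unfolding H_def
    by (rule transport_comp[rotated 2]) (auto simp: roots[symmetric] galois_perm_group_permutes intro: galois_perm_group_compose)
  then interpret M24_generators H p q s t
    by unfold_locales (use H_M24 p q s t in blast)+
  show ?thesis by (rule M24_subset)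
qed

end

theorem mainTheorem1:
  fixes t :: "bit poly fract"
  defines "t \<equiv> to_fract [:0, 1:]"
  defines "f \<equiv> Polynomial.monom 1 24 + Polynomial.monom 1 1 + [:t:]"
  shows "perm_isomorphic (ac_roots f) (galois_perm_group f) golay_points M24"
proof -
  obtain l where l: "bij_betw l (root_set generic) golay_points"
    "transport (root_set generic) (galois_perm_group trinomial) l \<subseteq> M24"
    by (rule golay_labelling_exists)
  have f: "f = trinomial" by (simp only: f_def t_def trinomial_def)
  interpret labelled_roots l by unfold_locales (rule l(1))
  interpret labelled_golay_roots l by unfold_locales (use l(2) in \<open>simp add: H_def\<close>)
  have "M24 = transport (root_set generic) (galois_perm_group trinomial) l"
    using l(2) M24_subset_H unfolding H_def by blast
  then show ?thesis
    unfolding perm_isomorphic_def f roots transport_def using l(1) by blast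
qed

end
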